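(* Let $X_t$ be any additive process in $\mathbb{R}^d$ and let $e$ be any moderate function (taken to be absolutely continuous and bounded, with $e(r)=e(1)$ for $r>1$). Define $$u(t)=a_e(t)=E\,e(X_t^* ),\qquad H(r)=e(r)^{-1},\qquad h(r)=\Big[e(r)+\int_r^1EG_{T_r}(\lambda)\,e(d\lambda)\Big]^{-1},\quad r\in(0,1),$$ and $$\delta_1=\inf\{\eta\ge0:\liminf_{r\to0}r^\eta H(r)=0\},\qquad \delta_2=\inf\{\eta\ge0:\liminf_{r\to0}r^\eta h(r)=0\},$$ $$\beta_1=\inf\{\eta\ge0:\lim_{r\to0}r^\eta h(r)=0\},\qquad \beta_2=\inf\{\eta\ge0:\lim_{r\to0}r^\eta H(r)=0\}.$$ Then, almost surely, $$\liminf_{t\to0}u(t)^{-1/\eta}X_t^*=\begin{cases}0,&\text{if }\eta>\delta_1,\\ \infty,&\text{if }\eta<\delta_2,\end{cases}\qquad \limsup_{t\to0}u(t)^{-1/\eta}X_t^*=\begin{cases}0,&\text{if }\eta>\beta_2,\\ \infty,&\text{if }\eta<\beta_1.\end{cases}$$ If, for a slow function $c$ and a moderate function $A$ (under the same convention as $e$), $$EG_{T_r}(\lambda)\le c(r)^{-1}\frac{A(r)}{A(\lambda)},\qquad 0<r\le\lambda\le1,$$ then with $e=A^{1/q}$, $q>1$, one has $$\int_r^1EG_{T_r}(\lambda)\,e(d\lambda)\le c_1(r)^{-1}e(r),\qquad r\in(0,1),$$ for some slow function $c_1$, and hence $\delta_1=\delta_2$ and $\beta_1=\beta_2$ for thi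s $e$.
   Context: $X_t^*=\sup_{0\le s\le t}|X_s|$ and $T_r=\inf\{t>0:|X_t|>r\}$ for $r>0$. Additive process in $\mathbb{R}^d$: a process with independent increments, right-continuous paths with left limits, continuous in probability, with $X_0=0$. Its Lévy kernel is $\nu_t(A)=E\sum_{s\le t}1(\Delta X_s\in A,\Delta X_s\ne0)$, $A\in\mathcal B(\mathbb{R}^d)$, and $G_t(\lambda)=\nu_t(\{x\in\mathbb{R}^d:|x|>\lambda\})$. $EG_{T_r}(\lambda)$ denotes the expectation of $G_t(\lambda)$ evaluated at the random time $t=T_r$. Moderate function: a nondecreasing right-continuous function $e$ with $e(0)=0$, $e(t)>0$ for $t>0$, for which there are constants $\rho,\sigma\in(0,\infty)$ with $e(t_2)/e(t_1)\le\rho(t_2/t_1)^\sigma$ whenever $0<t_1<t_2$. Slow function: a function $c$ on $(0,1]$ with values in $(0,1)$ and $\liminf_{r\to0}c(r)r^{-\eta}>0$ for all $\eta>0$. *)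

theory Defs
  imports "HOL-Probability.Probability"
begin

text \<open>
  Processes are indexed by \<^typ>\<open>real\<close>, but only times \<open>t \<ge> 0\<close> matter. Likewise moderate functions
  live on \<open>[0,\<infinity>)\<close> and slow functions on \<open>(0,1]\<close>; their values elsewhere are irrelevant.
\<close>

locale additive_process = prob_space M
  for M :: "'w measure" +
  fixes X :: "real \<Rightarrow> 'w \<Rightarrow> 'a :: euclidean_space"
  assumes measurable_X: "t \<ge> 0 \<Longrightarrow> X t \<in> borel_measurable M"
    and X_zero: "\<omega> \<in> space M \<Longrightarrow> X 0 \<omega> = 0"
    and right_cont: "\<omega> \<in> space M \<Longrightarrow> t \<ge> 0 \<Longrightarrow> continuous (at_right t) (\<lambda>s. X s \<omega>)"
    and left_lim: "\<omega> \<in> space M \<Longrightarrow> t > 0 \<Longrightarrow> \<exists>l. ((\<lambda>s. X s \<omega>) \<longlongrightarrow> l) (at_left t)"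
    and cont_in_prob: "t \<ge> 0 \<Longrightarrow> \<epsilon> > 0 \<Longrightarrow>
      ((\<lambda>s. prob {\<omega> \<in> space M. norm (X s \<omega> - X t \<omega>) > \<epsilon>}) \<longlongrightarrow> 0) (at t within {0..})"
    and indep_increments: "\<And>(n::nat) ts :: nat \<Rightarrow> real.
      0 \<le> ts 0 \<Longrightarrow> (\<forall>i<n. ts i < ts (Suc i)) \<Longrightarrow>
      indep_vars (\<lambda>_. borel) (\<lambda>i \<omega>. X (ts (Suc i)) \<omega> - X (ts i) \<omega>) {..<n}"

definition run_max :: "(real \<Rightarrow> 'w \<Rightarrow> 'a :: euclidean_space) \<Rightarrow> real \<Rightarrow> 'w \<Rightarrow> real" where
  "run_max X t \<omega> = (SUP s\<in>{0..t}. norm (X s \<omega>))"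

text \<open>The exit time is \<open>\<infinity>\<close> if the path never leaves the ball.\<close>

definition exit_time :: "(real \<Rightarrow> 'w \<Rightarrow> 'a :: euclidean_space) \<Rightarrow> real \<Rightarrow> 'w \<Rightarrow> ennreal" where
  "exit_time X r \<omega> = (INF t\<in>{t. t > 0 \<and> norm (X t \<omega>) > r}. ennreal t)"

definition jump :: "(real \<Rightarrow> 'w \<Rightarrow> 'a :: euclidean_space) \<Rightarrow> real \<Rightarrow> 'w \<Rightarrow> 'a" where
  "jump X s \<omega> = X s \<omega> - Lim (at_left s) (\<lambda>u. X u \<omega>)"

text \<open>
  The time argument of the Levy kernel is in \<open>[0,\<infinity>]\<close>, since it is evaluated at exit times; at \<open>\<infinity>\<close>
  the sum runs over all \<open>s > 0\<close>.
\<close>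

definition levy_kernel ::
  "'w measure \<Rightarrow> (real \<Rightarrow> 'w \<Rightarrow> 'a :: euclidean_space) \<Rightarrow> ennreal \<Rightarrow> 'a set \<Rightarrow> ennreal" where
  "levy_kernel M X t A =
     (\<integral>\<^sup>+\<omega>. (\<integral>\<^sup>+s\<in>{s. s > 0 \<and> ennreal s \<le> t}.
        indicator {s. jump X s \<omega> \<in> A \<and> jump X s \<omega> \<noteq> 0} s \<partial>count_space UNIV) \<partial>M)"

definition levy_tail ::
  "'w measure \<Rightarrow> (real \<Rightarrow> 'w \<Rightarrow> 'a :: euclidean_space) \<Rightarrow> ennreal \<Rightarrow> real \<Rightarrow> ennreal" where
  "levy_tail M X t l = levy_kernel M X t {x. norm x > l}"

definition EG ::
  "'w measure \<Rightarrow> (real \<Rightarrow> 'w \<Rightarrow> 'a :: euclidean_space) \<Rightarrow> real \<Rightarrow> real \<Rightarrow> ennreal" where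
  "EG M X r l = (\<integral>\<^sup>+\<omega>. levy_tail M X (exit_time X r \<omega>) l \<partial>M)"

definition moderate :: "(real \<Rightarrow> real) \<Rightarrow> bool" where
  "moderate e \<longleftrightarrow>
     mono_on {0..} e \<and> (\<forall>t\<ge>0. continuous (at_right t) e) \<and> e 0 = 0 \<and> (\<forall>t>0. e t > 0) \<and>
     (\<exists>\<rho>>0. \<exists>\<sigma>>0. \<forall>t1 t2. 0 < t1 \<and> t1 < t2 \<longrightarrow> e t2 / e t1 \<le> \<rho> * (t2 / t1) powr \<sigma>)"

text \<open>Absolute continuity of functions (the library only has it for measures).\<close>

definition abs_cont_on :: "real set \<Rightarrow> (real \<Rightarrow> real) \<Rightarrow> bool" where
  "abs_cont_on I f \<longleftrightarrow>
     (\<forall>\<epsilon>>0. \<exists>\<delta>>0. \<forall>(n::nat) a b.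
        (\<forall>i<n. a i \<le> b i \<and> {a i..b i} \<subseteq> I) \<and>
        disjoint_family_on (\<lambda>i. {a i<..<b i}) {..<n} \<and>
        (\<Sum>i<n. b i - a i) < \<delta>
        \<longrightarrow> (\<Sum>i<n. \<bar>f (b i) - f (a i)\<bar>) < \<epsilon>)"

definition normalized_moderate :: "(real \<Rightarrow> real) \<Rightarrow> bool" where
  "normalized_moderate e \<longleftrightarrow>
     moderate e \<and> abs_cont_on {0..} e \<and> bounded (e ` {0..}) \<and> (\<forall>r>1. e r = e 1)"

definition slow :: "(real \<Rightarrow> real) \<Rightarrow> bool" where
  "slow c \<longleftrightarrow>
     (\<forall>r\<in>{0<..1}. 0 < c r \<and> c r < 1) \<and>
     (\<forall>\<eta>>0. Liminf (at_right 0) (\<lambda>r. ereal (c r * r powr (-\<eta>))) > 0)"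

definition a_fun ::
  "'w measure \<Rightarrow> (real \<Rightarrow> 'w \<Rightarrow> 'a :: euclidean_space) \<Rightarrow> (real \<Rightarrow> real) \<Rightarrow> real \<Rightarrow> real" where
  "a_fun M X e t = (\<integral>\<omega>. e (run_max X t \<omega>) \<partial>M)"

text \<open>
  The Stieltjes integral against \<open>e(d\<lambda>)\<close> over \<open>(r,1]\<close>. As \<^const>\<open>interval_measure\<close> wants a distribution
  function on all of \<open>\<real>\<close>, \<open>e\<close> is extended to the left by \<open>e(0)\<close>.
\<close>

definition EG_int ::
  "'w measure \<Rightarrow> (real \<Rightarrow> 'w \<Rightarrow> 'a :: euclidean_space) \<Rightarrow> (real \<Rightarrow> real) \<Rightarrow> real \<Rightarrow> ennreal" where
  "EG_int M X e r = (\<integral>\<^sup>+l\<in>{r<..1}. EG M X r l \<partial>interval_measure (\<lambda>x. e (max 0 x)))"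

text \<open>\<open>h\<close> takes values in \<^typ>\<open>ennreal\<close> because the integral may be infinite, in which case \<open>h(r) = 0\<close>.\<close>

definition H_fun :: "(real \<Rightarrow> real) \<Rightarrow> real \<Rightarrow> ennreal" where
  "H_fun e r = inverse (ennreal (e r))"

definition h_fun ::
  "'w measure \<Rightarrow> (real \<Rightarrow> 'w \<Rightarrow> 'a :: euclidean_space) \<Rightarrow> (real \<Rightarrow> real) \<Rightarrow> real \<Rightarrow> ennreal" where
  "h_fun M X e r = inverse (ennreal (e r) + EG_int M X e r)"

definition liminf_index :: "(real \<Rightarrow> ennreal) \<Rightarrow> ereal" where
  "liminf_index f =
     (INF \<eta>\<in>{\<eta>. \<eta> \<ge> 0 \<and> Liminf (at_right 0) (\<lambda>r. ennreal (r powr \<eta>) * f r) = 0}. ereal \<eta>)"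

definition lim_index :: "(real \<Rightarrow> ennreal) \<Rightarrow> ereal" where
  "lim_index f =
     (INF \<eta>\<in>{\<eta>. \<eta> \<ge> 0 \<and> ((\<lambda>r. ennreal (r powr \<eta>) * f r) \<longlongrightarrow> 0) (at_right 0)}. ereal \<eta>)"

definition \<delta>\<^sub>1 :: "(real \<Rightarrow> real) \<Rightarrow> ereal" where
  "\<delta>\<^sub>1 e = liminf_index (H_fun e)"

definition \<delta>\<^sub>2 ::
  "'w measure \<Rightarrow> (real \<Rightarrow> 'w \<Rightarrow> 'a :: euclidean_space) \<Rightarrow> (real \<Rightarrow> real) \<Rightarrow> ereal" where
  "\<delta>\<^sub>2 M X e = liminf_index (h_fun M X e)"

definition \<beta>\<^sub>1 ::
  "'w measure \<Rightarrow> (real \<Rightarrow> 'w \<Rightarrow> 'a :: euclidean_space) \<Rightarrow> (real \<Rightarrow> real) \<Rightarrow> ereal" where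
  "\<beta>\<^sub>1 M X e = lim_index (h_fun M X e)"

definition \<beta>\<^sub>2 :: "(real \<Rightarrow> real) \<Rightarrow> ereal" where
  "\<beta>\<^sub>2 e = lim_index (H_fun e)"

end

theory Submission
  imports Defs
begin

text \<open>
  Write \<open>p = P(X\<^sup>*\<^sub>t \<le> r)\<close>. Everything rests on the bound
  \<open>p\<^sup>m u(t) \<le> C (e(r) + \<integral>\<^sub>r\<^sup>1 EG\<^bsub>T\<^sub>r\<^esub>(\<lambda>) e(d\<lambda>)) = C / h(r)\<close>, with \<open>C\<close>, \<open>m\<close> depending on \<open>e\<close> only.
  No stopping times are needed for it. On dyadic grids an excursion argument of Hoffmann-Jorgensen type
  gives \<open>P(S\<^sup>* \<ge> (1 + 4j) \<lambda>) \<le> P(max |\<xi>\<^sub>i| \<ge> 2\<lambda>) + (1 - p)\<^sup>j P(S\<^sup>* \<ge> \<lambda>)\<close> for \<open>\<lambda> \<ge> r\<close>. It is integrated against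
  \<open>e(d\<lambda>)\<close> with \<open>j\<close> of order \<open>p\<^sup>-\<^sup>2\<close>, so that the last term is absorbed by the moderate growth of \<open>e\<close>. As the
  mesh tends to \<open>0\<close>, large grid increments become jumps, and \<open>p P(some jump before t exceeds \<lambda>) \<le> EG\<^bsub>T\<^sub>r\<^esub>(\<lambda>)\<close>
  because \<open>T\<^sub>r \<ge> t\<close> on \<open>X\<^sup>*\<^sub>t \<le> r\<close>. The four limits follow from this bound, Markov's inequality
  \<open>P(X\<^sup>*\<^sub>t > r) \<le> u(t) / e(r)\<close> and Borel-Cantelli along times with prescribed \<open>u(t)\<close>, which exist because \<open>u\<close> is
  continuous.
\<close>

section \<open>Sums of independent summands\<close>

text \<open>The loss of a power of p comes from moderate growth: stretching the levels by 1 + 4j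
  costs at most a multiple of (1 + 4j)^s, that is p^(-2s), and one more factor p is paid when jump
  probabilities become \<open>EG\<close>; so m = 2s + 1 for a growth exponent s of e. A polynomial
  loss is affordable because the radii decrease geometrically, and the m-th root of a geometric
  sequence is still summable. The obstacle on the path side is measurability. The number of large
  jumps as a function of the path, and \<open>EG\<close> as a function of the level, are compared
  with measurable quantities only through monotonicity of \<open>nn_integral\<close>, which holds
  for arbitrary integrands; the occurrence of a large jump is replaced by a limsup of grid events.
  Every strict inequality between \<eta> and an index leaves a gap of exponents, which is split: one
  part makes the Borel-Cantelli series converge, the other drives the quotient to 0 or to
  infinity.\<close>

context prob_space
begin

text \<open>Independence enters the excursion argument only in this form: a past block against a
  future block, each seen as one random element of a product space.\<close>

lemma indep_vars_prob_inter:
  assumes ind: "indep_vars (\<lambda>_. N) \<xi> I" and "A \<inter> B = {}" "A \<subseteq> I" "B \<subseteq> I"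
    and P: "Measurable.pred (PiM A (\<lambda>_. N)) P" and Q: "Measurable.pred (PiM B (\<lambda>_. N)) Q"
  shows "prob {\<omega>\<in>space M. P (\<lambda>i\<in>A. \<xi> i \<omega>) \<and> Q (\<lambda>i\<in>B. \<xi> i \<omega>)}
       = prob {\<omega>\<in>space M. P (\<lambda>i\<in>A. \<xi> i \<omega>)} * prob {\<omega>\<in>space M. Q (\<lambda>i\<in>B. \<xi> i \<omega>)}"
proof -
  have iv: "indep_var (PiM A (\<lambda>_. N)) (\<lambda>\<omega>. \<lambda>i\<in>A. \<xi> i \<omega>) (PiM B (\<lambda>_. N)) (\<lambda>\<omega>. \<lambda>i\<in>B. \<xi> i \<omega>)"
    by (rule indep_var_restrict[OF ind assms(2-4)])
  have m: "(\<lambda>\<omega>. \<lambda>i\<in>A. \<xi> i \<omega>) \<in> measurable M (PiM A (\<lambda>_. N))" "(\<lambda>\<omega>. \<lambda>i\<in>B. \<xi> i \<omega>) \<in> measurable M (PiM B (\<lambda>_. N))"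
    using indep_var_rv1[OF iv] indep_var_rv2[OF iv] by auto
  let ?P = "{x\<in>space (PiM A (\<lambda>_. N)). P x}" and ?Q = "{x\<in>space (PiM B (\<lambda>_. N)). Q x}"
  have "?P \<in> sets (PiM A (\<lambda>_. N))" "?Q \<in> sets (PiM B (\<lambda>_. N))"
    using P Q by measurable
  note D = indep_varD[OF iv this]
  have "(\<lambda>x. (\<lambda>i\<in>A. \<xi> i x, \<lambda>i\<in>B. \<xi> i x)) -` (?P \<times> ?Q) \<inter> space M = {\<omega>\<in>space M. P (\<lambda>i\<in>A. \<xi> i \<omega>) \<and> Q (\<lambda>i\<in>B. \<xi> i \<omega>)}"
    "(\<lambda>\<omega>. \<lambda>i\<in>A. \<xi> i \<omega>) -` ?P \<inter> space M = {\<omega>\<in>space M. P (\<lambda>i\<in>A. \<xi> i \<omega>)}"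
    "(\<lambda>\<omega>. \<lambda>i\<in>B. \<xi> i \<omega>) -` ?Q \<inter> space M = {\<omega>\<in>space M. Q (\<lambda>i\<in>B. \<xi> i \<omega>)}"
    using m[THEN measurable_space] by auto
  with D show ?thesis by simp
qed

end

locale indep_summands = prob_space M for M :: "'w measure" +
  fixes \<xi> :: "nat \<Rightarrow> 'w \<Rightarrow> 'a :: euclidean_space" and n :: nat
  assumes indep: "indep_vars (\<lambda>_. borel) \<xi> {..<n}"
begin

definition psum :: "nat \<Rightarrow> 'w \<Rightarrow> 'a" where
  "psum k \<omega> = (\<Sum>i<k. \<xi> i \<omega>)"

lemma measurable_summand: "i < n \<Longrightarrow> \<xi> i \<in> borel_measurable M"
  using indep unfolding indep_vars_def by auto

lemma measurable_psum: "k \<le> n \<Longrightarrow> psum k \<in> borel_measurable M"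
  unfolding psum_def[abs_def] by (auto intro!: borel_measurable_sum measurable_summand)

lemma events_psum:
  "{\<omega>\<in>space M. \<exists>k\<le>n. t \<le> norm (psum k \<omega>)} \<in> events" "{\<omega>\<in>space M. \<exists>k\<le>n. t < norm (psum k \<omega>)} \<in> events"
proof -
  have "{\<omega>\<in>space M. \<exists>k\<in>{..n}. t \<le> norm (psum k \<omega>)} \<in> events" "{\<omega>\<in>space M. \<exists>k\<in>{..n}. t < norm (psum k \<omega>)} \<in> events"
    using measurable_psum by (auto intro!: sets.sets_Collect_finite_Ex borel_measurable_le borel_measurable_less)
  then show "{\<omega>\<in>space M. \<exists>k\<le>n. t \<le> norm (psum k \<omega>)} \<in> events" "{\<omega>\<in>space M. \<exists>k\<le>n. t < norm (psum k \<omega>)} \<in> events"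
    by (simp_all only: Bex_def atMost_iff)
qed

lemma events_summand: "{\<omega>\<in>space M. \<exists>i<n. u \<le> norm (\<xi> i \<omega>)} \<in> events"
proof -
  have "{\<omega>\<in>space M. \<exists>i\<in>{..<n}. u \<le> norm (\<xi> i \<omega>)} \<in> events"
    using measurable_summand by (auto intro!: sets.sets_Collect_finite_Ex borel_measurable_le)
  then show ?thesis by (simp only: Bex_def lessThan_iff)
qed

text \<open>Smallness is required only of the summands before the index k, not of all n. This bounds
  the overshoot at the first exit and still leaves everything up to the exit determined by the first
  k summands.\<close>

definition excursion :: "real \<Rightarrow> real \<Rightarrow> 'w set" where
  "excursion u t = {\<omega>\<in>space M. \<exists>k\<le>n. t \<le> norm (psum k \<omega>) \<and> (\<forall>i<k. norm (\<xi> i \<omega>) < u)}"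

text \<open>These pieces, disjoint in k, take the place of a stopping time: each is an event of the
  first k summands and hence independent of the later increments.\<close>

definition first_exit :: "real \<Rightarrow> real \<Rightarrow> nat \<Rightarrow> 'w set" where
  "first_exit u t k = {\<omega>\<in>space M. t \<le> norm (psum k \<omega>) \<and> (\<forall>m<k. norm (psum m \<omega>) < t) \<and> (\<forall>i<k. norm (\<xi> i \<omega>) < u)}"

lemma excursion_sets: "excursion u t \<in> sets M"
proof -
  have "excursion u t = (\<Union>k\<le>n. {\<omega>\<in>space M. t \<le> norm (psum k \<omega>) \<and> (\<forall>i\<in>{..<k}. norm (\<xi> i \<omega>) < u)})"
    by (auto simp: excursion_def)
  also have "\<dots> \<in> sets M"
    using measurable_summand measurable_psum
    by (intro sets.finite_UN) (auto intro!: sets.sets_Collect borel_measurable_le borel_measurable_less)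
  finally show ?thesis .
qed

lemma first_exit_sets:
  assumes "k \<le> n" shows "first_exit u t k \<in> sets M"
proof -
  have "first_exit u t k = {\<omega>\<in>space M. t \<le> norm (psum k \<omega>) \<and> (\<forall>m\<in>{..<k}. norm (psum m \<omega>) < t) \<and> (\<forall>i\<in>{..<k}. norm (\<xi> i \<omega>) < u)}"
    by (auto simp: first_exit_def)
  also have "\<dots> \<in> sets M"
    using measurable_summand measurable_psum assms
    by (auto intro!: sets.sets_Collect borel_measurable_le borel_measurable_less)
  finally show ?thesis .
qed

lemma psum_diff: "k \<le> m \<Longrightarrow> psum m \<omega> - psum k \<omega> = (\<Sum>i\<in>{k..<m}. \<xi> i \<omega>)"
  unfolding psum_def lessThan_atLeast0 by (subst sum_diff_nat_ivl) auto

lemma first_exit_indep: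
  assumes "k \<le> n"
  shows "prob (first_exit u t k \<inter> {\<omega>\<in>space M. \<exists>m\<in>{k..n}. v < norm (psum m \<omega> - psum k \<omega>)})
       = prob (first_exit u t k) * prob {\<omega>\<in>space M. \<exists>m\<in>{k..n}. v < norm (psum m \<omega> - psum k \<omega>)}"
proof -
  let ?P = "\<lambda>x :: nat \<Rightarrow> 'a. t \<le> norm (\<Sum>i<k. x i) \<and> (\<forall>m\<in>{..<k}. norm (\<Sum>i<m. x i) < t) \<and> (\<forall>i\<in>{..<k}. norm (x i) < u)"
  let ?Q = "\<lambda>x :: nat \<Rightarrow> 'a. \<exists>m\<in>{k..n}. v < norm (\<Sum>i\<in>{k..<m}. x i)"
  have 1: "first_exit u t k = {\<omega>\<in>space M. ?P (\<lambda>i\<in>{..<k}. \<xi> i \<omega>)}"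
    by (auto simp: first_exit_def psum_def)
  have 2: "{\<omega>\<in>space M. \<exists>m\<in>{k..n}. v < norm (psum m \<omega> - psum k \<omega>)} = {\<omega>\<in>space M. ?Q (\<lambda>i\<in>{k..<n}. \<xi> i \<omega>)}"
    by (auto simp: psum_diff intro!: bexI)
  have c: "(\<lambda>x. x i :: 'a) \<in> borel_measurable (PiM I (\<lambda>_. borel))" if "i \<in> I" for i :: nat and I
    using that by (rule measurable_component_singleton)
  have s: "(\<lambda>x. (\<Sum>i\<in>J. x i) :: 'a) \<in> borel_measurable (PiM I (\<lambda>_. borel))" if "J \<subseteq> I" for I J :: "nat set"
    using that by (intro borel_measurable_sum c) auto
  have le: "Measurable.pred (PiM I (\<lambda>_. borel)) (\<lambda>x. a \<le> norm (\<Sum>i\<in>J. x i :: 'a))"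
    and less: "Measurable.pred (PiM I (\<lambda>_. borel)) (\<lambda>x. norm (\<Sum>i\<in>J. x i :: 'a) < a)"
      "Measurable.pred (PiM I (\<lambda>_. borel)) (\<lambda>x. a < norm (\<Sum>i\<in>J. x i :: 'a))"
      "\<And>i. i \<in> I \<Longrightarrow> Measurable.pred (PiM I (\<lambda>_. borel)) (\<lambda>x. norm (x i :: 'a) < a)"
    if "J \<subseteq> I" for I J :: "nat set" and a
    using measurable_compose[OF s[OF that] borel_measurable_norm] measurable_compose[OF c borel_measurable_norm]
    by (auto simp: pred_def intro!: borel_measurable_le borel_measurable_less)
  have P: "Measurable.pred (PiM {..<k} (\<lambda>_. borel)) ?P"
    by (intro pred_intros_logic pred_intros_countable_bounded)
       (auto intro!: le less)
  have Q: "Measurable.pred (PiM {k..<n} (\<lambda>_. borel)) ?Q"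
    by (intro pred_intros_logic pred_intros_countable_bounded)
       (auto intro!: le less)
  have "prob {\<omega>\<in>space M. ?P (\<lambda>i\<in>{..<k}. \<xi> i \<omega>) \<and> ?Q (\<lambda>i\<in>{k..<n}. \<xi> i \<omega>)}
    = prob {\<omega>\<in>space M. ?P (\<lambda>i\<in>{..<k}. \<xi> i \<omega>)} * prob {\<omega>\<in>space M. ?Q (\<lambda>i\<in>{k..<n}. \<xi> i \<omega>)}"
    by (rule indep_vars_prob_inter[OF indep _ _ _ P Q]) (use assms in auto)
  moreover have "{\<omega>\<in>space M. ?P (\<lambda>i\<in>{..<k}. \<xi> i \<omega>) \<and> ?Q (\<lambda>i\<in>{k..<n}. \<xi> i \<omega>)}
     = {\<omega>\<in>space M. ?P (\<lambda>i\<in>{..<k}. \<xi> i \<omega>)} \<inter> {\<omega>\<in>space M. ?Q (\<lambda>i\<in>{k..<n}. \<xi> i \<omega>)}" by blast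
  ultimately show ?thesis unfolding 1 2 by simp
qed

text \<open>At the first exit from level t the overshoot is below u, so reaching t + u + 2r requires
  a further displacement of more than 2r from the exit position. That displacement is independent of
  the exit and forces one of its two end points to have norm above r. The latter event is the same
  for all exit indices, so its probability factors out of the sum, with no symmetry of the summands
  involved.\<close>

lemma prob_excursion_step:
  assumes "t > 0" "r \<ge> 0" "u > 0"
  shows "prob (excursion u (t + u + 2 * r)) \<le> prob {\<omega>\<in>space M. \<exists>k\<le>n. r < norm (psum k \<omega>)} * prob (excursion u t)"
proof -
  let ?F = "\<lambda>k. {\<omega>\<in>space M. \<exists>m\<in>{k..n}. 2 * r < norm (psum m \<omega> - psum k \<omega>)}"
  let ?G = "{\<omega>\<in>space M. \<exists>k\<le>n. r < norm (psum k \<omega>)}"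
  have G: "?G \<in> sets M" by (rule events_psum)
  have F: "?F k \<in> sets M" if "k \<le> n" for k
    using that measurable_psum by (auto intro!: sets.sets_Collect borel_measurable_less)
  have FG: "?F k \<subseteq> ?G" if "k \<le> n" for k
  proof clarify
    fix \<omega> m assume *: "\<omega> \<in> space M" "m \<in> {k..n}" "2 * r < norm (psum m \<omega> - psum k \<omega>)"
    then have "r < norm (psum m \<omega>) \<or> r < norm (psum k \<omega>)"
      using norm_triangle_ineq4[of "psum m \<omega>" "psum k \<omega>"] by linarith
    then show "\<exists>k\<le>n. r < norm (psum k \<omega>)" using * that by (meson atLeastAtMost_iff)
  qed
  have sub: "excursion u (t + u + 2 * r) \<subseteq> (\<Union>k\<in>{..n}. first_exit u t k \<inter> ?F k)"
  proof
    fix \<omega> assume "\<omega> \<in> excursion u (t + u + 2 * r)"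
    then obtain k' where k': "\<omega> \<in> space M" "k' \<le> n" "t + u + 2 * r \<le> norm (psum k' \<omega>)" "\<forall>i<k'. norm (\<xi> i \<omega>) < u"
      by (auto simp: excursion_def)
    define k where "k = (LEAST k. t \<le> norm (psum k \<omega>))"
    have tk': "t \<le> norm (psum k' \<omega>)" using k'(3) assms by linarith
    have tk: "t \<le> norm (psum k \<omega>)" unfolding k_def using tk' by (rule LeastI)
    have kk': "k \<le> k'" unfolding k_def using tk' by (rule Least_le)
    have low: "norm (psum m \<omega>) < t" if "m < k" for m
      using not_less_Least[OF that[unfolded k_def]] by simp
    have "k \<noteq> 0" using tk assms by (auto simp: psum_def intro: gr0I)
    then obtain j where j: "k = Suc j" by (cases k) auto
    have "psum k \<omega> = psum j \<omega> + \<xi> j \<omega>" by (simp add: j psum_def)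
    then have "norm (psum k \<omega>) \<le> norm (psum j \<omega>) + norm (\<xi> j \<omega>)" by (simp add: norm_triangle_ineq)
    moreover have "norm (psum j \<omega>) < t" "norm (\<xi> j \<omega>) < u" using low[of j] k'(4) kk' j by auto
    ultimately have "2 * r < norm (psum k' \<omega>) - norm (psum k \<omega>)" using k'(3) by linarith
    also have "\<dots> \<le> norm (psum k' \<omega> - psum k \<omega>)" by (rule norm_triangle_ineq2)
    finally have "\<omega> \<in> ?F k" using k' kk' by auto
    moreover have "\<omega> \<in> first_exit u t k" using k' kk' tk low by (auto simp: first_exit_def)
    ultimately show "\<omega> \<in> (\<Union>k\<in>{..n}. first_exit u t k \<inter> ?F k)" using kk' k' by auto
  qed
  have disj: "disjoint_family_on (first_exit u t) {..n}"
    unfolding disjoint_family_on_def first_exit_def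
    by (auto, metis linorder_neqE_nat not_less)
  have "prob (excursion u (t + u + 2 * r)) \<le> prob (\<Union>k\<in>{..n}. first_exit u t k \<inter> ?F k)"
    using first_exit_sets F by (intro finite_measure_mono sub sets.finite_UN sets.Int) auto
  also have "\<dots> \<le> (\<Sum>k\<in>{..n}. prob (first_exit u t k \<inter> ?F k))"
    using first_exit_sets F by (intro measure_UNION_le) (auto intro: sets.Int)
  also have "\<dots> = (\<Sum>k\<in>{..n}. prob (first_exit u t k) * prob (?F k))"
    by (intro sum.cong refl first_exit_indep) auto
  also have "\<dots> \<le> (\<Sum>k\<in>{..n}. prob (first_exit u t k) * prob ?G)"
    by (intro sum_mono mult_left_mono finite_measure_mono FG G measure_nonneg) simp
  also have "\<dots> = prob ?G * prob (\<Union>k\<in>{..n}. first_exit u t k)"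
    using first_exit_sets disj
    by (subst finite_measure_finite_Union) (auto simp: sum_distrib_right mult.commute)
  also have "\<dots> \<le> prob ?G * prob (excursion u t)"
    by (intro mult_left_mono finite_measure_mono excursion_sets measure_nonneg)
       (auto simp: first_exit_def excursion_def)
  finally show ?thesis .
qed

lemma prob_excursion_steps:
  assumes "t > 0" "r \<ge> 0" "u > 0"
  shows "prob (excursion u (t + real j * (u + 2 * r))) \<le> prob {\<omega>\<in>space M. \<exists>k\<le>n. r < norm (psum k \<omega>)} ^ j * prob (excursion u t)"
proof (induction j)
  case (Suc j)
  have "0 < t + real j * (u + 2 * r)" using assms by (intro add_pos_nonneg) auto
  from prob_excursion_step[OF this assms(2,3)]
  have "prob (excursion u (t + real (Suc j) * (u + 2 * r)))
     \<le> prob {\<omega>\<in>space M. \<exists>k\<le>n. r < norm (psum k \<omega>)} * prob (excursion u (t + real j * (u + 2 * r)))"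
    by (simp add: algebra_simps)
  also have "\<dots> \<le> prob {\<omega>\<in>space M. \<exists>k\<le>n. r < norm (psum k \<omega>)} *
     (prob {\<omega>\<in>space M. \<exists>k\<le>n. r < norm (psum k \<omega>)} ^ j * prob (excursion u t))"
    by (intro mult_left_mono Suc) auto
  finally show ?case by (simp add: mult.assoc)
qed simp

text \<open>A path that reaches the level without being an excursion has met a summand of size at
  least u on the way. The instance used later is t = l and u = 2l with r below l.\<close>

lemma prob_max_psum_ge:
  assumes "t > 0" "r \<ge> 0" "u > 0"
  shows "prob {\<omega>\<in>space M. \<exists>k\<le>n. t + real j * (u + 2 * r) \<le> norm (psum k \<omega>)}
    \<le> prob {\<omega>\<in>space M. \<exists>i<n. u \<le> norm (\<xi> i \<omega>)}
      + prob {\<omega>\<in>space M. \<exists>k\<le>n. r < norm (psum k \<omega>)} ^ j * prob {\<omega>\<in>space M. \<exists>k\<le>n. t \<le> norm (psum k \<omega>)}"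
    (is "prob ?L \<le> prob ?A + ?q * prob ?T")
proof -
  have A: "?A \<in> sets M" and T: "?T \<in> sets M" by (rule events_summand events_psum)+
  have "?L \<subseteq> ?A \<union> excursion u (t + real j * (u + 2 * r))"
  proof
    fix \<omega> assume "\<omega> \<in> ?L"
    then obtain k where k: "\<omega> \<in> space M" "k \<le> n" "t + real j * (u + 2 * r) \<le> norm (psum k \<omega>)" by blast
    show "\<omega> \<in> ?A \<union> excursion u (t + real j * (u + 2 * r))"
    proof (cases "\<forall>i<k. norm (\<xi> i \<omega>) < u")
      case True
      then show ?thesis using k unfolding excursion_def by blast
    next
      case False
      then obtain i where "i < k" "u \<le> norm (\<xi> i \<omega>)" by (auto simp: not_less)
      then show ?thesis using k order_less_le_trans[of i k n] by blast
    qed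
  qed
  then have "prob ?L \<le> prob (?A \<union> excursion u (t + real j * (u + 2 * r)))"
    using A excursion_sets by (intro finite_measure_mono sets.Un)
  also have "\<dots> \<le> prob ?A + prob (excursion u (t + real j * (u + 2 * r)))"
    by (rule measure_Un_le[OF A excursion_sets])
  also have "prob (excursion u (t + real j * (u + 2 * r))) \<le> ?q * prob (excursion u t)"
    by (rule prob_excursion_steps[OF assms])
  also have "prob (excursion u t) \<le> prob ?T"
    by (intro finite_measure_mono T) (auto simp: excursion_def)
  finally show ?thesis by (simp add: mult_left_mono)
qed

end

section \<open>Stieltjes measures and moderate functions\<close>

lemma abs_cont_on_imp_continuous_on:
  assumes "abs_cont_on I f" and "is_interval I"
  shows "continuous_on I f"
  unfolding continuous_on_iff
proof (intro ballI allI impI)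
  fix x \<epsilon> :: real assume x: "x \<in> I" and "\<epsilon> > 0"
  then obtain \<delta> where \<delta>: "\<delta> > 0" "\<And>(n::nat) a b. (\<forall>i<n. a i \<le> b i \<and> {a i..b i} \<subseteq> I) \<Longrightarrow>
        disjoint_family_on (\<lambda>i. {a i<..<b i}) {..<n} \<Longrightarrow> (\<Sum>i<n. b i - a i) < \<delta>
        \<Longrightarrow> (\<Sum>i<n. \<bar>f (b i) - f (a i)\<bar>) < \<epsilon>"
    using assms(1) unfolding abs_cont_on_def by meson
  have "dist (f y) (f x) < \<epsilon>" if y: "y \<in> I" "dist y x < \<delta>" for y
  proof -
    have "{min x y..max x y} \<subseteq> I"
    proof
      fix z assume "z \<in> {min x y..max x y}"
      then have "x \<le> z \<and> z \<le> y \<or> y \<le> z \<and> z \<le> x" by (cases "x \<le> y") auto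
      then show "z \<in> I" using mem_is_interval_1_I[OF assms(2) x y(1)] mem_is_interval_1_I[OF assms(2) y(1) x] by blast
    qed
    then have "\<bar>f (max x y) - f (min x y)\<bar> < \<epsilon>"
      using \<delta>(2)[of 1 "\<lambda>_. min x y" "\<lambda>_. max x y"] y(2)
      by (auto simp: dist_real_def disjoint_family_on_def)
    then show ?thesis by (auto simp: dist_real_def min_def max_def abs_minus_commute split: if_splits)
  qed
  with \<delta>(1) show "\<exists>d>0. \<forall>x'\<in>I. dist x' x < d \<longrightarrow> dist (f x') (f x) < \<epsilon>" by blast
qed

text \<open>Kept apart from growth and boundedness because the Stieltjes facts are also applied to
  \<open>\<lambda>x. A x powr (1 / q)\<close>.\<close>

locale mono_continuous =
  fixes e :: "real \<Rightarrow> real"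
  assumes mono: "mono_on {0..} e" and continuous: "continuous_on {0..} e" and zero: "e 0 = 0"
begin

abbreviation stieltjes :: "real measure" where
  "stieltjes \<equiv> interval_measure (\<lambda>x. e (max 0 x))"

lemma monoD: "0 \<le> x \<Longrightarrow> x \<le> y \<Longrightarrow> e x \<le> e y"
  using mono by (auto simp: mono_on_def)

lemma nonneg: "0 \<le> x \<Longrightarrow> 0 \<le> e x"
  using monoD[of 0 x] zero by simp

lemma extension_mono: "x \<le> y \<Longrightarrow> e (max 0 x) \<le> e (max 0 y)"
  by (rule monoD) auto

lemma extension_continuous: "continuous_on UNIV (\<lambda>x. e (max 0 x))"
  by (rule continuous_on_compose2[OF continuous]) (auto intro!: continuous_intros)

lemma extension_right_continuous: "continuous (at_right a) (\<lambda>x. e (max 0 x))"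
  using extension_continuous by (simp add: continuous_on_eq_continuous_within continuous_at_imp_continuous_at_within)

lemma emeasure_stieltjes_Ioc: "0 \<le> a \<Longrightarrow> a \<le> b \<Longrightarrow> emeasure stieltjes {a<..b} = ennreal (e b - e a)"
  using emeasure_interval_measure_Ioc[OF _ extension_mono extension_right_continuous, of a b] by simp

lemma sigma_finite_stieltjes: "sigma_finite_measure stieltjes"
  by (rule sigma_finite_interval_measure[OF extension_mono extension_right_continuous])

lemma borel_measurable_extension [measurable]: "(\<lambda>x. e (max 0 x)) \<in> borel_measurable borel"
  by (intro borel_measurable_continuous_onI extension_continuous)

text \<open>Since \<open>e 0 = 0\<close>, \<open>e (Z \<omega>)\<close> is the mass of the interval
  from 0 (excluded) to \<open>Z \<omega>\<close> (included); the rest is Fubini.\<close>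

lemma nn_integral_layer_cake:
  assumes "sigma_finite_measure M" and [measurable]: "Z \<in> borel_measurable M" and Z: "\<And>\<omega>. \<omega> \<in> space M \<Longrightarrow> 0 \<le> Z \<omega>"
  shows "(\<integral>\<^sup>+\<omega>. ennreal (e (Z \<omega>)) \<partial>M) = (\<integral>\<^sup>+l\<in>{0<..}. emeasure M {\<omega>\<in>space M. l \<le> Z \<omega>} \<partial>stieltjes)"
proof -
  interpret M: sigma_finite_measure M by fact
  interpret S: sigma_finite_measure stieltjes by (rule sigma_finite_stieltjes)
  interpret pair_sigma_finite M stieltjes ..
  let ?f = "\<lambda>\<omega> l. indicator {\<omega>\<in>space M. l \<le> Z \<omega>} \<omega> * indicator {0<..} l :: ennreal"
  have m: "case_prod ?f \<in> borel_measurable (M \<Otimes>\<^sub>M stieltjes)"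
  proof -
    have "case_prod ?f \<in> borel_measurable (M \<Otimes>\<^sub>M stieltjes) \<longleftrightarrow>
      (\<lambda>x. indicator {x\<in>space (M \<Otimes>\<^sub>M stieltjes). snd x \<le> Z (fst x) \<and> 0 < snd x} x :: ennreal) \<in> borel_measurable (M \<Otimes>\<^sub>M stieltjes)"
      by (intro measurable_cong) (auto simp: space_pair_measure split: split_indicator)
    also have "\<dots>" by measurable
    finally show ?thesis .
  qed
  have "(\<integral>\<^sup>+\<omega>. ennreal (e (Z \<omega>)) \<partial>M) = (\<integral>\<^sup>+\<omega>. (\<integral>\<^sup>+l. ?f \<omega> l \<partial>stieltjes) \<partial>M)"
  proof (rule nn_integral_cong)
    fix \<omega> assume w: "\<omega> \<in> space M"
    have "(\<integral>\<^sup>+l. ?f \<omega> l \<partial>stieltjes) = (\<integral>\<^sup>+l. indicator {0<..Z \<omega>} l \<partial>stieltjes)"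
      using w by (intro nn_integral_cong) (auto split: split_indicator)
    also have "\<dots> = ennreal (e (Z \<omega>))"
      using emeasure_stieltjes_Ioc[of 0 "Z \<omega>"] Z[OF w] zero by simp
    finally show "ennreal (e (Z \<omega>)) = (\<integral>\<^sup>+l. ?f \<omega> l \<partial>stieltjes)" by simp
  qed
  also have "\<dots> = (\<integral>\<^sup>+l. (\<integral>\<^sup>+\<omega>. ?f \<omega> l \<partial>M) \<partial>stieltjes)"
    using Fubini'[OF m] by simp
  also have "\<dots> = (\<integral>\<^sup>+l\<in>{0<..}. emeasure M {\<omega>\<in>space M. l \<le> Z \<omega>} \<partial>stieltjes)"
    by (intro nn_integral_cong) (simp add: nn_integral_multc)
  finally show ?thesis .
qed

end

locale normalized = mono_continuous +
  assumes pos: "x > 0 \<Longrightarrow> e x > 0" and const: "x > 1 \<Longrightarrow> e x = e 1"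
    and growth: "\<exists>\<rho>>0. \<exists>\<sigma>>0. \<forall>t1 t2. 0 < t1 \<and> t1 < t2 \<longrightarrow> e t2 / e t1 \<le> \<rho> * (t2 / t1) powr \<sigma>"

lemma normalized_moderate_imp_normalized: "normalized_moderate e \<Longrightarrow> normalized e"
  by unfold_locales
     (auto simp: normalized_moderate_def moderate_def is_interval_1 intro: abs_cont_on_imp_continuous_on)

context normalized
begin

lemma le_e1: "0 \<le> x \<Longrightarrow> e x \<le> e 1"
  using monoD[of x 1] const[of x] by (cases "x \<le> 1") auto

text \<open>The exponent is rounded up to a natural number to keep the choice of the iteration count
  algebraic. The constant is raised to at least 1 to cover K = 1, which the strict inequality
  \<open>t1 < t2\<close> in \<open>moderate\<close> leaves out.\<close>

lemma growth_nat:
  obtains \<rho> :: real and s :: nat where "\<rho> \<ge> 1" "s \<ge> 1" "\<And>x K. 0 \<le> x \<Longrightarrow> 1 \<le> K \<Longrightarrow> e (K * x) \<le> \<rho> * K ^ s * e x"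
proof -
  from growth obtain \<rho> \<sigma> where \<rho>: "\<rho> > 0" "\<sigma> > 0" and g: "\<And>t1 t2. 0 < t1 \<Longrightarrow> t1 < t2 \<Longrightarrow> e t2 / e t1 \<le> \<rho> * (t2 / t1) powr \<sigma>"
    by blast
  define s where "s = nat \<lceil>\<sigma>\<rceil>"
  have s: "s \<ge> 1" "\<sigma> \<le> real s" using \<rho>(2) by (auto simp: s_def) linarith
  have "e (K * x) \<le> max 1 \<rho> * K ^ s * e x" if x: "0 \<le> x" "1 \<le> K" for x K
  proof (cases "x = 0 \<or> K = 1")
    case True
    then show ?thesis
    proof
      assume "K = 1" then show ?thesis using nonneg[OF x(1)] mult_right_mono[of 1 "max 1 \<rho>" "e x"] by simp
    qed (simp add: zero)
  next
    case False
    then have x': "0 < x" "1 < K" using x by auto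
    then have "e (K * x) / e x \<le> \<rho> * K powr \<sigma>" using g[of x "K * x"] by simp
    also have "\<dots> \<le> max 1 \<rho> * K powr real s" using s x' \<rho> by (intro mult_mono powr_mono) auto
    also have "K powr real s = K ^ s" using x' by (simp add: powr_realpow)
    finally show ?thesis using pos[OF x'(1)] by (simp add: divide_simps)
  qed
  with s(1) show thesis by (intro that[of "max 1 \<rho>" s]) auto
qed

text \<open>The mass is finite because e is constant beyond 1; this makes an indicator an admissible
  dominating function in the passage to the limit.\<close>

lemma emeasure_stieltjes_Ioi: "emeasure stieltjes {0<..} = ennreal (e 1)"
proof -
  have "(\<lambda>n. emeasure stieltjes {0<..real (Suc n)}) \<longlonglongrightarrow> emeasure stieltjes (\<Union>n. {0<..real (Suc n)})"
    by (intro Lim_emeasure_incseq) (auto simp: incseq_def)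
  also have "(\<Union>n. {0<..real (Suc n)}) = {0<..}"
  proof (intro equalityI subsetI)
    fix x :: real assume "x \<in> {0<..}"
    moreover obtain n where "x \<le> real n" using real_arch_simple by blast
    ultimately show "x \<in> (\<Union>n. {0<..real (Suc n)})" by (intro UN_I[of n]) auto
  qed auto
  also have "(\<lambda>n. emeasure stieltjes {0<..real (Suc n)}) = (\<lambda>n. ennreal (e 1))"
  proof
    fix n show "emeasure stieltjes {0<..real (Suc n)} = ennreal (e 1)"
      using emeasure_stieltjes_Ioc[of 0 "real (Suc n)"] const[of "real (Suc n)"] zero
      by (cases "n = 0") auto
  qed
  finally show ?thesis by (simp add: LIMSEQ_const_iff)
qed

lemma emeasure_stieltjes_gt_one: "emeasure stieltjes {1<..} = 0"
proof -
  have "{1::real<..} = {0<..} - {0<..1}" by auto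
  then have "emeasure stieltjes {1<..} = emeasure stieltjes {0<..} - emeasure stieltjes {0<..1}"
    using emeasure_stieltjes_Ioc[of 0 1] by (simp add: emeasure_Diff greaterThanAtMost_def)
  then show ?thesis using emeasure_stieltjes_Ioi emeasure_stieltjes_Ioc[of 0 1] zero by simp
qed

end

text \<open>With j of order 1/p the factor (1 - p)^j would only be bounded by a constant and could
  not beat (1 + 4j)^s. With j of order 1/p^2 it is at most exp(-c/p), which lies below a constant
  times p^(2s), while (1 + 4j)^s is of order p^(-2s): the powers of p cancel, and c large makes the
  product small.\<close>

lemma exists_iteration_count:
  fixes \<rho> :: real and s :: nat
  assumes "\<rho> \<ge> 1" "s \<ge> 1"
  obtains C where "C > 0" "\<And>p. 0 < p \<Longrightarrow> p \<le> 1 \<Longrightarrow>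
    \<exists>j::nat. \<rho> * (1 + 4 * real j) ^ s * (1 - p) ^ j \<le> 1/2 \<and> 2 * \<rho> * (1 + 4 * real j) ^ s * p ^ (2 * s) \<le> C"
proof -
  \<comment> \<open>36 is the product of 9, from the bound on 1 + 4j, and 4, from (2s)^2. The factor
    2 before \<rho> yields the final 1/2, the summand 1 yields \<open>c \<ge> 1\<close>.\<close>
  define c where "c = 1 + 2 * \<rho> * (36 * real s ^ 2) ^ s"
  have c: "c \<ge> 1" using assms by (auto simp: c_def)
  have "\<exists>j::nat. \<rho> * (1 + 4 * real j) ^ s * (1 - p) ^ j \<le> 1/2 \<and> 2 * \<rho> * (1 + 4 * real j) ^ s * p ^ (2 * s) \<le> 2 * \<rho> * (9 * c) ^ s"
    if p: "0 < p" "p \<le> 1" for p :: real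
  proof -
    define j where "j = nat \<lceil>c / p\<^sup>2\<rceil>"
    have p2: "p\<^sup>2 \<le> 1" "p\<^sup>2 > 0" using p by (auto simp: power_le_one)
    have cp: "c / p\<^sup>2 \<ge> 1" using c p2 by (simp add: le_divide_eq)
    have j: "c / p\<^sup>2 \<le> real j" "real j \<le> c / p\<^sup>2 + 1"
      using cp by (auto simp: j_def)
    \<comment> \<open>From j <= c/p^2 + 1 the left side is at most 5 + 4c/p^2, and c/p^2 is at least
      1.\<close>
    have j9: "1 + 4 * real j \<le> 9 * c / p\<^sup>2" using j cp by simp
    have J: "(1 + 4 * real j) ^ s \<le> (9 * c) ^ s / p ^ (2 * s)"
      using power_mono[OF j9, of s] by (simp add: power_divide power_mult)
    have "(1 - p) ^ j \<le> exp (- p) ^ j"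
      using p exp_ge_add_one_self[of "-p"] by (intro power_mono) auto
    also have "\<dots> = exp (- (p * real j))" by (simp add: exp_of_nat_mult[symmetric] mult.commute)
    also have "\<dots> \<le> exp (- (c / p))"
      using mult_left_mono[OF j(1), of p] p by (simp add: power2_eq_square)
    \<comment> \<open>The inequality y <= exp y at y = c/(2sp) is raised to the power 2s and
      inverted; 2s is the exponent needed to cancel p^(-2s).\<close>
    also have "\<dots> \<le> (2 * real s * p / c) ^ (2 * s)"
    proof -
      have "c / (2 * real s * p) \<le> exp (c / (2 * real s * p))"
        using exp_ge_add_one_self[of "c / (2 * real s * p)"] by linarith
      then have "(c / (2 * real s * p)) ^ (2 * s) \<le> exp (c / (2 * real s * p)) ^ (2 * s)"
        using c p assms by (intro power_mono) auto
      also have "\<dots> = exp (c / p)"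
        using assms by (simp add: exp_of_nat_mult[symmetric])
      finally have "exp (- (c / p)) \<le> inverse ((c / (2 * real s * p)) ^ (2 * s))"
        unfolding exp_minus using c p assms by (intro le_imp_inverse_le zero_less_power) auto
      also have "\<dots> = (2 * real s * p / c) ^ (2 * s)" by (simp add: power_inverse[symmetric])
      finally show ?thesis .
    qed
    finally have q: "(1 - p) ^ j \<le> (2 * real s * p / c) ^ (2 * s)" .
    have "\<rho> * (1 + 4 * real j) ^ s * (1 - p) ^ j \<le> \<rho> * ((9 * c) ^ s / p ^ (2 * s)) * (2 * real s * p / c) ^ (2 * s)"
      using assms p c by (intro mult_mono q J) auto
    also have "\<dots> = \<rho> * (36 * real s ^ 2) ^ s / c ^ s"
    proof -
      have "(2 * real s * p / c) ^ (2 * s) = (4 * real s ^ 2) ^ s * p ^ (2 * s) / (c ^ s * c ^ s)"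
        by (simp add: power_divide power_mult_distrib power_mult power2_eq_square)
      moreover have "(9 * c) ^ s * (4 * real s ^ 2) ^ s = (36 * real s ^ 2) ^ s * c ^ s"
        unfolding power_mult_distrib[symmetric] by (rule arg_cong[where f="\<lambda>x. x ^ s"]) (simp add: algebra_simps)
      moreover have "\<rho> * (x / P) * (y * P / (d * d)) = \<rho> * z / d" if "x * y = z * d" "P \<noteq> 0" "d \<noteq> 0" for x y z P d :: real
        using that by (simp add: field_simps)
      ultimately show ?thesis using p c by simp
    qed
    also have "\<dots> \<le> \<rho> * (36 * real s ^ 2) ^ s / c"
      using assms c self_le_power[of c s] by (intro divide_left_mono) auto
    also have "\<dots> \<le> 1/2"
    proof -
      have "2 * (\<rho> * (36 * real s ^ 2) ^ s) = c - 1" by (simp add: c_def)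
      then show ?thesis using c by (simp add: pos_divide_le_eq)
    qed
    finally have 1: "\<rho> * (1 + 4 * real j) ^ s * (1 - p) ^ j \<le> 1/2" .
    have "2 * \<rho> * (1 + 4 * real j) ^ s * p ^ (2 * s) \<le> 2 * \<rho> * ((9 * c) ^ s / p ^ (2 * s)) * p ^ (2 * s)"
      using assms p c by (intro mult_right_mono mult_left_mono J) auto
    with 1 p show ?thesis by (intro exI[of _ j]) simp
  qed
  then show thesis using assms c by (intro that[of "2 * \<rho> * (9 * c) ^ s"]) auto
qed

lemma (in prob_space) borel_measurable_emeasure_antimono:
  fixes A :: "real \<Rightarrow> 'a set"
  assumes "\<And>l. A l \<in> events" "\<And>l l'. l \<le> l' \<Longrightarrow> A l' \<subseteq> A l"
  shows "(\<lambda>l. emeasure M (A l)) \<in> borel_measurable borel"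
proof -
  have "mono (\<lambda>l. - prob (A l))"
    using assms by (auto simp: mono_def intro!: finite_measure_mono)
  then have "(\<lambda>l. - prob (A l)) \<in> borel_measurable borel" by (rule borel_measurable_mono)
  then have "(\<lambda>l. - (- prob (A l))) \<in> borel_measurable borel" by (rule borel_measurable_uminus)
  then show ?thesis by (simp add: emeasure_eq_measure)
qed

section \<open>Moment bound for the maximum of partial sums\<close>

context indep_summands
begin

definition max_psum :: "'w \<Rightarrow> real" where
  "max_psum \<omega> = Max ((\<lambda>k. norm (psum k \<omega>)) ` {..n})"

lemma measurable_max_psum [measurable]: "max_psum \<in> borel_measurable M"
  unfolding max_psum_def[abs_def] 
  by (rule borel_measurable_Max) (auto intro!: measurable_compose[OF measurable_psum borel_measurable_norm])

lemma max_psum_ge_iff: "t \<le> max_psum \<omega> \<longleftrightarrow> (\<exists>k\<le>n. t \<le> norm (psum k \<omega>))"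
  unfolding max_psum_def by (subst Max_ge_iff) auto

lemma max_psum_nonneg: "0 \<le> max_psum \<omega>"
  unfolding max_psum_ge_iff by (auto intro: exI[of _ 0])

text \<open>Levels up to r are bounded by the trivial probability 1 and contribute
  \<open>e r\<close>; above r the excursion bound applies. Dividing the maximum by 1 + 4j moves the
  stretched level back to l.\<close>

lemma nn_integral_max_psum_step:
  assumes "normalized e" "r > 0"
  shows "(\<integral>\<^sup>+\<omega>. ennreal (e (max_psum \<omega> / (1 + 4 * real j))) \<partial>M)
    \<le> ennreal (e r) + (\<integral>\<^sup>+l\<in>{r<..}. emeasure M {\<omega>\<in>space M. \<exists>i<n. 2 * l \<le> norm (\<xi> i \<omega>)} \<partial>interval_measure (\<lambda>x. e (max 0 x)))
      + ennreal (prob {\<omega>\<in>space M. \<exists>k\<le>n. r < norm (psum k \<omega>)} ^ j) * (\<integral>\<^sup>+\<omega>. ennreal (e (max_psum \<omega>)) \<partial>M)"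
proof -
  interpret e: normalized e by fact
  let ?q = "prob {\<omega>\<in>space M. \<exists>k\<le>n. r < norm (psum k \<omega>)}" and ?K = "1 + 4 * real j"
  let ?A = "\<lambda>l. {\<omega>\<in>space M. \<exists>i<n. 2 * l \<le> norm (\<xi> i \<omega>)}"
  let ?B = "\<lambda>l. {\<omega>\<in>space M. l \<le> max_psum \<omega>}"
  have A: "?A l \<in> events" and B: "?B l \<in> events" for l
    by (rule events_summand, measurable)
  have mA: "(\<lambda>l. emeasure M (?A l)) \<in> borel_measurable borel"
    by (intro borel_measurable_emeasure_antimono A) force
  have mB: "(\<lambda>l. emeasure M (?B l)) \<in> borel_measurable borel"
    by (intro borel_measurable_emeasure_antimono B) auto
  have split: "(\<integral>\<^sup>+l. indicator {0<..r} l + (a l * indicator {r<..} l + c * (b l * indicator {0<..} l)) \<partial>e.stieltjes)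
      = emeasure e.stieltjes {0<..r} + ((\<integral>\<^sup>+l\<in>{r<..}. a l \<partial>e.stieltjes) + c * (\<integral>\<^sup>+l\<in>{0<..}. b l \<partial>e.stieltjes))"
    if [measurable]: "a \<in> borel_measurable borel" "b \<in> borel_measurable borel" for a b :: "real \<Rightarrow> ennreal" and c
    by (simp add: nn_integral_add nn_integral_cmult)
  have K: "?K > 0" by simp
  have "(\<integral>\<^sup>+\<omega>. ennreal (e (max_psum \<omega> / ?K)) \<partial>M) = (\<integral>\<^sup>+l\<in>{0<..}. emeasure M {\<omega>\<in>space M. l \<le> max_psum \<omega> / ?K} \<partial>e.stieltjes)"
    using max_psum_nonneg by (intro e.nn_integral_layer_cake sigma_finite_measure_axioms) auto
  also have "\<dots> \<le> (\<integral>\<^sup>+l. indicator {0<..r} l + (emeasure M (?A l) * indicator {r<..} l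
      + ennreal (?q ^ j) * (emeasure M (?B l) * indicator {0<..} l)) \<partial>e.stieltjes)"
  proof (rule nn_integral_mono)
    fix l :: real
    let ?L = "{\<omega>\<in>space M. l \<le> max_psum \<omega> / ?K}"
    consider "l \<le> 0" | "0 < l" "l \<le> r" | "r < l" by linarith
    then show "emeasure M ?L * indicator {0<..} l \<le> indicator {0<..r} l + (emeasure M (?A l) * indicator {r<..} l
      + ennreal (?q ^ j) * (emeasure M (?B l) * indicator {0<..} l))"
    proof cases
      case 2
      then show ?thesis by (simp add: emeasure_le_1 add_increasing2)
    next
      case 3
      then have l: "l > 0" using assms by simp
      \<comment> \<open>For r < l the level l + j(2l + 2r) is at most (1 + 4j) l, which is the
        origin of the divisor.\<close>
      have "real j * (2 * r) \<le> real j * (2 * l)" using 3 by (intro mult_left_mono) auto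
      then have "?L \<subseteq> {\<omega>\<in>space M. \<exists>k\<le>n. l + real j * (2 * l + 2 * r) \<le> norm (psum k \<omega>)}"
        using K by (auto simp: le_divide_eq max_psum_ge_iff[symmetric] algebra_simps intro: order_trans)
      then have "prob ?L \<le> prob {\<omega>\<in>space M. \<exists>k\<le>n. l + real j * (2 * l + 2 * r) \<le> norm (psum k \<omega>)}"
        by (intro finite_measure_mono events_psum)
      also have "\<dots> \<le> prob (?A l) + ?q ^ j * prob (?B l)"
        using prob_max_psum_ge[of l r "2 * l" j] l assms by (simp add: max_psum_ge_iff)
      finally have "ennreal (prob ?L) \<le> ennreal (prob (?A l)) + ennreal (?q ^ j) * ennreal (prob (?B l))"
        by (simp add: ennreal_mult[symmetric] ennreal_plus[symmetric] ennreal_leI del: ennreal_plus)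
      then show ?thesis using 3 l by (simp add: emeasure_eq_measure)
    qed simp
  qed
  also have "\<dots> = emeasure e.stieltjes {0<..r} + ((\<integral>\<^sup>+l\<in>{r<..}. emeasure M (?A l) \<partial>e.stieltjes)
      + ennreal (?q ^ j) * (\<integral>\<^sup>+l\<in>{0<..}. emeasure M (?B l) \<partial>e.stieltjes))"
    by (rule split[OF mA mB])
  also have "(\<integral>\<^sup>+l\<in>{0<..}. emeasure M (?B l) \<partial>e.stieltjes) = (\<integral>\<^sup>+\<omega>. ennreal (e (max_psum \<omega>)) \<partial>M)"
    using max_psum_nonneg by (intro e.nn_integral_layer_cake[symmetric] sigma_finite_measure_axioms) auto
  also have "emeasure e.stieltjes {0<..r} = ennreal (e r)"
    using e.emeasure_stieltjes_Ioc[of 0 r] assms e.zero by simp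
  finally show ?thesis by (simp add: add.assoc)
qed

end

text \<open>The term \<open>D * q * a\<close> can be moved to the left only because a is finite. For
  \<open>b = \<top>\<close> the case \<open>D = 0\<close> is separate, as
  \<open>0 * \<top> = 0\<close>.\<close>

lemma ennreal_le_absorb:
  fixes a b :: ennreal and D q :: real
  assumes "a \<le> ennreal D * (b + ennreal q * a)" "a < \<top>" "D \<ge> 0" "q \<ge> 0" "D * q \<le> 1/2"
  shows "a \<le> ennreal (2 * D) * b"
proof -
  obtain x where x: "a = ennreal x" "x \<ge> 0" using assms(2) by (cases a) auto
  show ?thesis
  proof (cases "b = \<top>")
    case True
    show ?thesis
    proof (cases "D = 0")
      case False
      then show ?thesis using True assms(3) by (simp add: ennreal_mult_top)
    qed (use assms(1) True in auto)
  next
    case False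
    then obtain y where y: "b = ennreal y" "y \<ge> 0" by (cases b) auto
    have "ennreal x \<le> ennreal (D * (y + q * x))"
      using assms(1) unfolding x y using assms(3,4) x(2) y(2)
      by (simp add: ennreal_mult[symmetric] ennreal_plus[symmetric] del: ennreal_plus)
    then have "x \<le> D * (y + q * x)" using assms(3,4) x(2) y(2) by (simp add: ennreal_le_iff)
    also have "\<dots> = D * y + (D * q) * x" by (simp add: algebra_simps)
    also have "\<dots> \<le> D * y + 1/2 * x" using assms(5) x(2) by (intro add_left_mono mult_right_mono)
    finally have "x \<le> 2 * D * y" by simp
    then show ?thesis using assms(3) x y by (simp add: ennreal_mult[symmetric] ennreal_leI)
  qed
qed

text \<open>The constants are fixed before the probability space, the summands and n, so that they
  survive refinement of a grid. Dividing the argument of e by 1 + 4j costs the factor D, which is of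
  order p^(-2s); multiplication by p^(2s) then leaves a bound free of j.\<close>

lemma (in normalized) max_psum_bound:
  obtains C :: real and m :: nat where "C > 0" and
    "\<And>M (\<xi> :: nat \<Rightarrow> 'w \<Rightarrow> 'a::euclidean_space) n r. indep_summands M \<xi> n \<Longrightarrow> r > 0 \<Longrightarrow>
      ennreal (measure M {\<omega>\<in>space M. \<forall>k\<le>n. norm (indep_summands.psum \<xi> k \<omega>) \<le> r} ^ m)
        * (\<integral>\<^sup>+\<omega>. ennreal (e (indep_summands.max_psum \<xi> n \<omega>)) \<partial>M)
      \<le> ennreal C * (ennreal (e r) + (\<integral>\<^sup>+l\<in>{r<..}. emeasure M {\<omega>\<in>space M. \<exists>i<n. 2 * l \<le> norm (\<xi> i \<omega>)} \<partial>stieltjes))"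
proof -
  obtain \<rho> s where \<rho>: "\<rho> \<ge> 1" "s \<ge> 1" and grow: "\<And>x K. 0 \<le> x \<Longrightarrow> 1 \<le> K \<Longrightarrow> e (K * x) \<le> \<rho> * K ^ s * e x"
    by (rule growth_nat) blast
  obtain C where C: "C > 0" and it: "\<And>p. 0 < p \<Longrightarrow> p \<le> 1 \<Longrightarrow>
    \<exists>j::nat. \<rho> * (1 + 4 * real j) ^ s * (1 - p) ^ j \<le> 1/2 \<and> 2 * \<rho> * (1 + 4 * real j) ^ s * p ^ (2 * s) \<le> C"
    by (rule exists_iteration_count[OF \<rho>]) blast
  show thesis
  proof (rule that[OF C, of "2 * s"])
    fix M :: "'w measure" and \<xi> :: "nat \<Rightarrow> 'w \<Rightarrow> 'a" and n r
    assume "indep_summands M \<xi> n" and r: "(r::real) > 0"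
    then interpret indep_summands M \<xi> n by simp
    let ?p = "prob {\<omega>\<in>space M. \<forall>k\<le>n. norm (psum k \<omega>) \<le> r}"
    let ?q = "prob {\<omega>\<in>space M. \<exists>k\<le>n. r < norm (psum k \<omega>)}"
    let ?I = "\<integral>\<^sup>+\<omega>. ennreal (e (max_psum \<omega>)) \<partial>M"
    let ?W = "\<integral>\<^sup>+l\<in>{r<..}. emeasure M {\<omega>\<in>space M. \<exists>i<n. 2 * l \<le> norm (\<xi> i \<omega>)} \<partial>stieltjes"
    show "ennreal (?p ^ (2 * s)) * ?I \<le> ennreal C * (ennreal (e r) + ?W)"
    proof (cases "?p = 0")
      \<comment> \<open>No iteration count is available for p = 0, but then the left side is 0, the
        exponent 2s being positive.\<close>
      case True then show ?thesis using \<rho> by (simp add: power_0_left)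
    next
      case False
      then have p: "0 < ?p" "?p \<le> 1" by (simp_all add: zero_less_measure_iff)
      have "{\<omega>\<in>space M. \<forall>k\<le>n. norm (psum k \<omega>) \<le> r} = space M - {\<omega>\<in>space M. \<exists>k\<le>n. r < norm (psum k \<omega>)}"
        by (auto simp: not_less)
      then have q: "?q = 1 - ?p" using prob_compl[OF events_psum(2), of r] by simp
      from it[OF p] obtain j :: nat where j: "\<rho> * (1 + 4 * real j) ^ s * (1 - ?p) ^ j \<le> 1/2"
        "2 * \<rho> * (1 + 4 * real j) ^ s * ?p ^ (2 * s) \<le> C" by blast
      define D where "D = \<rho> * (1 + 4 * real j) ^ s"
      have D: "D \<ge> 0" "D * (1 - ?p) ^ j \<le> 1/2" "2 * D * ?p ^ (2 * s) \<le> C"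
        using \<rho> j by (auto simp: D_def)
      have "?I \<le> (\<integral>\<^sup>+\<omega>. ennreal D * ennreal (e (max_psum \<omega> / (1 + 4 * real j))) \<partial>M)"
      proof (rule nn_integral_mono)
        fix \<omega>
        have "e (max_psum \<omega>) \<le> D * e (max_psum \<omega> / (1 + 4 * real j))"
          using grow[of "max_psum \<omega> / (1 + 4 * real j)" "1 + 4 * real j"] max_psum_nonneg[of \<omega>] by (simp add: D_def)
        then show "ennreal (e (max_psum \<omega>)) \<le> ennreal D * ennreal (e (max_psum \<omega> / (1 + 4 * real j)))"
          using D nonneg max_psum_nonneg[of \<omega>] by (simp add: ennreal_mult[symmetric] ennreal_leI)
      qed
      also have "\<dots> = ennreal D * (\<integral>\<^sup>+\<omega>. ennreal (e (max_psum \<omega> / (1 + 4 * real j))) \<partial>M)"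
      proof (rule nn_integral_cmult)
        have "(\<lambda>\<omega>. e (max 0 (max_psum \<omega> / (1 + 4 * real j)))) \<in> borel_measurable M" by measurable
        then show "(\<lambda>\<omega>. ennreal (e (max_psum \<omega> / (1 + 4 * real j)))) \<in> borel_measurable M"
          using max_psum_nonneg by (simp add: max_absorb2)
      qed
      also have "\<dots> \<le> ennreal D * ((ennreal (e r) + ?W) + ennreal ((1 - ?p) ^ j) * ?I)"
        using nn_integral_max_psum_step[OF normalized_axioms r, of j] unfolding q by (intro mult_left_mono) auto
      finally have I: "?I \<le> ennreal D * ((ennreal (e r) + ?W) + ennreal ((1 - ?p) ^ j) * ?I)" .
      \<comment> \<open>Boundedness of e supplies the finiteness that the absorption
        requires.\<close>
      have "?I \<le> (\<integral>\<^sup>+\<omega>. ennreal (e 1) \<partial>M)"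
        by (intro nn_integral_mono ennreal_leI le_e1 max_psum_nonneg)
      also have "\<dots> < \<top>" by (simp add: emeasure_space_1)
      finally have "?I \<le> ennreal (2 * D) * (ennreal (e r) + ?W)"
        using D p by (intro ennreal_le_absorb[OF I]) auto
      then have "ennreal (?p ^ (2 * s)) * ?I \<le> ennreal (?p ^ (2 * s)) * (ennreal (2 * D) * (ennreal (e r) + ?W))"
        by (rule mult_left_mono) simp
      also have "\<dots> = ennreal (2 * D * ?p ^ (2 * s)) * (ennreal (e r) + ?W)"
        by (subst mult.assoc[symmetric], subst ennreal_mult[symmetric]) (use D in \<open>auto simp: mult_ac\<close>)
      also have "\<dots> \<le> ennreal C * (ennreal (e r) + ?W)"
        using D by (intro mult_right_mono ennreal_leI) auto
      finally show ?thesis .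
    qed
  qed
qed

section \<open>Paths, jumps and the moment bound\<close>

context additive_process
begin

lemma right_tendsto:
  assumes "\<omega> \<in> space M" "0 \<le> t" "\<And>n. t \<le> s n" "s \<longlonglongrightarrow> t"
  shows "(\<lambda>n. X (s n) \<omega>) \<longlonglongrightarrow> X t \<omega>"
proof -
  have "continuous (at t within {t..}) (\<lambda>s. X s \<omega>)"
    using right_cont[OF assms(1,2)] by (simp add: continuous_within at_within_Ici_at_right)
  then show ?thesis
    using assms(3,4) unfolding continuous_within_sequentially by (auto simp: comp_def)
qed

text \<open>The left limit at v is written as \<open>X v \<omega> - jump X v \<omega>\<close>. The
  value v = 0 is allowed: there the jump is an arbitrary value, but no u satisfies the conditions of
  the second estimate.\<close>

lemma local_oscillation:
  assumes w: "\<omega> \<in> space M" and "0 \<le> v" "\<epsilon> > 0"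
  obtains d where "d > 0"
    "\<And>u. v \<le> u \<Longrightarrow> u < v + d \<Longrightarrow> norm (X u \<omega> - X v \<omega>) < \<epsilon>"
    "\<And>u. 0 \<le> u \<Longrightarrow> v - d < u \<Longrightarrow> u < v \<Longrightarrow> norm (X u \<omega> - (X v \<omega> - jump X v \<omega>)) < \<epsilon>"
proof -
  have "((\<lambda>s. X s \<omega>) \<longlongrightarrow> X v \<omega>) (at_right v)"
    using right_cont[OF w \<open>0 \<le> v\<close>] by (simp add: continuous_within)
  then have "\<forall>\<^sub>F u in at_right v. dist (X u \<omega>) (X v \<omega>) < \<epsilon>" using \<open>\<epsilon> > 0\<close> by (rule tendstoD)
  then obtain b where b: "b > v" "\<And>u. v < u \<Longrightarrow> u < b \<Longrightarrow> dist (X u \<omega>) (X v \<omega>) < \<epsilon>"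
    unfolding eventually_at_right_field by blast
  have "\<exists>a<v. \<forall>u. 0 \<le> u \<longrightarrow> a < u \<longrightarrow> u < v \<longrightarrow> dist (X u \<omega>) (X v \<omega> - jump X v \<omega>) < \<epsilon>"
  proof (cases "v = 0")
    case True then show ?thesis by (intro exI[of _ "-1"]) auto
  next
    case False
    then obtain L where L: "((\<lambda>s. X s \<omega>) \<longlongrightarrow> L) (at_left v)" using left_lim[OF w, of v] \<open>0 \<le> v\<close> by auto
    then have "Lim (at_left v) (\<lambda>u. X u \<omega>) = L" by (intro tendsto_Lim) auto
    moreover have "\<forall>\<^sub>F u in at_left v. dist (X u \<omega>) L < \<epsilon>" using L \<open>\<epsilon> > 0\<close> by (rule tendstoD)
    ultimately show ?thesis unfolding eventually_at_left_field by (auto simp: jump_def)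
  qed
  then obtain a where a: "a < v" "\<And>u. 0 \<le> u \<Longrightarrow> a < u \<Longrightarrow> u < v \<Longrightarrow> dist (X u \<omega>) (X v \<omega> - jump X v \<omega>) < \<epsilon>" by blast
  show thesis
  proof (rule that[of "min (b - v) (v - a)"])
    fix u assume u: "v \<le> u" "u < v + min (b - v) (v - a)"
    show "norm (X u \<omega> - X v \<omega>) < \<epsilon>"
      using b(2)[of u] u \<open>\<epsilon> > 0\<close> by (cases "u = v") (auto simp: dist_norm)
  next
    fix u assume "0 \<le> u" "v - min (b - v) (v - a) < u" "u < v"
    then show "norm (X u \<omega> - (X v \<omega> - jump X v \<omega>)) < \<epsilon>" using a(2)[of u] by (auto simp: dist_norm)
  qed (use a b in auto)
qed

text \<open>The one-sided limits bound the path near each time, and finitely many such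
  neighbourhoods cover the compact interval. A real-valued supremum says something only for bounded
  sets, so every use of \<open>run_max\<close> rests on this.\<close>

lemma bounded_path:
  assumes w: "\<omega> \<in> space M"
  shows "bdd_above ((\<lambda>s. norm (X s \<omega>)) ` {0..t})"
proof -
  have "\<exists>d>0. \<exists>B. \<forall>u. 0 \<le> u \<longrightarrow> \<bar>u - v\<bar> < d \<longrightarrow> norm (X u \<omega>) \<le> B" if "v \<in> {0..t}" for v
  proof -
    from that obtain d where d: "d > 0"
      "\<And>u. v \<le> u \<Longrightarrow> u < v + d \<Longrightarrow> norm (X u \<omega> - X v \<omega>) < 1"
      "\<And>u. 0 \<le> u \<Longrightarrow> v - d < u \<Longrightarrow> u < v \<Longrightarrow> norm (X u \<omega> - (X v \<omega> - jump X v \<omega>)) < 1"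
      by (auto intro: local_oscillation[OF w, of v 1])
    have "norm (X u \<omega>) \<le> 1 + norm (X v \<omega>) + norm (X v \<omega> - jump X v \<omega>)" if "0 \<le> u" "\<bar>u - v\<bar> < d" for u
    proof (cases "v \<le> u")
      case True
      then show ?thesis using d(2)[of u] that norm_triangle_sub[of "X u \<omega>" "X v \<omega>"] norm_ge_zero[of "X v \<omega> - jump X v \<omega>"] by linarith
    next
      case False
      then show ?thesis using d(3)[of u] that norm_triangle_sub[of "X u \<omega>" "X v \<omega> - jump X v \<omega>"] norm_ge_zero[of "X v \<omega>"] by linarith
    qed
    with d(1) show ?thesis by blast
  qed
  then obtain d B where d: "\<And>v. v \<in> {0..t} \<Longrightarrow> d v > 0"
    and B: "\<And>v u. v \<in> {0..t} \<Longrightarrow> 0 \<le> u \<Longrightarrow> \<bar>u - v\<bar> < d v \<Longrightarrow> norm (X u \<omega>) \<le> B v"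
    by metis
  obtain D where D: "D \<subseteq> {0..t}" "finite D" "{0..t} \<subseteq> (\<Union>v\<in>D. ball v (d v))"
  proof (rule compactE_image[of "{0..t}" "{0..t}" "\<lambda>v. ball v (d v)"])
    show "{0..t} \<subseteq> (\<Union>v\<in>{0..t}. ball v (d v))" using d by force
  qed auto
  show ?thesis
  proof (rule bdd_aboveI2)
    fix s assume s: "s \<in> {0..t}"
    then obtain v where v: "v \<in> D" "s \<in> ball v (d v)" using D(3) by blast
    then have "norm (X s \<omega>) \<le> B v" using B[of v s] D(1) s by (auto simp: dist_real_def abs_minus_commute)
    also have "\<dots> \<le> Max (B ` D)" using v D(2) by simp
    finally show "norm (X s \<omega>) \<le> Max (B ` D)" .
  qed
qed

lemma run_max_upper: "\<omega> \<in> space M \<Longrightarrow> 0 \<le> s \<Longrightarrow> s \<le> t \<Longrightarrow> norm (X s \<omega>) \<le> run_max X t \<omega>"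
  unfolding run_max_def by (intro cSUP_upper bounded_path) auto

lemma run_max_least: "0 \<le> t \<Longrightarrow> (\<And>s. 0 \<le> s \<Longrightarrow> s \<le> t \<Longrightarrow> norm (X s \<omega>) \<le> B) \<Longrightarrow> run_max X t \<omega> \<le> B"
  unfolding run_max_def by (intro cSUP_least) auto

lemma run_max_mono: "\<omega> \<in> space M \<Longrightarrow> 0 \<le> s \<Longrightarrow> s \<le> t \<Longrightarrow> run_max X s \<omega> \<le> run_max X t \<omega>"
  by (rule run_max_least) (auto intro: run_max_upper)

lemma run_max_nonneg: "\<omega> \<in> space M \<Longrightarrow> 0 \<le> t \<Longrightarrow> 0 \<le> run_max X t \<omega>"
  using run_max_upper[of \<omega> 0 t] norm_ge_zero order_trans by blast

lemma run_max_zero: "\<omega> \<in> space M \<Longrightarrow> run_max X 0 \<omega> = 0"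
  by (simp add: run_max_def X_zero)

section \<open>Dyadic grids: the running maximum and large jumps as limits\<close>

definition grid_incr :: "real \<Rightarrow> nat \<Rightarrow> nat \<Rightarrow> 'w \<Rightarrow> 'a" where
  "grid_incr t N i \<omega> = X (t * real (Suc i) / 2 ^ N) \<omega> - X (t * real i / 2 ^ N) \<omega>"

lemma indep_summands_grid:
  assumes "t > 0" shows "indep_summands M (grid_incr t N) (2 ^ N)"
proof -
  have "indep_vars (\<lambda>_. borel) (\<lambda>i \<omega>. X (t * real (Suc i) / 2 ^ N) \<omega> - X (t * real i / 2 ^ N) \<omega>) {..<2 ^ N}"
    using assms by (intro indep_increments[where ts = "\<lambda>i. t * real i / 2 ^ N"]) (auto simp: divide_strict_right_mono)
  then show ?thesis
    by unfold_locales (simp add: grid_incr_def[abs_def])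
qed

lemma psum_grid:
  assumes "t > 0" "\<omega> \<in> space M"
  shows "indep_summands.psum (grid_incr t N) k \<omega> = X (t * real k / 2 ^ N) \<omega>"
proof -
  interpret G: indep_summands M "grid_incr t N" "2 ^ N" by (rule indep_summands_grid[OF assms(1)])
  show ?thesis
    unfolding G.psum_def grid_incr_def
    using sum_lessThan_telescope[of "\<lambda>i. X (t * real i / 2 ^ N) \<omega>" k] X_zero[OF assms(2)] by simp
qed

lemma max_psum_grid_le:
  assumes "t > 0" "\<omega> \<in> space M"
  shows "indep_summands.max_psum (grid_incr t N) (2 ^ N) \<omega> \<le> run_max X t \<omega>"
proof -
  interpret G: indep_summands M "grid_incr t N" "2 ^ N" by (rule indep_summands_grid[OF assms(1)])
  show ?thesis unfolding G.max_psum_def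
  proof (rule Max.boundedI)
    fix a assume "a \<in> (\<lambda>k. norm (G.psum k \<omega>)) ` {..2 ^ N}"
    then obtain k where k: "k \<le> 2 ^ N" "a = norm (G.psum k \<omega>)" by auto
    then have "real k \<le> 2 ^ N" by (metis of_nat_le_iff of_nat_numeral of_nat_power)
    then have "t * real k / 2 ^ N \<le> t" using assms(1) by (simp add: divide_le_eq)
    then show "a \<le> run_max X t \<omega>"
      using assms unfolding k(2) by (subst psum_grid) (auto intro!: run_max_upper)
  qed auto
qed

text \<open>By right continuity a near-maximiser s is approached by the values at the grid points at
  or just to the right of it. Rounding up never leaves the interval, so s = t is allowed.\<close>

lemma max_psum_grid_tendsto:
  assumes "t > 0" "\<omega> \<in> space M"
  shows "(\<lambda>N. indep_summands.max_psum (grid_incr t N) (2 ^ N) \<omega>) \<longlonglongrightarrow> run_max X t \<omega>"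
proof (rule LIMSEQ_I)
  fix \<epsilon> :: real assume "\<epsilon> > 0"
  let ?m = "\<lambda>N. indep_summands.max_psum (grid_incr t N) (2 ^ N) \<omega>"
  have "run_max X t \<omega> - \<epsilon> < (SUP s\<in>{0..t}. norm (X s \<omega>))"
    using \<open>\<epsilon> > 0\<close> by (simp add: run_max_def)
  then obtain s where s: "0 \<le> s" "s \<le> t" "run_max X t \<omega> - \<epsilon> < norm (X s \<omega>)"
    using assms by (subst (asm) less_cSUP_iff) (auto intro: bounded_path)
  define k where "k N = nat \<lceil>s * 2 ^ N / t\<rceil>" for N
  have k1: "s * 2 ^ N / t \<le> real (k N)" "real (k N) \<le> s * 2 ^ N / t + 1" for N
    using s assms by (auto simp: k_def)
  have k2: "k N \<le> 2 ^ N" for N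
  proof -
    have "s * 2 ^ N / t \<le> 2 ^ N" using s assms by (simp add: divide_le_eq mult.commute mult_left_mono)
    then have "\<lceil>s * 2 ^ N / t\<rceil> \<le> 2 ^ N" by (simp add: ceiling_le_iff)
    then show ?thesis by (simp add: k_def nat_le_iff)
  qed
  have "(\<lambda>N. t * real (k N) / 2 ^ N) \<longlonglongrightarrow> s"
  proof (rule tendsto_sandwich)
    show "\<forall>\<^sub>F N in sequentially. s \<le> t * real (k N) / 2 ^ N"
      using k1(1) assms by (intro always_eventually allI) (simp add: field_simps)
    show "\<forall>\<^sub>F N in sequentially. t * real (k N) / 2 ^ N \<le> s + t / 2 ^ N"
      using k1(2) assms by (intro always_eventually allI) (simp add: field_simps)
    show "(\<lambda>N. s + t / 2 ^ N) \<longlonglongrightarrow> s"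
      using tendsto_add[OF tendsto_const LIMSEQ_divide_realpow_zero[of 2 t], of s] by simp
  qed auto
  then have "(\<lambda>N. X (t * real (k N) / 2 ^ N) \<omega>) \<longlonglongrightarrow> X s \<omega>"
    using k1(1) assms s by (intro right_tendsto) (auto simp: field_simps)
  then have "(\<lambda>N. norm (X (t * real (k N) / 2 ^ N) \<omega>)) \<longlonglongrightarrow> norm (X s \<omega>)" by (rule tendsto_norm)
  then have "\<forall>\<^sub>F N in sequentially. run_max X t \<omega> - \<epsilon> < norm (X (t * real (k N) / 2 ^ N) \<omega>)"
    using s(3) by (rule order_tendstoD)
  then obtain N0 where N0: "\<And>N. N \<ge> N0 \<Longrightarrow> run_max X t \<omega> - \<epsilon> < norm (X (t * real (k N) / 2 ^ N) \<omega>)"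
    unfolding eventually_sequentially by blast
  have "norm (?m N - run_max X t \<omega>) < \<epsilon>" if "N \<ge> N0" for N
  proof -
    interpret G: indep_summands M "grid_incr t N" "2 ^ N" by (rule indep_summands_grid[OF assms(1)])
    have "norm (G.psum (k N) \<omega>) \<le> G.max_psum \<omega>" using k2[of N] G.max_psum_ge_iff by blast
    with N0[OF that] have "run_max X t \<omega> - \<epsilon> < G.max_psum \<omega>" by (simp add: psum_grid[OF assms])
    with max_psum_grid_le[OF assms, of N] show ?thesis by auto
  qed
  then show "\<exists>N0. \<forall>N\<ge>N0. norm (?m N - run_max X t \<omega>) < \<epsilon>" by blast
qed

lemma measurable_run_max: "0 \<le> t \<Longrightarrow> run_max X t \<in> borel_measurable M"
proof (cases "t = 0")
  case True
  then show ?thesis using measurable_cong[of M "run_max X t" "\<lambda>_. 0" borel] run_max_zero by simp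
next
  case False
  assume "0 \<le> t"
  with False have t: "t > 0" by simp
  show ?thesis
    by (rule borel_measurable_LIMSEQ_real[OF max_psum_grid_tendsto[OF t]])
       (auto intro: indep_summands.measurable_max_psum indep_summands_grid t)
qed

text \<open>By contraposition: if all jumps are at most l, every time has a neighbourhood on which
  the path oscillates by less than 2l, and once the mesh is below a Lebesgue number of this cover no
  grid increment reaches 2l. The factor 2 leaves room for the oscillation on both sides of a jump of
  size l.\<close>

lemma large_grid_incr_imp_jump:
  assumes t: "t > 0" and w: "\<omega> \<in> space M" and "l > 0"
    and freq: "\<exists>\<^sub>F N in sequentially. \<exists>i<2 ^ N. 2 * l \<le> norm (grid_incr t N i \<omega>)"
  shows "\<exists>v. 0 < v \<and> v \<le> t \<and> l < norm (jump X v \<omega>)"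
proof (rule ccontr)
  assume "\<not> ?thesis"
  then have small: "\<And>v. 0 < v \<Longrightarrow> v \<le> t \<Longrightarrow> norm (jump X v \<omega>) \<le> l"
    by (auto simp: not_less)
  have "\<exists>d>0. \<forall>a b. 0 \<le> a \<longrightarrow> a \<le> b \<longrightarrow> b \<le> t \<longrightarrow> a \<in> ball v d \<longrightarrow> b \<in> ball v d \<longrightarrow> norm (X b \<omega> - X a \<omega>) < 2 * l"
    if v: "v \<in> {0..t}" for v
  proof -
    obtain d where d: "d > 0"
      "\<And>u. v \<le> u \<Longrightarrow> u < v + d \<Longrightarrow> norm (X u \<omega> - X v \<omega>) < l / 3"
      "\<And>u. 0 \<le> u \<Longrightarrow> v - d < u \<Longrightarrow> u < v \<Longrightarrow> norm (X u \<omega> - (X v \<omega> - jump X v \<omega>)) < l / 3"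
      using local_oscillation[OF w, of v "l / 3"] v \<open>l > 0\<close> by auto
    have "norm (X b \<omega> - X a \<omega>) < 2 * l" if ab: "0 \<le> a" "a \<le> b" "b \<le> t" "a \<in> ball v d" "b \<in> ball v d" for a b
    proof -
      have ab': "v - d < a" "a < v + d" "v - d < b" "b < v + d" using ab by (auto simp: dist_real_def)
      consider "v \<le> a" | "a < v" "v \<le> b" | "b < v" by linarith
      then show ?thesis
      proof cases
        case 1
        then show ?thesis using d(2)[of a] d(2)[of b] ab ab' \<open>l > 0\<close>
          norm_triangle_ineq4[of "X b \<omega> - X v \<omega>" "X a \<omega> - X v \<omega>"] by simp
      next
        case 2
        let ?J = "jump X v \<omega>"
        have "norm (X b \<omega> - X a \<omega>) = norm ((X b \<omega> - X v \<omega>) - (X a \<omega> - (X v \<omega> - ?J)) + ?J)" by (simp add: algebra_simps)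
        also have "\<dots> \<le> norm (X b \<omega> - X v \<omega>) + norm (X a \<omega> - (X v \<omega> - ?J)) + norm ?J"
          by (intro order_trans[OF norm_triangle_ineq] add_right_mono norm_triangle_ineq4)
        \<comment> \<open>Here a < v, so v is positive and the bound on jumps applies to it; the
          total 5l/3 stays below 2l.\<close>
        also have "\<dots> < l / 3 + l / 3 + l"
          using d(2)[of b] d(3)[of a] small[of v] 2 ab ab' by linarith
        finally show ?thesis using \<open>l > 0\<close> by simp
      next
        case 3
        then show ?thesis using d(3)[of a] d(3)[of b] ab ab' \<open>l > 0\<close>
          norm_triangle_ineq4[of "X b \<omega> - (X v \<omega> - jump X v \<omega>)" "X a \<omega> - (X v \<omega> - jump X v \<omega>)"] by simp
      qed
    qed
    with d(1) show ?thesis by blast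
  qed
  then obtain d where d: "\<And>v. v \<in> {0..t} \<Longrightarrow> d v > 0"
    and dd: "\<And>v a b. v \<in> {0..t} \<Longrightarrow> 0 \<le> a \<Longrightarrow> a \<le> b \<Longrightarrow> b \<le> t \<Longrightarrow> a \<in> ball v (d v) \<Longrightarrow> b \<in> ball v (d v) \<Longrightarrow> norm (X b \<omega> - X a \<omega>) < 2 * l"
    by metis
  obtain \<delta> where \<delta>: "\<delta> > 0" "\<And>x. x \<in> {0..t} \<Longrightarrow> \<exists>G\<in>(\<lambda>v. ball v (d v)) ` {0..t}. ball x \<delta> \<subseteq> G"
  proof (rule Heine_Borel_lemma[of "{0..t}" "(\<lambda>v. ball v (d v)) ` {0..t}"])
    show "{0..t} \<subseteq> \<Union>((\<lambda>v. ball v (d v)) ` {0..t})" using d by force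
  qed auto
  have "(\<lambda>N. t / 2 ^ N) \<longlonglongrightarrow> 0" by (intro LIMSEQ_divide_realpow_zero) simp
  then have "\<forall>\<^sub>F N in sequentially. t / 2 ^ N < \<delta>" using \<delta>(1) by (rule order_tendstoD)
  then have "\<forall>\<^sub>F N in sequentially. \<not> (\<exists>i<2 ^ N. 2 * l \<le> norm (grid_incr t N i \<omega>))"
  proof eventually_elim
    case (elim N)
    show ?case
    proof clarify
      fix i :: nat assume i: "i < 2 ^ N" "2 * l \<le> norm (grid_incr t N i \<omega>)"
      let ?a = "t * real i / 2 ^ N" and ?b = "t * real (Suc i) / 2 ^ N"
      have "real (Suc i) \<le> 2 ^ N" using i(1) by (metis Suc_leI of_nat_le_iff of_nat_numeral of_nat_power)
      then have b: "?b \<le> t" using t by (simp add: divide_le_eq)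
      have a: "0 \<le> ?a" "?b = ?a + t / 2 ^ N" using t by (auto simp: field_simps)
      have "0 < t / 2 ^ N" using t by simp
      then have ab: "?a \<le> ?b" "?a \<in> {0..t}" "?a \<in> ball ?a \<delta>" "?b \<in> ball ?a \<delta>"
        using a b elim \<delta>(1) by (auto simp: dist_real_def)
      obtain v where "v \<in> {0..t}" "ball ?a \<delta> \<subseteq> ball v (d v)" using \<delta>(2)[OF ab(2)] by blast
      then have v: "v \<in> {0..t}" "?a \<in> ball v (d v)" "?b \<in> ball v (d v)" using ab(3,4) by blast+
      have "norm (X ?b \<omega> - X ?a \<omega>) < 2 * l" by (rule dd[OF v(1) a(1) ab(1) b v(2,3)])
      with i(2) show False by (simp add: grid_incr_def)
    qed
  qed
  with freq show False by (simp add: frequently_def)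
qed

text \<open>As a limsup of grid events this is visibly measurable. For positive t and l it lies
  inside the event that some jump up to time t exceeds l; that inclusion is all that is claimed, the
  two need not coincide.\<close>

definition large_jump :: "real \<Rightarrow> real \<Rightarrow> 'w set" where
  "large_jump t l = {\<omega>\<in>space M. \<exists>\<^sub>F N in sequentially. \<exists>i<2 ^ N. 2 * l \<le> norm (grid_incr t N i \<omega>)}"

lemma large_jump_eq:
  "large_jump t l = (\<Inter>n. \<Union>N\<in>{n..}. {\<omega>\<in>space M. \<exists>i<2 ^ N. 2 * l \<le> norm (grid_incr t N i \<omega>)})"
  by (auto simp: large_jump_def frequently_sequentially Bex_def)

lemma large_grid_incr_events: "t > 0 \<Longrightarrow> {\<omega>\<in>space M. \<exists>i<2 ^ N. u \<le> norm (grid_incr t N i \<omega>)} \<in> events"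
  by (rule indep_summands.events_summand[OF indep_summands_grid])

lemma large_jump_events: "t > 0 \<Longrightarrow> large_jump t l \<in> events"
  unfolding large_jump_eq by (intro countable_Un_Int large_grid_incr_events UNIV_not_empty)

lemma large_grid_incr_antimono:
  assumes "u \<le> u'"
  shows "{\<omega>\<in>space M. \<exists>i<n. u' \<le> norm (grid_incr t N i \<omega>)} \<subseteq> {\<omega>\<in>space M. \<exists>i<n. u \<le> norm (grid_incr t N i \<omega>)}"
  using order_trans[OF assms] by blast

lemma large_jump_antimono: "l \<le> l' \<Longrightarrow> large_jump t l' \<subseteq> large_jump t l"
  unfolding large_jump_eq by (intro INF_mono UN_mono large_grid_incr_antimono bexI) auto

lemma borel_measurable_emeasure_large_jump:
  "t > 0 \<Longrightarrow> (\<lambda>l. emeasure M (large_jump t l)) \<in> borel_measurable borel"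
  by (intro borel_measurable_emeasure_antimono large_jump_events large_jump_antimono)

text \<open>A path in the event contributes at least 1 to the jump count. The two integrands are
  compared pointwise, so measurability is asked of the event alone and not of the count.\<close>

lemma emeasure_large_jump_le_levy_tail:
  assumes "t > 0" "l > 0"
  shows "emeasure M (large_jump t l) \<le> levy_tail M X (ennreal t) l"
proof -
  have "emeasure M (large_jump t l) = (\<integral>\<^sup>+\<omega>. indicator (large_jump t l) \<omega> \<partial>M)"
    using large_jump_events[OF assms(1)] by simp
  also have "\<dots> \<le> levy_kernel M X (ennreal t) {x. norm x > l}"
    unfolding levy_kernel_def
  proof (rule nn_integral_mono)
    fix \<omega> assume w: "\<omega> \<in> space M"
    let ?f = "\<lambda>s. indicator {s. jump X s \<omega> \<in> {x. norm x > l} \<and> jump X s \<omega> \<noteq> 0} s * indicator {s. s > 0 \<and> ennreal s \<le> ennreal t} s :: ennreal"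
    show "indicator (large_jump t l) \<omega> \<le> (\<integral>\<^sup>+s. ?f s \<partial>count_space UNIV)"
    proof (cases "\<omega> \<in> large_jump t l")
      case True
      then obtain v where v: "0 < v" "v \<le> t" "l < norm (jump X v \<omega>)"
        using large_grid_incr_imp_jump[OF assms(1) w assms(2)] by (auto simp: large_jump_def)
      then have "jump X v \<omega> \<noteq> 0" using assms(2) by auto
      then have "(1::ennreal) = ?f v" using v by (simp add: ennreal_leI)
      also have "\<dots> \<le> (\<integral>\<^sup>+s. ?f s \<partial>count_space UNIV)" by (rule nn_integral_ge_point) simp
      finally show ?thesis using True by simp
    qed simp
  qed
  finally show ?thesis by (simp add: levy_tail_def)
qed

lemma levy_tail_mono: "s \<le> t \<Longrightarrow> levy_tail M X s l \<le> levy_tail M X t l"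
  unfolding levy_tail_def levy_kernel_def
  by (intro nn_integral_mono) (auto split: split_indicator)

text \<open>\<open>levy_tail\<close> is already an expectation and sees the path only through the
  time at which it is evaluated. On the event that the running maximum stays within r, the exit time
  is at least t and the tail there is at least its value at t, a constant. A product of
  probabilities thus arises without any independence of exit time and jumps.\<close>

lemma EG_lower_bound:
  assumes "t > 0" "l > 0"
  shows "ennreal (prob {\<omega>\<in>space M. run_max X t \<omega> \<le> r}) * emeasure M (large_jump t l) \<le> EG M X r l"
proof -
  let ?A = "{\<omega>\<in>space M. run_max X t \<omega> \<le> r}"
  have A: "?A \<in> events" using measurable_run_max[of t] assms by (auto intro!: borel_measurable_le)
  have "ennreal (prob ?A) * emeasure M (large_jump t l) \<le> levy_tail M X (ennreal t) l * emeasure M ?A"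
    unfolding emeasure_eq_measure[symmetric]
    using emeasure_large_jump_le_levy_tail[OF assms] by (subst mult.commute) (rule mult_right_mono, auto)
  also have "\<dots> = (\<integral>\<^sup>+\<omega>. levy_tail M X (ennreal t) l * indicator ?A \<omega> \<partial>M)"
    using A by (simp add: nn_integral_cmult_indicator)
  also have "\<dots> \<le> EG M X r l"
    unfolding EG_def
  proof (rule nn_integral_mono)
    fix \<omega> assume w: "\<omega> \<in> space M"
    show "levy_tail M X (ennreal t) l * indicator ?A \<omega> \<le> levy_tail M X (exit_time X r \<omega>) l"
    proof (cases "run_max X t \<omega> \<le> r")
      case True
      have "ennreal t \<le> exit_time X r \<omega>"
        unfolding exit_time_def
      proof (rule INF_greatest)
        fix s assume s: "s \<in> {t. t > 0 \<and> norm (X t \<omega>) > r}"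
        then have "\<not> s \<le> t" using run_max_upper[OF w, of s t] True by auto
        then show "ennreal t \<le> ennreal s" by (intro ennreal_leI) simp
      qed
      then show ?thesis using True w by (simp add: levy_tail_mono)
    qed simp
  qed
  finally show ?thesis .
qed

text \<open>The bound for sums is applied on every dyadic grid, with constants that do not depend on
  the grid, and the mesh tends to 0 by dominated convergence on both sides.\<close>

lemma nn_integral_run_max_bound:
  assumes "normalized e"
  obtains C :: real and m :: nat where "C > 0" and
    "\<And>t r. t > 0 \<Longrightarrow> 0 < r \<Longrightarrow>
       ennreal (prob {\<omega>\<in>space M. run_max X t \<omega> \<le> r} ^ m) * (\<integral>\<^sup>+\<omega>. ennreal (e (run_max X t \<omega>)) \<partial>M)
        \<le> ennreal C * (ennreal (e r) + (\<integral>\<^sup>+l\<in>{r<..1}. emeasure M (large_jump t l) \<partial>interval_measure (\<lambda>x. e (max 0 x))))"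
proof -
  interpret e: normalized e by fact
  obtain C :: real and m :: nat where C: "C > 0" and
    bound: "\<And>M (\<xi> :: nat \<Rightarrow> 'w \<Rightarrow> 'a) n r. indep_summands M \<xi> n \<Longrightarrow> r > 0 \<Longrightarrow>
      ennreal (measure M {\<omega>\<in>space M. \<forall>k\<le>n. norm (indep_summands.psum \<xi> k \<omega>) \<le> r} ^ m)
        * (\<integral>\<^sup>+\<omega>. ennreal (e (indep_summands.max_psum \<xi> n \<omega>)) \<partial>M)
      \<le> ennreal C * (ennreal (e r) + (\<integral>\<^sup>+l\<in>{r<..}. emeasure M {\<omega>\<in>space M. \<exists>i<n. 2 * l \<le> norm (\<xi> i \<omega>)} \<partial>e.stieltjes))"
    by (rule e.max_psum_bound) blast
  show thesis
  proof (rule that[OF C, of m])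
    fix t r :: real assume t: "t > 0" and r: "0 < r"
    let ?p = "prob {\<omega>\<in>space M. run_max X t \<omega> \<le> r}"
    let ?B = "\<lambda>N l. {\<omega>\<in>space M. \<exists>i<2 ^ N. 2 * l \<le> norm (grid_incr t N i \<omega>)}"
    \<comment> \<open>The grid events need not be monotone in N and may fail to converge. Their tail
      unions decrease to \<open>large_jump t l\<close>, so continuity from above applies.\<close>
    define U where "U n l = (\<Union>N\<in>{n..}. ?B N l)" for n l
    have Bev: "?B N l \<in> events" for N l by (rule large_grid_incr_events[OF t])
    have Uev: "U n l \<in> events" for n l unfolding U_def by (intro countable_Un_Int Bev)
    have mU: "(\<lambda>l. emeasure M (U n l)) \<in> borel_measurable borel" for n
    proof (rule borel_measurable_emeasure_antimono[OF Uev])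
      fix l l' :: real assume "l \<le> l'"
      then show "U n l' \<subseteq> U n l" unfolding U_def by (intro UN_mono large_grid_incr_antimono) auto
    qed
    have mJ: "(\<lambda>l. emeasure M (large_jump t l)) \<in> borel_measurable borel"
      by (rule borel_measurable_emeasure_large_jump[OF t])
    have le: "ennreal (?p ^ m) * (\<integral>\<^sup>+\<omega>. ennreal (e (indep_summands.max_psum (grid_incr t N) (2 ^ N) \<omega>)) \<partial>M)
      \<le> ennreal C * (ennreal (e r) + (\<integral>\<^sup>+l\<in>{r<..}. emeasure M (U N l) \<partial>e.stieltjes))" (is "?L N \<le> ?R N") for N
    proof -
      interpret G: indep_summands M "grid_incr t N" "2 ^ N" by (rule indep_summands_grid[OF t])
      have eq: "{\<omega>\<in>space M. \<forall>k\<le>2 ^ N. norm (G.psum k \<omega>) \<le> r} = space M - {\<omega>\<in>space M. \<exists>k\<le>2 ^ N. r < norm (G.psum k \<omega>)}"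
        by (auto simp: not_less)
      have ev: "{\<omega>\<in>space M. \<forall>k\<le>2 ^ N. norm (G.psum k \<omega>) \<le> r} \<in> events"
        unfolding eq by (rule sets.compl_sets[OF G.events_psum(2)])
      \<comment> \<open>A bound on the whole path bounds all grid values, so p, which is free of N,
        may replace the grid probability.\<close>
      have "{\<omega>\<in>space M. run_max X t \<omega> \<le> r} \<subseteq> {\<omega>\<in>space M. \<forall>k\<le>2 ^ N. norm (G.psum k \<omega>) \<le> r}"
      proof clarify
        fix \<omega> k assume "\<omega> \<in> space M" "run_max X t \<omega> \<le> r" "k \<le> (2::nat) ^ N"
        moreover from this have "norm (G.psum k \<omega>) \<le> G.max_psum \<omega>" using G.max_psum_ge_iff by blast
        ultimately show "norm (G.psum k \<omega>) \<le> r" using max_psum_grid_le[OF t, of \<omega> N] by linarith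
      qed
      then have "?p ^ m \<le> prob {\<omega>\<in>space M. \<forall>k\<le>2 ^ N. norm (G.psum k \<omega>) \<le> r} ^ m"
        by (intro power_mono finite_measure_mono ev measure_nonneg)
      then have "?L N \<le> ennreal (prob {\<omega>\<in>space M. \<forall>k\<le>2 ^ N. norm (G.psum k \<omega>) \<le> r} ^ m) * (\<integral>\<^sup>+\<omega>. ennreal (e (G.max_psum \<omega>)) \<partial>M)"
        by (intro mult_right_mono ennreal_leI) auto
      also have "\<dots> \<le> ennreal C * (ennreal (e r) + (\<integral>\<^sup>+l\<in>{r<..}. emeasure M (?B N l) \<partial>e.stieltjes))"
        by (rule bound[OF G.indep_summands_axioms r])
      also have "\<dots> \<le> ?R N"
        unfolding U_def
        by (intro mult_left_mono add_left_mono nn_integral_mono mult_right_mono emeasure_mono UN_upper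
            Uev[unfolded U_def] zero_le) simp
      finally show ?thesis .
    qed
    have L: "?L \<longlonglongrightarrow> ennreal (?p ^ m) * (\<integral>\<^sup>+\<omega>. ennreal (e (run_max X t \<omega>)) \<partial>M)"
    proof (rule ennreal_tendsto_cmult)
      show "(\<lambda>N. \<integral>\<^sup>+\<omega>. ennreal (e (indep_summands.max_psum (grid_incr t N) (2 ^ N) \<omega>)) \<partial>M) \<longlonglongrightarrow> (\<integral>\<^sup>+\<omega>. ennreal (e (run_max X t \<omega>)) \<partial>M)"
      proof (rule nn_integral_dominated_convergence[where w="\<lambda>_. ennreal (e 1)"])
        fix N
        interpret G: indep_summands M "grid_incr t N" "2 ^ N" by (rule indep_summands_grid[OF t])
        have "(\<lambda>\<omega>. e (max 0 (G.max_psum \<omega>))) \<in> borel_measurable M"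
          by (rule measurable_compose[OF G.measurable_max_psum e.borel_measurable_extension])
        then show "(\<lambda>\<omega>. ennreal (e (G.max_psum \<omega>))) \<in> borel_measurable M"
          using G.max_psum_nonneg by (simp add: max_absorb2)
        show "AE \<omega> in M. ennreal (e (G.max_psum \<omega>)) \<le> ennreal (e 1)"
          by (intro AE_I2 ennreal_leI e.le_e1 G.max_psum_nonneg)
      next
        have "(\<lambda>\<omega>. e (max 0 (run_max X t \<omega>))) \<in> borel_measurable M"
          using t by (intro measurable_compose[OF measurable_run_max e.borel_measurable_extension]) auto
        then have "(\<lambda>\<omega>. ennreal (e (max 0 (run_max X t \<omega>)))) \<in> borel_measurable M" by simp
        then show "(\<lambda>\<omega>. ennreal (e (run_max X t \<omega>))) \<in> borel_measurable M"
          using run_max_nonneg t by (simp add: max_absorb2 cong: measurable_cong)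
        show "AE \<omega> in M. (\<lambda>N. ennreal (e (indep_summands.max_psum (grid_incr t N) (2 ^ N) \<omega>))) \<longlonglongrightarrow> ennreal (e (run_max X t \<omega>))"
        proof (intro AE_I2 tendsto_ennrealI)
          fix \<omega> assume w: "\<omega> \<in> space M"
          show "(\<lambda>N. e (indep_summands.max_psum (grid_incr t N) (2 ^ N) \<omega>)) \<longlonglongrightarrow> e (run_max X t \<omega>)"
            using max_psum_grid_tendsto[OF t w] run_max_nonneg[OF w] t
              indep_summands.max_psum_nonneg[OF indep_summands_grid[OF t]]
            by (intro continuous_on_tendsto_compose[OF e.continuous]) auto
        qed
      qed (auto simp: emeasure_space_1)
    qed simp
    have R: "?R \<longlonglongrightarrow> ennreal C * (ennreal (e r) + (\<integral>\<^sup>+l\<in>{r<..}. emeasure M (large_jump t l) \<partial>e.stieltjes))"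
    proof (intro ennreal_tendsto_cmult tendsto_add tendsto_const)
      have "emeasure e.stieltjes {r<..} \<le> emeasure e.stieltjes {0<..}" using r by (intro emeasure_mono) auto
      then have fin: "emeasure e.stieltjes {r<..} < \<top>" using e.emeasure_stieltjes_Ioi by (simp add: order_le_less_trans)
      show "(\<lambda>N. \<integral>\<^sup>+l\<in>{r<..}. emeasure M (U N l) \<partial>e.stieltjes) \<longlonglongrightarrow> (\<integral>\<^sup>+l\<in>{r<..}. emeasure M (large_jump t l) \<partial>e.stieltjes)"
      proof (rule nn_integral_dominated_convergence[where w="indicator {r<..}"])
        show "(\<lambda>l. emeasure M (U N l) * indicator {r<..} l) \<in> borel_measurable e.stieltjes" for N
          using mU[of N] by simp
        show "(\<lambda>l. emeasure M (large_jump t l) * indicator {r<..} l) \<in> borel_measurable e.stieltjes"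
          using mJ by simp
        show "AE l in e.stieltjes. (\<lambda>N. emeasure M (U N l) * indicator {r<..} l) \<longlonglongrightarrow> emeasure M (large_jump t l) * indicator {r<..} l"
        proof (intro AE_I2)
          fix l
          have "(\<lambda>N. emeasure M (U N l)) \<longlonglongrightarrow> emeasure M (\<Inter>N. U N l)"
          proof (rule Lim_emeasure_decseq)
            show "range (\<lambda>N. U N l) \<subseteq> events" using Uev by blast
            show "decseq (\<lambda>N. U N l)" unfolding decseq_def U_def by (intro allI impI UN_mono) simp_all
            show "emeasure M (U N l) \<noteq> \<infinity>" for N by (simp add: emeasure_eq_measure)
          qed
          also have "(\<Inter>N. U N l) = large_jump t l" by (simp only: large_jump_eq U_def)
          finally show "(\<lambda>N. emeasure M (U N l) * indicator {r<..} l) \<longlonglongrightarrow> emeasure M (large_jump t l) * indicator {r<..} l"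
            by (cases "r < l") simp_all
        qed
        show "AE l in e.stieltjes. emeasure M (U N l) * indicator {r<..} l \<le> indicator {r<..} l" for N
          by (intro AE_I2) (simp add: emeasure_le_1 split: split_indicator)
        show "(\<integral>\<^sup>+l. indicator {r<..} l \<partial>e.stieltjes) < \<infinity>" using fin by simp
      qed simp
    qed simp
    \<comment> \<open>The Stieltjes measure has no mass beyond 1, so the range can be cut to that of
      \<open>EG_int\<close>.\<close>
    have "(\<integral>\<^sup>+l\<in>{r<..}. emeasure M (large_jump t l) \<partial>e.stieltjes) = (\<integral>\<^sup>+l\<in>{r<..1}. emeasure M (large_jump t l) \<partial>e.stieltjes)"
    proof (rule nn_integral_cong_AE)
      have "{1::real<..} \<in> null_sets e.stieltjes" using e.emeasure_stieltjes_gt_one by auto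
      then have "AE l in e.stieltjes. l \<notin> {1<..}" by (rule AE_not_in)
      then show "AE l in e.stieltjes. emeasure M (large_jump t l) * indicator {r<..} l = emeasure M (large_jump t l) * indicator {r<..1} l"
        by eventually_elim (auto split: split_indicator)
    qed
    with LIMSEQ_le[OF L R] le
    show "ennreal (?p ^ m) * (\<integral>\<^sup>+\<omega>. ennreal (e (run_max X t \<omega>)) \<partial>M)
        \<le> ennreal C * (ennreal (e r) + (\<integral>\<^sup>+l\<in>{r<..1}. emeasure M (large_jump t l) \<partial>e.stieltjes))"
      by auto
  qed
qed

lemma integrable_run_max:
  assumes "normalized e" "0 \<le> t"
  shows "integrable M (\<lambda>\<omega>. e (run_max X t \<omega>))"
proof -
  interpret e: normalized e by fact
  have "(\<lambda>\<omega>. e (max 0 (run_max X t \<omega>))) \<in> borel_measurable M"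
    by (rule measurable_compose[OF measurable_run_max[OF assms(2)] e.borel_measurable_extension])
  then have "(\<lambda>\<omega>. e (run_max X t \<omega>)) \<in> borel_measurable M"
    using run_max_nonneg assms(2) by (simp add: max_absorb2 cong: measurable_cong)
  then show ?thesis
    using e.le_e1 e.nonneg run_max_nonneg[OF _ assms(2)]
    by (intro integrable_const_bound[where B = "e 1"]) auto
qed

text \<open>One more factor p turns the jump probability under the integral into \<open>EG\<close>;
  hence the exponent \<open>Suc m\<close>. Being positive, it can later be removed by a
  root.\<close>

lemma a_fun_bound:
  assumes "normalized e"
  obtains C :: real and m :: nat where "C > 0" "m \<ge> 1" and
    "\<And>t r. t > 0 \<Longrightarrow> 0 < r \<Longrightarrow>
       ennreal (prob {\<omega>\<in>space M. run_max X t \<omega> \<le> r} ^ m * a_fun M X e t) \<le> ennreal C * (ennreal (e r) + EG_int M X e r)"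
proof -
  interpret e: normalized e by fact
  obtain C :: real and m :: nat where C: "C > 0" and
    bound: "\<And>t r. t > 0 \<Longrightarrow> 0 < r \<Longrightarrow>
       ennreal (prob {\<omega>\<in>space M. run_max X t \<omega> \<le> r} ^ m) * (\<integral>\<^sup>+\<omega>. ennreal (e (run_max X t \<omega>)) \<partial>M)
        \<le> ennreal C * (ennreal (e r) + (\<integral>\<^sup>+l\<in>{r<..1}. emeasure M (large_jump t l) \<partial>e.stieltjes))"
    by (rule nn_integral_run_max_bound[OF assms]) blast
  show thesis
  proof (rule that[OF C, of "Suc m"])
    fix t r :: real assume t: "t > 0" and r: "0 < r"
    let ?p = "prob {\<omega>\<in>space M. run_max X t \<omega> \<le> r}"
    have a: "(\<integral>\<^sup>+\<omega>. ennreal (e (run_max X t \<omega>)) \<partial>M) = ennreal (a_fun M X e t)"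
      unfolding a_fun_def using t e.nonneg run_max_nonneg
      by (intro nn_integral_eq_integral integrable_run_max[OF assms]) auto
    have a0: "0 \<le> a_fun M X e t"
      unfolding a_fun_def using t e.nonneg run_max_nonneg by (intro integral_nonneg_AE) auto
    let ?J = "\<lambda>l. emeasure M (large_jump t l)"
    have "ennreal (?p ^ Suc m * a_fun M X e t) = ennreal ?p * (ennreal (?p ^ m) * ennreal (a_fun M X e t))"
      using a0 by (simp add: ennreal_mult mult.assoc)
    also have "\<dots> \<le> ennreal ?p * (ennreal C * (ennreal (e r) + (\<integral>\<^sup>+l\<in>{r<..1}. ?J l \<partial>e.stieltjes)))"
      using bound[OF t r] unfolding a by (rule mult_left_mono) simp
    also have "\<dots> = ennreal C * (ennreal ?p * ennreal (e r) + ennreal ?p * (\<integral>\<^sup>+l\<in>{r<..1}. ?J l \<partial>e.stieltjes))"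
      by (simp add: distrib_left mult.left_commute)
    also have "\<dots> \<le> ennreal C * (ennreal (e r) + EG_int M X e r)"
    proof (intro mult_left_mono add_mono)
      have "ennreal ?p * ennreal (e r) \<le> 1 * ennreal (e r)"
        by (intro mult_right_mono) (auto simp: ennreal_le_1)
      then show "ennreal ?p * ennreal (e r) \<le> ennreal (e r)" by simp
      have "?J \<in> borel_measurable borel" by (rule borel_measurable_emeasure_large_jump[OF t])
      then have "ennreal ?p * (\<integral>\<^sup>+l\<in>{r<..1}. ?J l \<partial>e.stieltjes) = (\<integral>\<^sup>+l. ennreal ?p * (?J l * indicator {r<..1} l) \<partial>e.stieltjes)"
        by (intro nn_integral_cmult[symmetric]) simp
      also have "\<dots> \<le> EG_int M X e r"
        unfolding EG_int_def
      proof (rule nn_integral_mono)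
        fix l show "ennreal ?p * (?J l * indicator {r<..1} l) \<le> EG M X r l * indicator {r<..1} l"
          using EG_lower_bound[OF t, of l r] r by (auto split: split_indicator)
      qed
      finally show "ennreal ?p * (\<integral>\<^sup>+l\<in>{r<..1}. ?J l \<partial>e.stieltjes) \<le> EG_int M X e r" .
    qed auto
    finally show "ennreal (?p ^ Suc m * a_fun M X e t) \<le> ennreal C * (ennreal (e r) + EG_int M X e r)" .
  qed simp
qed

end

section \<open>Behaviour of the running maximum at time zero\<close>

lemma frequently_filterlim:
  assumes "filterlim g F G" "\<exists>\<^sub>F x in G. P (g x)"
  shows "\<exists>\<^sub>F y in F. P y"
  using assms unfolding frequently_def filterlim_iff by blast

lemma ereal_Liminf_eq_0:
  assumes "\<forall>\<^sub>F t in F. 0 \<le> y t" "\<And>\<epsilon>. \<epsilon> > 0 \<Longrightarrow> \<exists>\<^sub>F t in F. y t < \<epsilon>"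
  shows "Liminf F (\<lambda>t. ereal (y t)) = 0"
proof (rule antisym)
  show "0 \<le> Liminf F (\<lambda>t. ereal (y t))"
    using assms(1) by (intro Liminf_bounded) (auto elim: eventually_mono)
  show "Liminf F (\<lambda>t. ereal (y t)) \<le> 0"
  proof (rule ccontr)
    assume "\<not> ?thesis"
    then obtain \<epsilon> where "0 < ereal \<epsilon>" "ereal \<epsilon> < Liminf F (\<lambda>t. ereal (y t))"
      using ereal_dense2[of 0 "Liminf F (\<lambda>t. ereal (y t))"] by (auto simp: not_le)
    then have "\<forall>\<^sub>F t in F. ereal \<epsilon> < ereal (y t)" by (intro less_LiminfD)
    moreover have "\<exists>\<^sub>F t in F. y t < \<epsilon>" using \<open>0 < ereal \<epsilon>\<close> by (intro assms(2)) simp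
    ultimately show False unfolding frequently_def by (auto elim!: eventually_mono notE)
  qed
qed

lemma ereal_Liminf_eq_PInf:
  assumes "\<And>B. \<forall>\<^sub>F t in F. B < y t"
  shows "Liminf F (\<lambda>t. ereal (y t)) = \<infinity>"
proof (rule ereal_top)
  fix B show "ereal B \<le> Liminf F (\<lambda>t. ereal (y t))"
    using assms[of B] by (intro Liminf_bounded) (auto elim: eventually_mono)
qed

lemma ereal_Limsup_eq_0:
  assumes "F \<noteq> bot" "\<forall>\<^sub>F t in F. 0 \<le> y t" "\<And>\<epsilon>. \<epsilon> > 0 \<Longrightarrow> \<forall>\<^sub>F t in F. y t < \<epsilon>"
  shows "Limsup F (\<lambda>t. ereal (y t)) = 0"
proof (rule antisym)
  have "0 \<le> Liminf F (\<lambda>t. ereal (y t))"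
    using assms(2) by (intro Liminf_bounded) (auto elim: eventually_mono)
  then show "0 \<le> Limsup F (\<lambda>t. ereal (y t))" using Liminf_le_Limsup[OF assms(1)] order_trans by blast
  show "Limsup F (\<lambda>t. ereal (y t)) \<le> 0"
  proof (rule ccontr)
    assume "\<not> ?thesis"
    then obtain \<epsilon> where e: "0 < ereal \<epsilon>" "ereal \<epsilon> < Limsup F (\<lambda>t. ereal (y t))"
      using ereal_dense2[of 0 "Limsup F (\<lambda>t. ereal (y t))"] by (auto simp: not_le)
    then have "Limsup F (\<lambda>t. ereal (y t)) \<le> ereal \<epsilon>"
      using assms(3)[of \<epsilon>] by (intro Limsup_bounded) (auto elim: eventually_mono)
    with e(2) show False by simp
  qed
qed

lemma ereal_Limsup_eq_PInf:
  assumes "\<And>B. \<exists>\<^sub>F t in F. B < y t"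
  shows "Limsup F (\<lambda>t. ereal (y t)) = \<infinity>"
proof (rule ereal_top)
  fix B show "ereal B \<le> Limsup F (\<lambda>t. ereal (y t))"
  proof (rule ccontr)
    assume "\<not> ?thesis"
    then have "\<forall>\<^sub>F t in F. ereal (y t) < ereal B" by (intro Limsup_lessD) (simp add: not_le)
    then have "\<forall>\<^sub>F t in F. \<not> B < y t" by (rule eventually_mono) auto
    with assms[of B] show False unfolding frequently_def by blast
  qed
qed

text \<open>Here and in the three lemmas on indices that follow, the condition on the index is
  traded for an inequality at an exponent \<eta>' strictly different from \<eta>. The gap between
  the two is the resource of all later estimates.\<close>

lemma liminf_index_less:
  assumes "liminf_index f < ereal \<eta>"
  obtains \<eta>' where "0 \<le> \<eta>'" "\<eta>' < \<eta>" "\<exists>\<^sub>F r in at_right 0. ennreal (r powr \<eta>') * f r < 1"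
proof -
  from assms obtain \<eta>' where *: "0 \<le> \<eta>'" "\<eta>' < \<eta>" "Liminf (at_right 0) (\<lambda>r. ennreal (r powr \<eta>') * f r) = 0"
    unfolding liminf_index_def INF_less_iff by auto
  have "\<exists>\<^sub>F r in at_right 0. ennreal (r powr \<eta>') * f r < 1"
    unfolding frequently_def
  proof
    assume "\<forall>\<^sub>F r in at_right 0. \<not> ennreal (r powr \<eta>') * f r < 1"
    then have "1 \<le> Liminf (at_right 0) (\<lambda>r. ennreal (r powr \<eta>') * f r)"
      by (intro Liminf_bounded) (auto simp: not_less)
    with *(3) show False by simp
  qed
  with * that show thesis by blast
qed

lemma less_liminf_index:
  assumes "ereal \<eta> < liminf_index f" "0 \<le> \<eta>"
  obtains \<eta>' c where "\<eta> < \<eta>'" "c > 0" "\<forall>\<^sub>F r in at_right 0. ennreal c \<le> ennreal (r powr \<eta>') * f r"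
proof -
  from ereal_dense2[OF assms(1)] obtain \<eta>' where e: "\<eta> < \<eta>'" "ereal \<eta>' < liminf_index f" by auto
  have "liminf_index f \<le> ereal \<eta>'" if "Liminf (at_right 0) (\<lambda>r. ennreal (r powr \<eta>') * f r) = 0"
    unfolding liminf_index_def using that assms(2) e(1) by (intro INF_lower) simp
  then have "Liminf (at_right 0) (\<lambda>r. ennreal (r powr \<eta>') * f r) \<noteq> 0"
    using e(2) by (auto simp: not_less[symmetric])
  then have "0 < Liminf (at_right 0) (\<lambda>r. ennreal (r powr \<eta>') * f r)" by (simp add: zero_less_iff_neq_zero)
  then obtain c' where c': "0 < c'" "c' < Liminf (at_right 0) (\<lambda>r. ennreal (r powr \<eta>') * f r)"
    using dense by blast
  then have "c' < \<top>" using order_less_le_trans top_greatest by blast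
  then obtain c where c: "c' = ennreal c" "c > 0" using c'(1) by (cases c') auto
  have "\<forall>\<^sub>F r in at_right 0. c' < ennreal (r powr \<eta>') * f r" using c'(2) by (rule less_LiminfD)
  then have "\<forall>\<^sub>F r in at_right 0. ennreal c \<le> ennreal (r powr \<eta>') * f r" unfolding c by (rule eventually_mono) simp
  with e c that show thesis by blast
qed

lemma lim_index_less:
  assumes "lim_index f < ereal \<eta>"
  obtains \<eta>' where "0 \<le> \<eta>'" "\<eta>' < \<eta>" "\<forall>\<^sub>F r in at_right 0. ennreal (r powr \<eta>') * f r < 1"
proof -
  from assms obtain \<eta>' where *: "0 \<le> \<eta>'" "\<eta>' < \<eta>" "((\<lambda>r. ennreal (r powr \<eta>') * f r) \<longlongrightarrow> 0) (at_right 0)"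
    unfolding lim_index_def INF_less_iff by auto
  from order_tendstoD(2)[OF *(3), of 1] * that show thesis by auto
qed

lemma less_lim_index:
  assumes "ereal \<eta> < lim_index f" "0 \<le> \<eta>"
  obtains \<eta>' c where "\<eta> < \<eta>'" "c > 0" "\<exists>\<^sub>F r in at_right 0. ennreal c \<le> ennreal (r powr \<eta>') * f r"
proof -
  from ereal_dense2[OF assms(1)] obtain \<eta>' where e: "\<eta> < \<eta>'" "ereal \<eta>' < lim_index f" by auto
  have "lim_index f \<le> ereal \<eta>'" if "((\<lambda>r. ennreal (r powr \<eta>') * f r) \<longlongrightarrow> 0) (at_right 0)"
    unfolding lim_index_def using that assms(2) e(1) by (intro INF_lower) simp
  then have "\<not> ((\<lambda>r. ennreal (r powr \<eta>') * f r) \<longlongrightarrow> 0) (at_right 0)"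
    using e(2) by (auto simp: not_less[symmetric])
  then obtain c' where c': "0 < c'" "\<exists>\<^sub>F r in at_right 0. \<not> ennreal (r powr \<eta>') * f r < c'"
    unfolding order_tendsto_iff frequently_def by auto
  obtain c where c: "c > 0" "ennreal c \<le> c'"
  proof (cases c')
    case (real x) then show thesis using c'(1) by (intro that[of x]) auto
  qed (auto intro: that[of 1])
  have "\<exists>\<^sub>F r in at_right 0. ennreal c \<le> ennreal (r powr \<eta>') * f r"
    using c'(2) by (rule frequently_elim1) (use c(2) in \<open>auto simp: not_less\<close>)
  with e c that show thesis by blast
qed

text \<open>The geometric rate makes every positive power of \<open>r n\<close> summable.\<close>

lemma frequently_at_right_0_sequence:
  assumes "\<exists>\<^sub>F r::real in at_right 0. P r"
  obtains r where "\<And>n::nat. 0 < r n" "\<And>n. r n \<le> (1/2) ^ n" "\<And>n. P (r n)"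
proof -
  have "\<exists>r. 0 < r \<and> r \<le> (1/2) ^ n \<and> P r" for n :: nat
  proof -
    have "\<forall>\<^sub>F r::real in at_right 0. r < (1/2) ^ n \<and> 0 < r"
      by (intro eventually_conj eventually_at_right_less order_tendstoD(2)[OF tendsto_ident_at]) auto
    from frequently_eventually_frequently[OF assms this] show ?thesis
      by (auto dest!: frequently_ex intro: less_imp_le)
  qed
  then show thesis using that by metis
qed

lemma eventually_at_right_0_dyadic:
  assumes "\<forall>\<^sub>F r::real in at_right 0. P r"
  shows "\<forall>\<^sub>F n::nat in sequentially. P ((1/2) ^ n)"
proof -
  have "filterlim (\<lambda>n::nat. (1/2::real) ^ n) (at_right 0) sequentially"
    unfolding filterlim_at by (auto intro!: LIMSEQ_power_zero always_eventually)
  with assms show ?thesis unfolding filterlim_iff by blast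
qed

text \<open>The sequence is not assumed monotone. For s below \<open>t N\<close>,
  \<open>Suc n\<close> is taken as the first index from N on at which the sequence is at most
  s.\<close>

lemma eventually_between_null_sequence:
  fixes t :: "nat \<Rightarrow> real"
  assumes "\<And>n. t n > 0" "t \<longlonglongrightarrow> 0"
  shows "\<forall>\<^sub>F s in at_right 0. \<exists>n\<ge>N. t (Suc n) \<le> s \<and> s < t n"
  unfolding eventually_at_right_field
proof (intro exI[of _ "t N"] conjI allI impI)
  fix s assume s: "0 < s" "s < t N"
  from order_tendstoD(2)[OF assms(2) s(1)] obtain m where m: "\<And>n. n \<ge> m \<Longrightarrow> t n < s"
    unfolding eventually_sequentially by blast
  define k where "k = (LEAST k. t (N + k) \<le> s)"
  have ex: "t (N + m) \<le> s" using m[of "N + m"] by simp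
  have k: "t (N + k) \<le> s" unfolding k_def using ex by (rule LeastI)
  have "k \<noteq> 0" using k s by (auto intro: gr0I)
  then obtain j where j: "k = Suc j" by (cases k) auto
  then have "s < t (N + j)" using not_less_Least[of j "\<lambda>k. t (N + k) \<le> s"] unfolding k_def by auto
  with k j show "\<exists>n\<ge>N. t (Suc n) \<le> s \<and> s < t n" by (intro exI[of _ "N + j"]) auto
qed (rule assms)

section \<open>Continuity of u and Markov's inequality\<close>

context additive_process
begin

lemma measurable_incr: "0 \<le> s \<Longrightarrow> 0 \<le> t \<Longrightarrow> (\<lambda>\<omega>. X s \<omega> - X t \<omega>) \<in> borel_measurable M"
  by (intro borel_measurable_diff measurable_X)

text \<open>A jump at t keeps the path, at all late times of a sequence increasing to t, farther
  than some 1/(k+1) from its value at t. For each k and each starting index this has probability 0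
  by continuity in probability, and these are countably many events.\<close>

lemma AE_no_jump:
  assumes t: "t > 0"
  shows "AE \<omega> in M. jump X t \<omega> = 0"
proof -
  define s where "s n = t - t / real (Suc n)" for n
  have s: "0 \<le> s n" "s n < t" for n using t by (auto simp: s_def divide_le_eq)
  have slim: "s \<longlonglongrightarrow> t"
  proof -
    have "(\<lambda>n. t - t * inverse (real (Suc n))) \<longlonglongrightarrow> t - t * 0"
      by (intro tendsto_intros LIMSEQ_inverse_real_of_nat)
    then show ?thesis by (simp add: s_def[abs_def] divide_inverse)
  qed
  define B where "B \<epsilon> m = {\<omega>\<in>space M. \<epsilon> < norm (X (s m) \<omega> - X t \<omega>)}" for \<epsilon> m
  have B: "B \<epsilon> m \<in> events" for \<epsilon> m
    unfolding B_def using measurable_incr[of "s m" t] s t by (auto intro!: borel_measurable_less measurable_compose[OF _ borel_measurable_norm])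
  have null: "(\<Inter>m\<in>{n..}. B \<epsilon> m) \<in> null_sets M" if "\<epsilon> > 0" for n \<epsilon>
  proof -
    have ev: "(\<Inter>m\<in>{n..}. B \<epsilon> m) \<in> events" by (intro countable_Un_Int B) auto
    have "filterlim s (at t within {0..}) sequentially"
      unfolding filterlim_at using slim s less_imp_neq[OF s(2)] by auto
    then have "(\<lambda>m. prob (B \<epsilon> m)) \<longlonglongrightarrow> 0"
      unfolding B_def by (rule filterlim_compose[OF cont_in_prob[OF less_imp_le[OF t] that]])
    moreover have "\<forall>\<^sub>F m in sequentially. prob (\<Inter>m\<in>{n..}. B \<epsilon> m) \<le> prob (B \<epsilon> m)"
      using eventually_ge_at_top[of n] by eventually_elim (intro finite_measure_mono B INT_lower, simp)
    ultimately have "prob (\<Inter>m\<in>{n..}. B \<epsilon> m) \<le> 0" by (rule tendsto_lowerbound) simp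
    then have "prob (\<Inter>m\<in>{n..}. B \<epsilon> m) = 0" using measure_nonneg antisym by blast
    with ev show ?thesis by (simp add: null_sets_def emeasure_eq_measure)
  qed
  have "AE \<omega> in M. \<forall>n k. \<omega> \<notin> (\<Inter>m\<in>{n..}. B (inverse (real (Suc k))) m)"
    unfolding AE_all_countable by (intro allI AE_not_in null) simp
  then show ?thesis
  proof (rule AE_mp, intro AE_I2 impI)
    fix \<omega> assume w: "\<omega> \<in> space M" and no: "\<forall>n k. \<omega> \<notin> (\<Inter>m\<in>{n..}. B (inverse (real (Suc k))) m)"
    show "jump X t \<omega> = 0"
    proof (rule ccontr)
      let ?J = "jump X t \<omega>"
      assume "?J \<noteq> 0"
      then obtain k where k: "inverse (real (Suc k)) < norm ?J / 2"
        using reals_Archimedean[of "norm ?J / 2"] by auto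
      obtain d where d: "d > 0" "\<And>u. 0 \<le> u \<Longrightarrow> t - d < u \<Longrightarrow> u < t \<Longrightarrow> norm (X u \<omega> - (X t \<omega> - ?J)) < norm ?J / 2"
      proof -
        have "norm ?J / 2 > 0" using \<open>?J \<noteq> 0\<close> by simp
        then show thesis
          by (rule local_oscillation[OF w less_imp_le[OF t]]) (rule that; simp)
      qed
      have "\<forall>\<^sub>F m in sequentially. t - d < s m" using slim d(1) by (intro order_tendstoD) auto
      then obtain n where n: "\<And>m. m \<ge> n \<Longrightarrow> t - d < s m" unfolding eventually_sequentially by blast
      have "\<omega> \<in> B (inverse (real (Suc k))) m" if "m \<ge> n" for m
      proof -
        have "norm (X (s m) \<omega> - (X t \<omega> - ?J)) < norm ?J / 2" using s[of m] n[OF that] by (intro d(2))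
        moreover have "norm ?J \<le> norm (X (s m) \<omega> - (X t \<omega> - ?J)) + norm (X (s m) \<omega> - X t \<omega>)"
          using norm_triangle_ineq4[of "X (s m) \<omega> - (X t \<omega> - ?J)" "X (s m) \<omega> - X t \<omega>"] by simp
        ultimately have "inverse (real (Suc k)) < norm (X (s m) \<omega> - X t \<omega>)" using k by linarith
        with w show ?thesis by (simp add: B_def)
      qed
      then have "\<omega> \<in> (\<Inter>m\<in>{n..}. B (inverse (real (Suc k))) m)" by blast
      with no show False by blast
    qed
  qed
qed

lemma run_max_continuous_no_jump:
  assumes w: "\<omega> \<in> space M" and t: "0 \<le> t" "t > 0 \<Longrightarrow> jump X t \<omega> = 0"
  shows "continuous (at t within {0..}) (\<lambda>s. run_max X s \<omega>)"
  unfolding continuous_within_eps_delta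
proof (intro allI impI)
  fix \<epsilon> :: real assume "\<epsilon> > 0"
  obtain d where d: "d > 0"
      "\<And>u. t \<le> u \<Longrightarrow> u < t + d \<Longrightarrow> norm (X u \<omega> - X t \<omega>) < \<epsilon> / 3"
      "\<And>u. 0 \<le> u \<Longrightarrow> t - d < u \<Longrightarrow> u < t \<Longrightarrow> norm (X u \<omega> - (X t \<omega> - jump X t \<omega>)) < \<epsilon> / 3"
    using local_oscillation[OF w t(1), of "\<epsilon> / 3"] \<open>\<epsilon> > 0\<close> by auto
  have close: "norm (X u \<omega> - X t \<omega>) < \<epsilon> / 3" if "0 \<le> u" "\<bar>u - t\<bar> < d" for u
  proof (cases "t \<le> u")
    case True then show ?thesis using d(2)[of u] that by auto
  next
    case False then show ?thesis using d(3)[of u] that t(2) by auto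
  qed
  \<comment> \<open>Only times after a and up to b can raise the maximum, and there the path is
    within 2\<epsilon>/3 of its value at a.\<close>
  have step: "run_max X b \<omega> < run_max X a \<omega> + \<epsilon>" if ab: "0 \<le> a" "a \<le> b" "\<bar>a - t\<bar> < d" "\<bar>b - t\<bar> < d" for a b
  proof -
    have "run_max X b \<omega> \<le> run_max X a \<omega> + 2 * (\<epsilon> / 3)"
    proof (rule run_max_least)
      fix u assume u: "0 \<le> u" "u \<le> b"
      show "norm (X u \<omega>) \<le> run_max X a \<omega> + 2 * (\<epsilon> / 3)"
      proof (cases "u \<le> a")
        case True
        then show ?thesis using run_max_upper[OF w u(1) True] \<open>\<epsilon> > 0\<close> by simp
      next
        case False
        then have "\<bar>u - t\<bar> < d" using u ab by auto
        then have "norm (X u \<omega> - X t \<omega>) < \<epsilon> / 3" "norm (X a \<omega> - X t \<omega>) < \<epsilon> / 3" using close u ab by auto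
        moreover have "norm (X u \<omega>) \<le> norm (X a \<omega>) + norm (X u \<omega> - X t \<omega>) + norm (X a \<omega> - X t \<omega>)"
          using norm_triangle_ineq[of "X a \<omega>" "(X u \<omega> - X t \<omega>) - (X a \<omega> - X t \<omega>)"]
            norm_triangle_ineq4[of "X u \<omega> - X t \<omega>" "X a \<omega> - X t \<omega>"] by simp
        moreover have "norm (X a \<omega>) \<le> run_max X a \<omega>" using ab by (intro run_max_upper w) auto
        ultimately show ?thesis by linarith
      qed
    qed (use ab in auto)
    with \<open>\<epsilon> > 0\<close> show ?thesis by linarith
  qed
  show "\<exists>d>0. \<forall>s\<in>{0..}. dist s t < d \<longrightarrow> dist (run_max X s \<omega>) (run_max X t \<omega>) < \<epsilon>"
  proof (intro exI[of _ d] conjI ballI impI d(1))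
    fix s assume s: "s \<in> {0..}" "dist s t < d"
    show "dist (run_max X s \<omega>) (run_max X t \<omega>) < \<epsilon>"
    proof (cases "s \<le> t")
      case True
      with step[of s t] s d(1) t run_max_mono[OF w, of s t] show ?thesis by (auto simp: dist_real_def)
    next
      case False
      with step[of t s] s d(1) t run_max_mono[OF w, of t s] show ?thesis by (auto simp: dist_real_def)
    qed
  qed
qed

text \<open>The running maximum may jump at random times, but at the fixed time t it is almost
  surely continuous, since a jump there is a null event. Boundedness of e then gives dominated
  convergence.\<close>

lemma a_fun_continuous:
  assumes "normalized e"
  shows "continuous_on {0..} (a_fun M X e)"
  unfolding continuous_on_eq_continuous_within
proof
  interpret e: normalized e by fact
  fix t :: real assume t: "t \<in> {0..}"
  show "continuous (at t within {0..}) (a_fun M X e)"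
    unfolding continuous_within_sequentially
  proof (intro allI impI, elim conjE)
    fix s :: "nat \<Rightarrow> real" assume s: "\<forall>n. s n \<in> {0..}" "s \<longlonglongrightarrow> t"
    have nojump: "AE \<omega> in M. t > 0 \<longrightarrow> jump X t \<omega> = 0"
      using AE_no_jump[of t] by (cases "t > 0") auto
    have "(\<lambda>n. \<integral>\<omega>. e (run_max X (s n) \<omega>) \<partial>M) \<longlonglongrightarrow> (\<integral>\<omega>. e (run_max X t \<omega>) \<partial>M)"
    proof (rule integral_dominated_convergence[where w="\<lambda>_. e 1"])
      show "(\<lambda>\<omega>. e (run_max X t \<omega>)) \<in> borel_measurable M" "(\<lambda>\<omega>. e (run_max X (s n) \<omega>)) \<in> borel_measurable M" for n
        using integrable_run_max[OF assms, of t] integrable_run_max[OF assms, of "s n"] t s by auto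
      show "AE \<omega> in M. norm (e (run_max X (s n) \<omega>)) \<le> e 1" for n
        using s(1) e.le_e1 e.nonneg run_max_nonneg by (intro AE_I2) auto
      show "AE \<omega> in M. (\<lambda>n. e (run_max X (s n) \<omega>)) \<longlonglongrightarrow> e (run_max X t \<omega>)"
        using nojump
      proof (rule AE_mp, intro AE_I2 impI)
        fix \<omega> assume w: "\<omega> \<in> space M" "t > 0 \<longrightarrow> jump X t \<omega> = 0"
        then have "(\<lambda>n. run_max X (s n) \<omega>) \<longlonglongrightarrow> run_max X t \<omega>"
          using run_max_continuous_no_jump[OF w(1), of t] t s unfolding continuous_within_sequentially by (auto simp: comp_def)
        then show "(\<lambda>n. e (run_max X (s n) \<omega>)) \<longlonglongrightarrow> e (run_max X t \<omega>)"
          using run_max_nonneg[OF w(1)] t s(1) by (intro continuous_on_tendsto_compose[OF e.continuous]) auto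
      qed
    qed simp
    then show "(a_fun M X e \<circ> s) \<longlonglongrightarrow> a_fun M X e t" by (simp add: a_fun_def comp_def)
  qed
qed

lemma a_fun_mono:
  assumes "normalized e" "0 \<le> s" "s \<le> t"
  shows "a_fun M X e s \<le> a_fun M X e t"
proof -
  interpret e: normalized e by fact
  show ?thesis unfolding a_fun_def
    using assms by (intro integral_mono integrable_run_max e.monoD run_max_mono run_max_nonneg) auto
qed

lemma a_fun_zero:
  assumes "normalized e" shows "a_fun M X e 0 = 0"
proof -
  interpret e: normalized e by fact
  have "a_fun M X e 0 = (\<integral>\<omega>. 0 \<partial>M)"
    unfolding a_fun_def by (intro Bochner_Integration.integral_cong) (auto simp: run_max_zero e.zero)
  then show ?thesis by simp
qed

lemma prob_run_max_gt:
  assumes "normalized e" "0 \<le> t" "0 < r"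
  shows "prob {\<omega>\<in>space M. r < run_max X t \<omega>} \<le> a_fun M X e t / e r"
proof -
  interpret e: normalized e by fact
  have ev: "{\<omega>\<in>space M. r < run_max X t \<omega>} \<in> events"
    using measurable_run_max[OF assms(2)] by (intro borel_measurable_less) auto
  have "e r * prob {\<omega>\<in>space M. r < run_max X t \<omega>} = (\<integral>\<omega>. e r * indicator {\<omega>\<in>space M. r < run_max X t \<omega>} \<omega> \<partial>M)"
    using ev by simp
  also have "\<dots> \<le> a_fun M X e t"
    unfolding a_fun_def
  proof (rule integral_mono)
    show "integrable M (\<lambda>\<omega>. e r * indicator {\<omega>\<in>space M. r < run_max X t \<omega>} \<omega> :: real)"
      using ev by (intro integrable_mult_right integrable_real_indicator) (auto simp: emeasure_eq_measure)
    show "integrable M (\<lambda>\<omega>. e (run_max X t \<omega>))" using assms by (intro integrable_run_max)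
    fix \<omega> assume "\<omega> \<in> space M"
    then show "e r * indicator {\<omega>\<in>space M. r < run_max X t \<omega>} \<omega> \<le> e (run_max X t \<omega>)"
      using assms e.nonneg[of "run_max X t \<omega>"] run_max_nonneg[of \<omega> t] e.monoD[of r "run_max X t \<omega>"]
      by (auto split: split_indicator)
  qed
  finally show ?thesis using e.pos[OF assms(3)] by (simp add: pos_le_divide_eq mult.commute)
qed

end

section \<open>Borel-Cantelli along sequences of radii and times\<close>

lemma null_sequence_powr:
  fixes r :: "nat \<Rightarrow> real"
  assumes "\<And>n. 0 < r n" "\<And>n. r n \<le> (1/2) ^ n" "\<kappa> > 0"
  shows "(\<lambda>n. r n powr \<kappa>) \<longlonglongrightarrow> 0" "filterlim (\<lambda>n. r n powr (- \<kappa>)) at_top sequentially"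
    "r n powr \<kappa> \<le> ((1/2) powr \<kappa>) ^ n" "(1/2::real) powr \<kappa> < 1"
proof -
  show 1: "(1/2::real) powr \<kappa> < 1" using powr_less_mono2[OF assms(3), of "1/2" 1] by simp
  have le: "r n powr \<kappa> \<le> ((1/2) powr \<kappa>) ^ n" for n
    using powr_mono2[OF less_imp_le[OF assms(3)] less_imp_le[OF assms(1)] assms(2)]
    by (simp add: powr_realpow[symmetric] powr_powr mult.commute)
  then show "r n powr \<kappa> \<le> ((1/2) powr \<kappa>) ^ n" .
  show lim: "(\<lambda>n. r n powr \<kappa>) \<longlonglongrightarrow> 0"
    using le 1 by (intro tendsto_sandwich[OF _ _ tendsto_const LIMSEQ_power_zero[of "(1/2) powr \<kappa>"]] always_eventually) auto
  have "filterlim (\<lambda>n. inverse (r n powr \<kappa>)) at_top sequentially"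
    using lim less_imp_neq[OF assms(1)] by (intro filterlim_inverse_at_top always_eventually) (auto simp: powr_gt_zero)
  then show "filterlim (\<lambda>n. r n powr (- \<kappa>)) at_top sequentially" by (simp add: powr_minus)
qed

lemma ennreal_le_of_inverse:
  fixes V :: ennreal
  assumes "ennreal c \<le> ennreal x * inverse V" "c > 0" "x \<ge> 0"
  shows "V \<le> ennreal (x / c)"
proof (cases V)
  case (real v)
  show ?thesis
  proof (cases "v = 0")
    case False
    with real have "v > 0" by simp
    then have "ennreal c \<le> ennreal (x * inverse v)"
      using assms real by (simp add: inverse_ennreal ennreal_mult)
    then have "c \<le> x * inverse v" using assms \<open>v > 0\<close> by (simp add: ennreal_le_iff)
    then show ?thesis using assms(2) \<open>v > 0\<close> unfolding real(2) by (intro ennreal_leI) (simp add: field_simps)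
  qed (use real in simp)
qed (use assms in simp)

lemma (in prob_space) AE_eventually_not:
  assumes "\<And>n. {\<omega>\<in>space M. P n \<omega>} \<in> events" "\<forall>\<^sub>F n in sequentially. prob {\<omega>\<in>space M. P n \<omega>} \<le> f n" "summable f"
  shows "AE \<omega> in M. \<forall>\<^sub>F n in sequentially. \<not> P n \<omega>"
proof -
  have "summable (\<lambda>n. prob {\<omega>\<in>space M. P n \<omega>})"
    by (rule summable_comparison_test_ev[OF _ assms(3)]) (use assms(2) in \<open>auto elim: eventually_mono\<close>)
  then have "AE \<omega> in M. \<forall>\<^sub>F n in sequentially. \<omega> \<in> space M - {\<omega>\<in>space M. P n \<omega>}"
    by (intro borel_cantelli_AE1 assms(1)) (auto simp: emeasure_eq_measure)
  then show ?thesis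
    by (rule AE_mp) (auto intro!: AE_I2 elim: eventually_mono)
qed

text \<open>The gap \<eta> - \<eta>' is halved: one half is the factor between E and U, which
  reappears as the bound of an exit probability, and the other half survives as the positive
  exponent on the right.\<close>

lemma powr_upper_bound:
  fixes r \<eta> \<eta>' E U :: real
  assumes "0 < r" "0 \<le> \<eta>'" "\<eta>' < \<eta>" "r powr \<eta>' < E" "r powr ((\<eta> - \<eta>') / 2) * E \<le> U"
  shows "U powr (- 1 / \<eta>) * r \<le> r powr ((\<eta> - \<eta>') / (2 * \<eta>))"
proof -
  have "r powr ((\<eta> + \<eta>') / 2) = r powr ((\<eta> - \<eta>') / 2) * r powr \<eta>'"
    by (simp add: powr_add[symmetric] field_simps)
  also have "\<dots> \<le> U" using assms(4,5) mult_left_mono[of "r powr \<eta>'" E "r powr ((\<eta> - \<eta>') / 2)"] by simp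
  finally have "U powr (- 1 / \<eta>) \<le> (r powr ((\<eta> + \<eta>') / 2)) powr (- 1 / \<eta>)"
    using assms by (intro powr_mono2') auto
  then have "U powr (- 1 / \<eta>) * r \<le> r powr ((\<eta> + \<eta>') / 2 * (- 1 / \<eta>)) * r powr 1"
    using assms by (simp add: powr_powr)
  also have "\<dots> = r powr ((\<eta> + \<eta>') / 2 * (- 1 / \<eta>) + 1)" by (simp only: powr_add)
  also have "(\<eta> + \<eta>') / 2 * (- 1 / \<eta>) + 1 = (\<eta> - \<eta>') / (2 * \<eta>)"
    using assms by (simp add: field_simps)
  finally show ?thesis .
qed

lemma powr_lower_eq:
  fixes r \<eta> \<eta>'' :: real
  assumes "0 < r" "0 < \<eta>"
  shows "(r powr \<eta>'') powr (- 1 / \<eta>) * r = r powr (- ((\<eta>'' - \<eta>) / \<eta>))"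
proof -
  have "(r powr \<eta>'') powr (- 1 / \<eta>) * r = r powr (\<eta>'' * (- 1 / \<eta>)) * r powr 1"
    using assms by (simp add: powr_powr)
  also have "\<dots> = r powr (\<eta>'' * (- 1 / \<eta>) + 1)" by (simp only: powr_add)
  also have "\<eta>'' * (- 1 / \<eta>) + 1 = - ((\<eta>'' - \<eta>) / \<eta>)" using assms by (simp add: field_simps)
  finally show ?thesis .
qed

lemma eventually_at_right_0_sequence: "(\<And>n. t n > 0) \<Longrightarrow> t \<longlonglongrightarrow> 0 \<Longrightarrow> filterlim t (at_right (0::real)) sequentially"
  unfolding filterlim_at by (auto intro!: always_eventually simp: less_imp_neq[THEN not_sym])

text \<open>Positivity of u makes the quotient meaningful: if u vanished at some t > 0, the process
  would almost surely stay at 0 up to t, and \<open>u t powr (- 1 / \<eta>)\<close> would be 0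
  because \<open>0 powr x = 0\<close>, so no infinite limit could occur. It also turns small values
  of u into small times.\<close>

locale additive_process_moderate = additive_process M X for M :: "'w measure" and X :: "real \<Rightarrow> 'w \<Rightarrow> 'a :: euclidean_space" +
  fixes e :: "real \<Rightarrow> real"
  assumes e: "normalized e" and a_fun_pos: "t > 0 \<Longrightarrow> a_fun M X e t > 0"
begin

sublocale e: normalized e by (rule e)

abbreviation "u \<equiv> a_fun M X e"

lemma small_time_of_small_u:
  assumes "t > 0" "s \<ge> 0" "u s < u t" shows "s < t"
  using a_fun_mono[OF e, of t s] assms by (cases "s < t") auto

text \<open>Intermediate values between \<open>u 0 = 0\<close> and \<open>u 1\<close>. As u is
  nondecreasing and positive at every a > 0, values tending to 0 force the times below each such
  a.\<close>

lemma exists_times: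
  assumes "x \<longlonglongrightarrow> 0" "\<forall>\<^sub>F n::nat in sequentially. x n > 0"
  obtains t :: "nat \<Rightarrow> real" where "\<And>n. t n > 0" "t \<longlonglongrightarrow> 0" "\<forall>\<^sub>F n in sequentially. u (t n) = x n"
proof -
  \<comment> \<open>The value 1 is a placeholder for the finitely many indices at which the level
    may not be attained.\<close>
  define t where "t n = (if \<exists>s>0. u s = x n then SOME s. s > 0 \<and> u s = x n else 1)" for n
  have t: "t n > 0 \<and> ((\<exists>s>0. u s = x n) \<longrightarrow> u (t n) = x n)" for n
    using someI_ex[of "\<lambda>s. s > 0 \<and> u s = x n"] unfolding t_def by (cases "\<exists>s>0. u s = x n") auto
  have "\<forall>\<^sub>F n in sequentially. x n < u 1" using assms(1) a_fun_pos[of 1] by (intro order_tendstoD) auto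
  with assms(2) have eq: "\<forall>\<^sub>F n in sequentially. u (t n) = x n"
  proof eventually_elim
    case (elim n)
    have "\<exists>s\<ge>0. s \<le> 1 \<and> u s = x n"
      using elim a_fun_zero[OF e] continuous_on_subset[OF a_fun_continuous[OF e], of "{0..1}"]
      by (intro IVT') auto
    then obtain s where s: "s \<ge> 0" "u s = x n" by blast
    with elim a_fun_zero[OF e] have "s \<noteq> 0" by auto
    then have "0 < s" using s(1) by simp
    with s(2) t[of n] show ?case by blast
  qed
  have "t \<longlonglongrightarrow> 0"
  proof (rule order_tendstoI)
    fix a :: real assume "a < 0"
    then show "\<forall>\<^sub>F n in sequentially. a < t n" using t by (auto intro!: always_eventually order_less_trans[of a 0])
  next
    fix a :: real assume "0 < a"
    then have "\<forall>\<^sub>F n in sequentially. x n < u a" using assms(1) a_fun_pos by (intro order_tendstoD) auto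
    with eq show "\<forall>\<^sub>F n in sequentially. t n < a"
    proof eventually_elim
      case (elim n)
      show ?case by (rule small_time_of_small_u) (use t[of n] \<open>0 < a\<close> elim in simp_all)
    qed
  qed
  with t eq that show thesis by blast
qed

text \<open>The value of \<open>u (t n)\<close> is prescribed so that Markov's bound
  \<open>u (t n) / e (r n)\<close> equals \<open>r n powr \<theta>\<close>, which is
  summable.\<close>

lemma upper_sequence:
  assumes r: "\<And>n. 0 < r n" "\<And>n. r n \<le> (1/2) ^ n" and "\<theta> > 0"
  obtains t :: "nat \<Rightarrow> real" where "\<And>n. t n > 0" "t \<longlonglongrightarrow> 0"
    "\<forall>\<^sub>F n in sequentially. u (t n) = r n powr \<theta> * e (r n)"
    "AE \<omega> in M. \<forall>\<^sub>F n in sequentially. run_max X (t n) \<omega> \<le> r n"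
proof -
  have "(\<lambda>n. r n powr \<theta> * e (r n)) \<longlonglongrightarrow> 0"
  proof (rule tendsto_sandwich[OF _ _ tendsto_const])
    show "(\<lambda>n. r n powr \<theta> * e 1) \<longlonglongrightarrow> 0"
      using tendsto_mult_right[OF null_sequence_powr(1)[OF r \<open>\<theta> > 0\<close>], of "e 1"] by simp
    show "\<forall>\<^sub>F n in sequentially. 0 \<le> r n powr \<theta> * e (r n)"
      by (intro always_eventually allI mult_nonneg_nonneg powr_ge_zero e.nonneg less_imp_le r(1))
    show "\<forall>\<^sub>F n in sequentially. r n powr \<theta> * e (r n) \<le> r n powr \<theta> * e 1"
      by (intro always_eventually allI mult_left_mono powr_ge_zero e.le_e1 less_imp_le r(1))
  qed
  moreover have "\<forall>\<^sub>F n in sequentially. r n powr \<theta> * e (r n) > 0"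
  proof (intro always_eventually allI mult_pos_pos)
    fix n show "r n powr \<theta> > 0" "e (r n) > 0" using r(1)[of n] e.pos[of "r n"] by auto
  qed
  ultimately obtain t where t: "\<And>n. t n > 0" "t \<longlonglongrightarrow> 0" "\<forall>\<^sub>F n in sequentially. u (t n) = r n powr \<theta> * e (r n)"
    using exists_times[of "\<lambda>n. r n powr \<theta> * e (r n)"] by metis
  have "AE \<omega> in M. \<forall>\<^sub>F n in sequentially. \<not> r n < run_max X (t n) \<omega>"
  proof (rule AE_eventually_not)
    show "{\<omega> \<in> space M. r n < run_max X (t n) \<omega>} \<in> events" for n
      using measurable_run_max[of "t n"] t(1)[of n] by (intro borel_measurable_less) auto
    show "\<forall>\<^sub>F n in sequentially. prob {\<omega> \<in> space M. r n < run_max X (t n) \<omega>} \<le> ((1/2) powr \<theta>) ^ n"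
      using t(3)
    proof eventually_elim
      case (elim n)
      have "prob {\<omega> \<in> space M. r n < run_max X (t n) \<omega>} \<le> u (t n) / e (r n)"
        by (intro prob_run_max_gt e r less_imp_le t)
      also have "\<dots> = r n powr \<theta>" using elim e.pos[OF r(1)[of n]] by simp
      also have "\<dots> \<le> ((1/2) powr \<theta>) ^ n" by (rule null_sequence_powr(3)[OF r \<open>\<theta> > 0\<close>])
      finally show ?case .
    qed
    show "summable (\<lambda>n. ((1/2) powr \<theta>) ^ n :: real)"
      using null_sequence_powr(4)[OF r \<open>\<theta> > 0\<close>] by (intro summable_geometric) auto
  qed
  then have "AE \<omega> in M. \<forall>\<^sub>F n in sequentially. run_max X (t n) \<omega> \<le> r n" by (simp add: not_less)
  with t that show thesis by blast
qed

text \<open>With \<open>u (t n) = r n powr \<eta>''\<close> the moment bound reads p^m <= (C/c)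
  r_n^\<kappa>, where \<kappa> = \<eta>' - \<eta>''. Taking the m-th root only changes the ratio of
  the dominating geometric series from 2^(-\<kappa>) to its m-th root q.\<close>

lemma lower_sequence:
  assumes r: "\<And>n. 0 < r n" "\<And>n. r n \<le> (1/2) ^ n" and "c > 0" "0 < \<eta>''" "\<eta>'' < \<eta>'"
    and h: "\<forall>\<^sub>F n in sequentially. ennreal c \<le> ennreal (r n powr \<eta>') * h_fun M X e (r n)"
  obtains t :: "nat \<Rightarrow> real" where "\<And>n. t n > 0" "t \<longlonglongrightarrow> 0"
    "\<forall>\<^sub>F n in sequentially. u (t n) = r n powr \<eta>''"
    "AE \<omega> in M. \<forall>\<^sub>F n in sequentially. r n < run_max X (t n) \<omega>"
proof -
  have "\<forall>\<^sub>F n in sequentially. r n powr \<eta>'' > 0"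
  proof (intro always_eventually allI)
    fix n show "r n powr \<eta>'' > 0" using r(1)[of n] by simp
  qed
  from exists_times[OF null_sequence_powr(1)[OF r \<open>0 < \<eta>''\<close>] this]
  obtain t where t: "\<And>n. t n > 0" "t \<longlonglongrightarrow> 0" "\<forall>\<^sub>F n in sequentially. u (t n) = r n powr \<eta>''" by blast
  obtain C :: real and m :: nat where C: "C > 0" "m \<ge> 1" and
    bound: "\<And>t r. t > 0 \<Longrightarrow> 0 < r \<Longrightarrow>
       ennreal (prob {\<omega>\<in>space M. run_max X t \<omega> \<le> r} ^ m * u t) \<le> ennreal C * (ennreal (e r) + EG_int M X e r)"
    by (rule a_fun_bound[OF e]) blast
  define \<kappa> where "\<kappa> = \<eta>' - \<eta>''"
  have \<kappa>: "\<kappa> > 0" using assms by (simp add: \<kappa>_def)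
  define q where "q = root m ((1/2) powr \<kappa>)"
  have q: "0 \<le> q" "q < 1"
    using C null_sequence_powr(4)[OF r \<kappa>] by (auto simp: q_def)
  have "AE \<omega> in M. \<forall>\<^sub>F n in sequentially. \<not> run_max X (t n) \<omega> \<le> r n"
  proof (rule AE_eventually_not)
    show "{\<omega> \<in> space M. run_max X (t n) \<omega> \<le> r n} \<in> events" for n
      using measurable_run_max[of "t n"] t(1)[of n] by (intro borel_measurable_le) auto
    show "\<forall>\<^sub>F n in sequentially. prob {\<omega> \<in> space M. run_max X (t n) \<omega> \<le> r n} \<le> root m (C / c) * q ^ n"
      using t(3) h
    proof eventually_elim
      case (elim n)
      let ?p = "prob {\<omega> \<in> space M. run_max X (t n) \<omega> \<le> r n}"
      have "ennreal (?p ^ m * u (t n)) \<le> ennreal C * (ennreal (e (r n)) + EG_int M X e (r n))"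
        by (rule bound[OF t(1) r(1)])
      also have "\<dots> \<le> ennreal C * ennreal (r n powr \<eta>' / c)"
        using elim(2) \<open>c > 0\<close> unfolding h_fun_def by (intro mult_left_mono ennreal_le_of_inverse) auto
      also have "\<dots> = ennreal (C * (r n powr \<eta>' / c))"
        using C \<open>c > 0\<close> by (intro ennreal_mult[symmetric]) auto
      finally have "?p ^ m * r n powr \<eta>'' \<le> C * (r n powr \<eta>' / c)"
        using C \<open>c > 0\<close> elim(1) by (subst (asm) ennreal_le_iff) auto
      moreover have "r n powr \<eta>' = r n powr \<kappa> * r n powr \<eta>''"
        by (simp add: \<kappa>_def powr_add[symmetric])
      ultimately have "?p ^ m * r n powr \<eta>'' \<le> (C / c * r n powr \<kappa>) * r n powr \<eta>''" by simp
      moreover have "r n powr \<eta>'' > 0" using r(1)[of n] by simp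
      ultimately have "?p ^ m \<le> C / c * r n powr \<kappa>" by (rule mult_right_le_imp_le)
      also have "\<dots> \<le> C / c * ((1/2) powr \<kappa>) ^ n"
        using C \<open>c > 0\<close> by (intro mult_left_mono null_sequence_powr(3)[OF r \<kappa>]) auto
      finally have "root m (?p ^ m) \<le> root m (C / c * ((1/2) powr \<kappa>) ^ n)" using C by simp
      also have "\<dots> = root m (C / c) * q ^ n" unfolding real_root_mult using C by (simp add: real_root_power q_def)
      finally show ?case using C by (simp add: real_root_power_cancel)
    qed
    show "summable (\<lambda>n. root m (C / c) * q ^ n)"
      using q by (intro summable_mult summable_geometric) auto
  qed
  then have "AE \<omega> in M. \<forall>\<^sub>F n in sequentially. r n < run_max X (t n) \<omega>" by (simp add: not_le)
  with t that show thesis by blast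
qed

section \<open>The four limits for a fixed exponent\<close>

abbreviation "ratio \<eta> \<omega> t \<equiv> u t powr (- 1 / \<eta>) * run_max X t \<omega>"

lemma H_less_one: "0 < r \<Longrightarrow> ennreal (r powr \<eta>') * H_fun e r < 1 \<Longrightarrow> r powr \<eta>' < e r"
  unfolding H_fun_def using e.pos[of r]
  by (simp add: inverse_ennreal ennreal_mult[symmetric] ennreal_less_iff divide_inverse[symmetric] flip: ennreal_1)

lemma ratio_small_frequently:
  assumes "\<delta>\<^sub>1 e < ereal \<eta>"
  shows "AE \<omega> in M. \<forall>\<epsilon>>0. \<exists>\<^sub>F t in at_right 0. ratio \<eta> \<omega> t < \<epsilon>"
proof -
  obtain \<eta>' where \<eta>': "0 \<le> \<eta>'" "\<eta>' < \<eta>" and fr: "\<exists>\<^sub>F r in at_right 0. ennreal (r powr \<eta>') * H_fun e r < 1"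
    using assms unfolding \<delta>\<^sub>1_def by (rule liminf_index_less)
  obtain r where r: "\<And>n. 0 < r n" "\<And>n. r n \<le> (1/2) ^ n" "\<And>n. ennreal (r n powr \<eta>') * H_fun e (r n) < 1"
    using frequently_at_right_0_sequence[OF fr] by blast
  have \<theta>: "(\<eta> - \<eta>') / 2 > 0" "(\<eta> - \<eta>') / (2 * \<eta>) > 0" using \<eta>' by auto
  obtain t where t: "\<And>n. t n > 0" "t \<longlonglongrightarrow> 0"
    "\<forall>\<^sub>F n in sequentially. u (t n) = r n powr ((\<eta> - \<eta>') / 2) * e (r n)"
    "AE \<omega> in M. \<forall>\<^sub>F n in sequentially. run_max X (t n) \<omega> \<le> r n"
    using upper_sequence[OF r(1,2) \<theta>(1)] by blast
  from t(4) show ?thesis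
  proof (rule AE_mp, intro AE_I2 impI allI)
    fix \<omega> \<epsilon> assume ev: "\<forall>\<^sub>F n in sequentially. run_max X (t n) \<omega> \<le> r n" and "(\<epsilon>::real) > 0"
    have "\<forall>\<^sub>F n in sequentially. r n powr ((\<eta> - \<eta>') / (2 * \<eta>)) < \<epsilon>"
      using null_sequence_powr(1)[OF r(1,2) \<theta>(2)] \<open>\<epsilon> > 0\<close> by (rule order_tendstoD)
    with ev t(3) have "\<forall>\<^sub>F n in sequentially. ratio \<eta> \<omega> (t n) < \<epsilon>"
    proof eventually_elim
      case (elim n)
      have "ratio \<eta> \<omega> (t n) \<le> u (t n) powr (- 1 / \<eta>) * r n" using elim by (intro mult_left_mono) auto
      also have "\<dots> \<le> r n powr ((\<eta> - \<eta>') / (2 * \<eta>))"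
        using elim by (intro powr_upper_bound[OF r(1) \<eta>' H_less_one[OF r(1,3)]]) simp
      finally show ?case using elim by simp
    qed
    then show "\<exists>\<^sub>F s in at_right 0. ratio \<eta> \<omega> s < \<epsilon>"
      by (intro frequently_filterlim[OF eventually_at_right_0_sequence[OF t(1,2)]] eventually_frequently) auto
  qed
qed

text \<open>Dyadic radii permit interpolation between the times. For s from t_(n+1) up to t_n, the
  maximum is at most its value at t_n and u is at least its value at t_(n+1); the mismatch of
  indices costs the factor r_n / r_(n+1) = 2, whence \<epsilon>/2 in the proof.\<close>

lemma ratio_small_eventually:
  assumes "\<beta>\<^sub>2 e < ereal \<eta>"
  shows "AE \<omega> in M. \<forall>\<epsilon>>0. \<forall>\<^sub>F t in at_right 0. ratio \<eta> \<omega> t < \<epsilon>"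
proof -
  obtain \<eta>' where \<eta>': "0 \<le> \<eta>'" "\<eta>' < \<eta>" and ev: "\<forall>\<^sub>F r in at_right 0. ennreal (r powr \<eta>') * H_fun e r < 1"
    using assms unfolding \<beta>\<^sub>2_def by (rule lim_index_less)
  define r where "r n = (1/2::real) ^ n" for n
  have r: "0 < r n" "r n \<le> (1/2) ^ n" for n by (auto simp: r_def)
  have r3: "\<forall>\<^sub>F n in sequentially. ennreal (r n powr \<eta>') * H_fun e (r n) < 1"
    using eventually_at_right_0_dyadic[OF ev] by (simp add: r_def)
  have \<theta>: "(\<eta> - \<eta>') / 2 > 0" "(\<eta> - \<eta>') / (2 * \<eta>) > 0" using \<eta>' by auto
  obtain t where t: "\<And>n. t n > 0" "t \<longlonglongrightarrow> 0"
    "\<forall>\<^sub>F n in sequentially. u (t n) = r n powr ((\<eta> - \<eta>') / 2) * e (r n)"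
    "AE \<omega> in M. \<forall>\<^sub>F n in sequentially. run_max X (t n) \<omega> \<le> r n"
    using upper_sequence[OF r \<theta>(1)] by blast
  from t(4) show ?thesis
  proof (rule AE_mp, intro AE_I2 impI allI)
    fix \<omega> \<epsilon> assume w: "\<omega> \<in> space M" and ev: "\<forall>\<^sub>F n in sequentially. run_max X (t n) \<omega> \<le> r n" and "(\<epsilon>::real) > 0"
    have "\<forall>\<^sub>F n in sequentially. r n powr ((\<eta> - \<eta>') / (2 * \<eta>)) < \<epsilon> / 2"
      using \<open>\<epsilon> > 0\<close> by (intro order_tendstoD(2)[OF null_sequence_powr(1)[OF r \<theta>(2)]]) simp
    with ev t(3) r3 have "\<forall>\<^sub>F n in sequentially. run_max X (t n) \<omega> \<le> r n \<and> u (t n) = r n powr ((\<eta> - \<eta>') / 2) * e (r n)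
        \<and> ennreal (r n powr \<eta>') * H_fun e (r n) < 1 \<and> r n powr ((\<eta> - \<eta>') / (2 * \<eta>)) < \<epsilon> / 2"
      by eventually_elim blast
    then obtain N where N: "\<And>n. n \<ge> N \<Longrightarrow> run_max X (t n) \<omega> \<le> r n \<and> u (t n) = r n powr ((\<eta> - \<eta>') / 2) * e (r n)
        \<and> ennreal (r n powr \<eta>') * H_fun e (r n) < 1 \<and> r n powr ((\<eta> - \<eta>') / (2 * \<eta>)) < \<epsilon> / 2"
      unfolding eventually_sequentially by blast
    from eventually_between_null_sequence[OF t(1,2), of N]
    show "\<forall>\<^sub>F s in at_right 0. ratio \<eta> \<omega> s < \<epsilon>"
    proof eventually_elim
      case (elim s)
      then obtain n where n: "n \<ge> N" "t (Suc n) \<le> s" "s < t n" by blast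
      have s: "0 < s" using n t(1)[of "Suc n"] by linarith
      have "run_max X s \<omega> \<le> run_max X (t n) \<omega>" using n s by (intro run_max_mono w) auto
      also have "\<dots> \<le> 2 * r (Suc n)" using N[OF n(1)] by (simp add: r_def)
      finally have "ratio \<eta> \<omega> s \<le> u s powr (- 1 / \<eta>) * (2 * r (Suc n))" by (intro mult_left_mono) auto
      also have "\<dots> = 2 * (u s powr (- 1 / \<eta>) * r (Suc n))" by simp
      also have "u s powr (- 1 / \<eta>) * r (Suc n) \<le> r (Suc n) powr ((\<eta> - \<eta>') / (2 * \<eta>))"
      proof (rule powr_upper_bound[OF r(1) \<eta>' H_less_one[OF r(1)]])
        show "ennreal (r (Suc n) powr \<eta>') * H_fun e (r (Suc n)) < 1" using N[of "Suc n"] n by simp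
        show "r (Suc n) powr ((\<eta> - \<eta>') / 2) * e (r (Suc n)) \<le> u s"
          using N[of "Suc n"] n a_fun_mono[OF e, of "t (Suc n)" s] t(1)[of "Suc n"] by simp
      qed
      also have "r (Suc n) powr ((\<eta> - \<eta>') / (2 * \<eta>)) < \<epsilon> / 2" using N[of "Suc n"] n by simp
      finally show ?case by simp
    qed
  qed
qed

lemma ratio_large_frequently:
  assumes "ereal \<eta> < \<beta>\<^sub>1 M X e" "0 < \<eta>"
  shows "AE \<omega> in M. \<forall>B. \<exists>\<^sub>F t in at_right 0. B < ratio \<eta> \<omega> t"
proof -
  obtain \<eta>' c where \<eta>': "\<eta> < \<eta>'" "c > 0" and fr: "\<exists>\<^sub>F r in at_right 0. ennreal c \<le> ennreal (r powr \<eta>') * h_fun M X e r"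
    using assms unfolding \<beta>\<^sub>1_def by (auto elim: less_lim_index)
  obtain r where r: "\<And>n. 0 < r n" "\<And>n. r n \<le> (1/2) ^ n" "\<And>n. ennreal c \<le> ennreal (r n powr \<eta>') * h_fun M X e (r n)"
    using frequently_at_right_0_sequence[OF fr] by blast
  \<comment> \<open>The part \<eta>' - \<eta>'' of the gap yields summable probabilities, the part
    \<eta>'' - \<eta> makes the quotient diverge.\<close>
  obtain \<eta>'' where \<eta>'': "\<eta> < \<eta>''" "\<eta>'' < \<eta>'" using dense \<eta>'(1) by blast
  have pos: "0 < \<eta>''" using \<eta>''(1) assms(2) by simp
  obtain t where t: "\<And>n. t n > 0" "t \<longlonglongrightarrow> 0" "\<forall>\<^sub>F n in sequentially. u (t n) = r n powr \<eta>''"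
    "AE \<omega> in M. \<forall>\<^sub>F n in sequentially. r n < run_max X (t n) \<omega>"
    by (rule lower_sequence[OF r(1,2) \<eta>'(2) pos \<eta>''(2) always_eventually]) (use r(3) in blast)+
  have \<theta>: "(\<eta>'' - \<eta>) / \<eta> > 0" using \<eta>'' assms by simp
  from t(4) show ?thesis
  proof (rule AE_mp, intro AE_I2 impI allI)
    fix \<omega> and B :: real assume ev: "\<forall>\<^sub>F n in sequentially. r n < run_max X (t n) \<omega>"
    have "\<forall>\<^sub>F n in sequentially. B < r n powr (- ((\<eta>'' - \<eta>) / \<eta>))"
      using null_sequence_powr(2)[OF r(1,2) \<theta>] unfolding filterlim_at_top_dense by blast
    with ev t(3) have "\<forall>\<^sub>F n in sequentially. B < ratio \<eta> \<omega> (t n)"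
    proof eventually_elim
      case (elim n)
      have "u (t n) powr (- 1 / \<eta>) * r n \<le> ratio \<eta> \<omega> (t n)" using elim by (intro mult_left_mono) auto
      then show ?case using elim powr_lower_eq[OF r(1) assms(2), of n \<eta>''] by simp
    qed
    then show "\<exists>\<^sub>F s in at_right 0. B < ratio \<eta> \<omega> s"
      by (intro frequently_filterlim[OF eventually_at_right_0_sequence[OF t(1,2)]] eventually_frequently) auto
  qed
qed

text \<open>Interpolation in the opposite direction: for s from t_(n+1) up to t_n, u is at most its
  value at t_n and the maximum is at least its value at t_(n+1). Again the factor 2 is lost, whence
  2B in the proof.\<close>

lemma ratio_large_eventually:
  assumes "ereal \<eta> < \<delta>\<^sub>2 M X e" "0 < \<eta>"
  shows "AE \<omega> in M. \<forall>B. \<forall>\<^sub>F t in at_right 0. B < ratio \<eta> \<omega> t"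
proof -
  obtain \<eta>' c where \<eta>': "\<eta> < \<eta>'" "c > 0" and ev: "\<forall>\<^sub>F r in at_right 0. ennreal c \<le> ennreal (r powr \<eta>') * h_fun M X e r"
    using assms unfolding \<delta>\<^sub>2_def by (auto elim: less_liminf_index)
  define r where "r n = (1/2::real) ^ n" for n
  have r: "0 < r n" "r n \<le> (1/2) ^ n" for n by (auto simp: r_def)
  have r3: "\<forall>\<^sub>F n in sequentially. ennreal c \<le> ennreal (r n powr \<eta>') * h_fun M X e (r n)"
    using eventually_at_right_0_dyadic[OF ev] by (simp add: r_def)
  obtain \<eta>'' where \<eta>'': "\<eta> < \<eta>''" "\<eta>'' < \<eta>'" using dense \<eta>'(1) by blast
  have pos: "0 < \<eta>''" using \<eta>''(1) assms(2) by simp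
  obtain t where t: "\<And>n. t n > 0" "t \<longlonglongrightarrow> 0" "\<forall>\<^sub>F n in sequentially. u (t n) = r n powr \<eta>''"
    "AE \<omega> in M. \<forall>\<^sub>F n in sequentially. r n < run_max X (t n) \<omega>"
    by (rule lower_sequence[OF r \<eta>'(2) pos \<eta>''(2) r3]) blast
  have \<theta>: "(\<eta>'' - \<eta>) / \<eta> > 0" using \<eta>'' assms by simp
  from t(4) show ?thesis
  proof (rule AE_mp, intro AE_I2 impI allI)
    fix \<omega> and B :: real assume w: "\<omega> \<in> space M" and ev: "\<forall>\<^sub>F n in sequentially. r n < run_max X (t n) \<omega>"
    have "\<forall>\<^sub>F n in sequentially. 2 * B < r n powr (- ((\<eta>'' - \<eta>) / \<eta>))"
      using null_sequence_powr(2)[OF r \<theta>] unfolding filterlim_at_top_dense by blast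
    with ev t(3) have "\<forall>\<^sub>F n in sequentially. r n < run_max X (t n) \<omega> \<and> u (t n) = r n powr \<eta>''
        \<and> 2 * B < r n powr (- ((\<eta>'' - \<eta>) / \<eta>))"
      by eventually_elim blast
    then obtain N where N: "\<And>n. n \<ge> N \<Longrightarrow> r n < run_max X (t n) \<omega> \<and> u (t n) = r n powr \<eta>''
        \<and> 2 * B < r n powr (- ((\<eta>'' - \<eta>) / \<eta>))"
      unfolding eventually_sequentially by blast
    from eventually_between_null_sequence[OF t(1,2), of N]
    show "\<forall>\<^sub>F s in at_right 0. B < ratio \<eta> \<omega> s"
    proof eventually_elim
      case (elim s)
      then obtain n where n: "n \<ge> N" "t (Suc n) \<le> s" "s < t n" by blast
      have s: "0 < s" using n t(1)[of "Suc n"] by linarith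
      have "u s \<le> u (t n)" using n s by (intro a_fun_mono e) auto
      then have "(r n powr \<eta>'') powr (- 1 / \<eta>) \<le> u s powr (- 1 / \<eta>)"
        using N[OF n(1)] a_fun_pos[OF s] assms(2) by (intro powr_mono2') auto
      moreover have "r n \<le> 2 * run_max X s \<omega>"
      proof -
        have "r n = 2 * r (Suc n)" by (simp add: r_def)
        also have "r (Suc n) \<le> run_max X (t (Suc n)) \<omega>" using N[of "Suc n"] n by simp
        also have "\<dots> \<le> run_max X s \<omega>" using n t(1)[of "Suc n"] by (intro run_max_mono w) auto
        finally show ?thesis by simp
      qed
      ultimately have "(r n powr \<eta>'') powr (- 1 / \<eta>) * r n \<le> u s powr (- 1 / \<eta>) * (2 * run_max X s \<omega>)"
        using r(1)[of n] by (intro mult_mono) auto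
      then have "2 * B < 2 * ratio \<eta> \<omega> s"
        using N[OF n(1)] powr_lower_eq[OF r(1) assms(2), of n \<eta>''] by simp
      then show ?case by simp
    qed
  qed
qed

text \<open>Near 0 the base u is below 1, so its power with exponent -1/\<eta> decreases as \<eta>
  grows. This monotonicity reduces the uncountably many exponents to the rational ones and thus to a
  single null set.\<close>

lemma ratio_antimono:
  assumes "0 < \<eta>'" "\<eta>' \<le> \<eta>" "\<omega> \<in> space M"
  shows "\<forall>\<^sub>F t in at_right 0. 0 \<le> ratio \<eta> \<omega> t \<and> ratio \<eta> \<omega> t \<le> ratio \<eta>' \<omega> t"
proof -
  have "((\<lambda>t. u t) \<longlongrightarrow> u 0) (at 0 within {0..})"
    using a_fun_continuous[OF e] by (simp add: continuous_on)
  then have "(u \<longlongrightarrow> 0) (at_right 0)"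
    by (simp add: a_fun_zero[OF e] at_within_Ici_at_right)
  then have "\<forall>\<^sub>F t in at_right 0. u t < 1" by (rule order_tendstoD) simp
  moreover have "\<forall>\<^sub>F t in at_right (0::real). 0 < t" by (rule eventually_at_right_less)
  ultimately show ?thesis
  proof eventually_elim
    case (elim t)
    have m: "0 \<le> run_max X t \<omega>" using elim by (intro run_max_nonneg assms) simp
    have "u t powr (- 1 / \<eta>) \<le> u t powr (- 1 / \<eta>')"
      using elim assms a_fun_pos[of t] by (intro powr_mono') (auto simp: field_simps)
    with m show ?case by (auto intro!: mult_right_mono)
  qed
qed

lemma limits_at_zero:
  "AE \<omega> in M. \<forall>\<eta>>0.
     (ereal \<eta> > \<delta>\<^sub>1 e \<longrightarrow> Liminf (at_right 0) (\<lambda>t. ereal (ratio \<eta> \<omega> t)) = 0) \<and>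
     (ereal \<eta> < \<delta>\<^sub>2 M X e \<longrightarrow> Liminf (at_right 0) (\<lambda>t. ereal (ratio \<eta> \<omega> t)) = \<infinity>) \<and>
     (ereal \<eta> > \<beta>\<^sub>2 e \<longrightarrow> Limsup (at_right 0) (\<lambda>t. ereal (ratio \<eta> \<omega> t)) = 0) \<and>
     (ereal \<eta> < \<beta>\<^sub>1 M X e \<longrightarrow> Limsup (at_right 0) (\<lambda>t. ereal (ratio \<eta> \<omega> t)) = \<infinity>)"
proof -
  have "AE \<omega> in M. \<forall>q::rat.
      (\<delta>\<^sub>1 e < ereal (of_rat q) \<longrightarrow> (\<forall>\<epsilon>>0. \<exists>\<^sub>F t in at_right 0. ratio (of_rat q) \<omega> t < \<epsilon>)) \<and>
      (\<beta>\<^sub>2 e < ereal (of_rat q) \<longrightarrow> (\<forall>\<epsilon>>0. \<forall>\<^sub>F t in at_right 0. ratio (of_rat q) \<omega> t < \<epsilon>)) \<and>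
      (ereal (of_rat q) < \<beta>\<^sub>1 M X e \<longrightarrow> 0 < q \<longrightarrow> (\<forall>B. \<exists>\<^sub>F t in at_right 0. B < ratio (of_rat q) \<omega> t)) \<and>
      (ereal (of_rat q) < \<delta>\<^sub>2 M X e \<longrightarrow> 0 < q \<longrightarrow> (\<forall>B. \<forall>\<^sub>F t in at_right 0. B < ratio (of_rat q) \<omega> t))"
    unfolding AE_all_countable AE_conj_iff
    using ratio_small_frequently ratio_small_eventually ratio_large_frequently ratio_large_eventually
    by auto
  then show ?thesis
  proof (rule AE_mp, intro AE_I2 impI allI)
    fix \<omega> \<eta> assume w: "\<omega> \<in> space M" and \<eta>: "(0::real) < \<eta>"
      and all: "\<forall>q::rat.
      (\<delta>\<^sub>1 e < ereal (of_rat q) \<longrightarrow> (\<forall>\<epsilon>>0. \<exists>\<^sub>F t in at_right 0. ratio (of_rat q) \<omega> t < \<epsilon>)) \<and>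
      (\<beta>\<^sub>2 e < ereal (of_rat q) \<longrightarrow> (\<forall>\<epsilon>>0. \<forall>\<^sub>F t in at_right 0. ratio (of_rat q) \<omega> t < \<epsilon>)) \<and>
      (ereal (of_rat q) < \<beta>\<^sub>1 M X e \<longrightarrow> 0 < q \<longrightarrow> (\<forall>B. \<exists>\<^sub>F t in at_right 0. B < ratio (of_rat q) \<omega> t)) \<and>
      (ereal (of_rat q) < \<delta>\<^sub>2 M X e \<longrightarrow> 0 < q \<longrightarrow> (\<forall>B. \<forall>\<^sub>F t in at_right 0. B < ratio (of_rat q) \<omega> t))"
    \<comment> \<open>A rational exponent below \<eta> serves the two limits equal to 0, its
      quotient being the larger one; a rational above \<eta> serves the two infinite limits, its
      quotient being the smaller one.\<close>
    have rat_below: "\<exists>q::rat. x < ereal (of_rat q) \<and> of_rat q < \<eta> \<and> 0 < q" if x: "x < ereal \<eta>" for x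
    proof -
      obtain y where y: "x < ereal y" "y < \<eta>" using ereal_dense2[OF x] by auto
      have "max 0 y < \<eta>" using y \<eta> by simp
      from of_rat_dense[OF this] obtain q where "max 0 y < real_of_rat q" "real_of_rat q < \<eta>" by blast
      with y show ?thesis by (intro exI[of _ q]) (auto intro: less_trans)
    qed
    have rat_above: "\<exists>q::rat. ereal (of_rat q) < x \<and> \<eta> < of_rat q \<and> 0 < q" if x: "ereal \<eta> < x" for x
    proof -
      obtain y where y: "ereal y < x" "\<eta> < y" using ereal_dense2[OF x] by auto
      from of_rat_dense[OF y(2)] obtain q where q: "\<eta> < real_of_rat q" "real_of_rat q < y" by blast
      then have "0 < real_of_rat q" using \<eta> by linarith
      moreover have "ereal (real_of_rat q) < x" using q y less_trans[of "ereal (real_of_rat q)" "ereal y" x] by simp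
      ultimately show ?thesis using q by (intro exI[of _ q]) auto
    qed
    have nonneg: "\<forall>\<^sub>F t in at_right 0. 0 \<le> ratio \<eta> \<omega> t"
      using ratio_antimono[OF \<eta> order_refl w] by (rule eventually_mono) simp
    show "(ereal \<eta> > \<delta>\<^sub>1 e \<longrightarrow> Liminf (at_right 0) (\<lambda>t. ereal (ratio \<eta> \<omega> t)) = 0) \<and>
     (ereal \<eta> < \<delta>\<^sub>2 M X e \<longrightarrow> Liminf (at_right 0) (\<lambda>t. ereal (ratio \<eta> \<omega> t)) = \<infinity>) \<and>
     (ereal \<eta> > \<beta>\<^sub>2 e \<longrightarrow> Limsup (at_right 0) (\<lambda>t. ereal (ratio \<eta> \<omega> t)) = 0) \<and>
     (ereal \<eta> < \<beta>\<^sub>1 M X e \<longrightarrow> Limsup (at_right 0) (\<lambda>t. ereal (ratio \<eta> \<omega> t)) = \<infinity>)"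
    proof (intro conjI impI)
      assume "\<delta>\<^sub>1 e < ereal \<eta>"
      from rat_below[OF this] obtain q :: rat where q: "\<delta>\<^sub>1 e < ereal (of_rat q)" "of_rat q < \<eta>" "0 < q" by blast
      show "Liminf (at_right 0) (\<lambda>t. ereal (ratio \<eta> \<omega> t)) = 0"
      proof (rule ereal_Liminf_eq_0[OF nonneg])
        fix \<epsilon> :: real assume "\<epsilon> > 0"
        with all q(1) have "\<exists>\<^sub>F t in at_right 0. ratio (of_rat q) \<omega> t < \<epsilon>" by blast
        from frequently_eventually_frequently[OF this ratio_antimono[of "of_rat q" \<eta> \<omega>]]
        show "\<exists>\<^sub>F t in at_right 0. ratio \<eta> \<omega> t < \<epsilon>" using q w by (auto elim: frequently_elim1)
      qed
    next
      assume "\<beta>\<^sub>2 e < ereal \<eta>"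
      from rat_below[OF this] obtain q :: rat where q: "\<beta>\<^sub>2 e < ereal (of_rat q)" "of_rat q < \<eta>" "0 < q" by blast
      show "Limsup (at_right 0) (\<lambda>t. ereal (ratio \<eta> \<omega> t)) = 0"
      proof (rule ereal_Limsup_eq_0[OF _ nonneg])
        fix \<epsilon> :: real assume "\<epsilon> > 0"
        with all q(1) have "\<forall>\<^sub>F t in at_right 0. ratio (of_rat q) \<omega> t < \<epsilon>" by blast
        moreover have "\<forall>\<^sub>F t in at_right 0. 0 \<le> ratio \<eta> \<omega> t \<and> ratio \<eta> \<omega> t \<le> ratio (of_rat q) \<omega> t"
          using q w by (intro ratio_antimono) auto
        ultimately show "\<forall>\<^sub>F t in at_right 0. ratio \<eta> \<omega> t < \<epsilon>" by eventually_elim linarith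
      qed simp
    next
      assume "ereal \<eta> < \<delta>\<^sub>2 M X e"
      from rat_above[OF this] obtain q :: rat where q: "ereal (of_rat q) < \<delta>\<^sub>2 M X e" "\<eta> < of_rat q" "0 < q" by blast
      show "Liminf (at_right 0) (\<lambda>t. ereal (ratio \<eta> \<omega> t)) = \<infinity>"
      proof (rule ereal_Liminf_eq_PInf)
        fix B
        from all q have "\<forall>\<^sub>F t in at_right 0. B < ratio (of_rat q) \<omega> t" by blast
        moreover have "\<forall>\<^sub>F t in at_right 0. 0 \<le> ratio (of_rat q) \<omega> t \<and> ratio (of_rat q) \<omega> t \<le> ratio \<eta> \<omega> t"
          using q w \<eta> by (intro ratio_antimono) auto
        ultimately show "\<forall>\<^sub>F t in at_right 0. B < ratio \<eta> \<omega> t" by eventually_elim linarith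
      qed
    next
      assume "ereal \<eta> < \<beta>\<^sub>1 M X e"
      from rat_above[OF this] obtain q :: rat where q: "ereal (of_rat q) < \<beta>\<^sub>1 M X e" "\<eta> < of_rat q" "0 < q" by blast
      show "Limsup (at_right 0) (\<lambda>t. ereal (ratio \<eta> \<omega> t)) = \<infinity>"
      proof (rule ereal_Limsup_eq_PInf)
        fix B
        from all q have fr: "\<exists>\<^sub>F t in at_right 0. B < ratio (of_rat q) \<omega> t" by blast
        have ev: "\<forall>\<^sub>F t in at_right 0. 0 \<le> ratio (of_rat q) \<omega> t \<and> ratio (of_rat q) \<omega> t \<le> ratio \<eta> \<omega> t"
          using q w \<eta> by (intro ratio_antimono) auto
        show "\<exists>\<^sub>F t in at_right 0. B < ratio \<eta> \<omega> t"
          using frequently_eventually_frequently[OF fr ev] by (rule frequently_elim1) linarith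
      qed
    qed
  qed
qed

end

section \<open>Comparison of the indices\<close>

context mono_continuous
begin

text \<open>Unless e stays below 2Y on the whole range, the sublevel set lies between r and a point
  m with e m = 2Y. The factor 2 is there because e may be constant on intervals: the strict
  inequality e l < e m gives l <= m by monotonicity alone.\<close>

lemma emeasure_stieltjes_sublevel:
  assumes "0 \<le> r" "Y > 0"
  shows "emeasure stieltjes {l\<in>{r<..1}. e (max 0 l) \<le> Y} \<le> ennreal (2 * Y)"
proof (cases "r \<le> 1 \<and> e r \<le> Y")
  case False
  have "\<not> e (max 0 l) \<le> Y" if "r < l" "l \<le> 1" for l
    using False that assms(1) monoD[of r l] by auto
  then have "{l\<in>{r<..1}. e (max 0 l) \<le> Y} = {}" by auto
  then show ?thesis by (simp only: emeasure_empty zero_le)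
next
  case True
  define Y' where "Y' = min (2 * Y) (e 1)"
  have er: "e r \<le> e 1" using True assms by (intro monoD) auto
  have "\<exists>m\<ge>r. m \<le> 1 \<and> e m = Y'"
    using True er assms continuous_on_subset[OF continuous, of "{r..1}"]
    by (intro IVT') (auto simp: Y'_def)
  then obtain m where m: "r \<le> m" "m \<le> 1" "e m = Y'" by blast
  have "{l\<in>{r<..1}. e (max 0 l) \<le> Y} \<subseteq> (if e 1 \<le> 2 * Y then {r<..1} else {r<..m})"
  proof
    fix l assume l: "l \<in> {l\<in>{r<..1}. e (max 0 l) \<le> Y}"
    show "l \<in> (if e 1 \<le> 2 * Y then {r<..1} else {r<..m})"
    proof (cases "e 1 \<le> 2 * Y")
      case False
      then have "e l < e m" using l assms m(3) by (auto simp: Y'_def)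
      then have "l \<le> m" using monoD[of m l] m(1) assms by fastforce
      then show ?thesis using False l by auto
    qed (use l in auto)
  qed
  then have "emeasure stieltjes {l\<in>{r<..1}. e (max 0 l) \<le> Y} \<le> emeasure stieltjes (if e 1 \<le> 2 * Y then {r<..1} else {r<..m})"
    by (intro emeasure_mono) auto
  also have "\<dots> \<le> ennreal (2 * Y)"
    using emeasure_stieltjes_Ioc[of r 1] emeasure_stieltjes_Ioc[of r m] True assms m nonneg[of r]
    by (auto intro!: ennreal_leI simp: Y'_def)
  finally show ?thesis .
qed

text \<open>Cut \<open>(r,1]\<close> into the dyadic level sets of \<open>e\<close>.\<close>

lemma nn_integral_powr_stieltjes:
  assumes "q > 1"
  obtains K :: real where "K \<ge> 1"
    "\<And>r. 0 < e r \<Longrightarrow> 0 < r \<Longrightarrow> (\<integral>\<^sup>+l\<in>{r<..1}. ennreal (e l powr (- q)) \<partial>stieltjes) \<le> ennreal (K * e r powr (1 - q))"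
proof -
  define \<gamma> :: real where "\<gamma> = 2 powr (1 - q)"
  have \<gamma>: "0 < \<gamma>" "\<gamma> < 1" using assms powr_less_mono[of "1 - q" 0 "2::real"] by (auto simp: \<gamma>_def)
  \<comment> \<open>4 is the constant 2 of the sublevel bound times the ratio 2 between the upper
    and lower edge of a dyadic level. The geometric series has ratio \<gamma> = 2^(1-q), below 1
    because q > 1.\<close>
  define K where "K = 4 / (1 - \<gamma>)"
  have "(\<integral>\<^sup>+l\<in>{r<..1}. ennreal (e l powr (- q)) \<partial>stieltjes) \<le> ennreal (K * e r powr (1 - q))"
    if a: "0 < e r" and r: "0 < r" for r
  proof -
    \<comment> \<open>These are full sublevel sets and overlap. The overcount is harmless for an
      upper bound: each l is charged to the set of its own dyadic level, and the other terms are
      nonnegative.\<close>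
    define S where "S j = {l\<in>{r<..1}. e (max 0 l) \<le> 2 ^ Suc j * e r}" for j :: nat
    have S: "S j \<in> sets stieltjes" for j
      unfolding S_def by simp
    define b where "b j = (2 ^ j * e r) powr (- q)" for j :: nat
    have "(\<integral>\<^sup>+l\<in>{r<..1}. ennreal (e l powr (- q)) \<partial>stieltjes) \<le> (\<integral>\<^sup>+l. (\<Sum>j. ennreal (b j) * indicator (S j) l) \<partial>stieltjes)"
    proof (rule nn_integral_mono)
      fix l
      show "ennreal (e l powr (- q)) * indicator {r<..1} l \<le> (\<Sum>j. ennreal (b j) * indicator (S j) l)"
      proof (cases "l \<in> {r<..1}")
        case True
        then have el: "e r \<le> e l" using monoD[of r l] r by auto
        obtain n where n: "e l / e r < 2 ^ n" using real_arch_pow[of 2 "e l / e r"] by auto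
        define k where "k = (LEAST n. e l / e r < 2 ^ n)"
        have k: "e l / e r < 2 ^ k" unfolding k_def using n by (rule LeastI)
        have "k \<noteq> 0" using k el a by (auto intro: gr0I)
        then obtain j where j: "k = Suc j" by (cases k) auto
        then have j2: "2 ^ j \<le> e l / e r" using not_less_Least[of j "\<lambda>n. e l / e r < 2 ^ n"] unfolding k_def by auto
        have "l \<in> S j" using True k r a unfolding j by (auto simp: S_def divide_less_eq max_def)
        moreover have "e l powr (- q) \<le> b j"
          unfolding b_def using j2 a assms by (intro powr_mono2') (auto simp: le_divide_eq)
        ultimately have "ennreal (e l powr (- q)) * indicator {r<..1} l \<le> (\<Sum>j\<in>{j}. ennreal (b j) * indicator (S j) l)"
          using True by (simp add: ennreal_leI)
        also have "\<dots> \<le> (\<Sum>j. ennreal (b j) * indicator (S j) l)"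
          by (intro sum_le_suminf) auto
        finally show ?thesis .
      qed simp
    qed
    also have "\<dots> = (\<Sum>j. ennreal (b j) * emeasure stieltjes (S j))"
      using S by (subst nn_integral_suminf) (simp_all add: nn_integral_cmult_indicator del: sets_interval_measure)
    also have "\<dots> \<le> (\<Sum>j. ennreal (4 * e r powr (1 - q) * \<gamma> ^ j))"
    proof (rule suminf_le)
      fix j
      have "ennreal (b j) * emeasure stieltjes (S j) \<le> ennreal (b j) * ennreal (2 * (2 ^ Suc j * e r))"
        unfolding S_def using a r by (intro mult_left_mono emeasure_stieltjes_sublevel) auto
      also have "\<dots> = ennreal (b j * (4 * (2 ^ j * e r)))"
        using a by (simp add: ennreal_mult[symmetric] b_def)
      also have "b j * (4 * (2 ^ j * e r)) = 4 * ((2 ^ j * e r) powr (- q) * (2 ^ j * e r) powr 1)"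
        using a by (simp add: b_def)
      also have "(2 ^ j * e r) powr (- q) * (2 ^ j * e r) powr 1 = (2 ^ j * e r) powr (1 - q)"
        by (simp only: powr_add[symmetric]) simp
      also have "\<dots> = e r powr (1 - q) * \<gamma> ^ j"
        using a by (simp add: powr_mult \<gamma>_def powr_realpow[symmetric] powr_powr mult.commute)
      finally show "ennreal (b j) * emeasure stieltjes (S j) \<le> ennreal (4 * e r powr (1 - q) * \<gamma> ^ j)"
        by (simp add: mult.assoc)
    qed auto
    also have "\<dots> = ennreal (\<Sum>j. 4 * e r powr (1 - q) * \<gamma> ^ j)"
      using \<gamma> by (intro suminf_ennreal2 summable_mult summable_geometric) auto
    also have "(\<Sum>j. 4 * e r powr (1 - q) * \<gamma> ^ j) = K * e r powr (1 - q)"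
      using \<gamma> by (subst suminf_mult) (auto simp: suminf_geometric K_def)
    finally show ?thesis .
  qed
  moreover have "K \<ge> 1" using \<gamma> by (simp add: K_def le_divide_eq)
  ultimately show thesis using that by blast
qed

end

section \<open>Indices under factors that vary slower than every power\<close>

lemma ennreal_Liminf_eq_0_iff:
  fixes f :: "'a \<Rightarrow> ennreal"
  shows "Liminf F f = 0 \<longleftrightarrow> (\<forall>\<epsilon>>0. \<exists>\<^sub>F x in F. f x < \<epsilon>)"
proof (intro iffI allI impI)
  fix \<epsilon> :: ennreal assume "Liminf F f = 0" "\<epsilon> > 0"
  show "\<exists>\<^sub>F x in F. f x < \<epsilon>"
    unfolding frequently_def
  proof
    assume "\<forall>\<^sub>F x in F. \<not> f x < \<epsilon>"
    then have "\<epsilon> \<le> Liminf F f" by (intro Liminf_bounded) (simp add: not_less)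
    with \<open>Liminf F f = 0\<close> \<open>\<epsilon> > 0\<close> show False by simp
  qed
next
  assume *: "\<forall>\<epsilon>>0. \<exists>\<^sub>F x in F. f x < \<epsilon>"
  show "Liminf F f = 0"
  proof (rule ccontr)
    assume "Liminf F f \<noteq> 0"
    then obtain \<epsilon> where "0 < \<epsilon>" "\<epsilon> < Liminf F f" using dense[of 0 "Liminf F f"] by (auto simp: zero_less_iff_neq_zero)
    then have "\<forall>\<^sub>F x in F. \<epsilon> < f x" by (intro less_LiminfD)
    then have "\<forall>\<^sub>F x in F. \<not> f x < \<epsilon>" by (rule eventually_mono) auto
    with * \<open>0 < \<epsilon>\<close> show False unfolding frequently_def by blast
  qed
qed

text \<open>A loss of r^\<kappa> shifts an index by at most \<kappa>, and \<kappa> is arbitrary. In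
  the other direction, the smaller function admits every exponent that the larger one does.\<close>

lemma index_eqI:
  fixes f g :: "real \<Rightarrow> ennreal"
  assumes le: "\<forall>\<^sub>F r in at_right 0. g r \<le> f r"
    and ge: "\<And>\<kappa>. \<kappa> > 0 \<Longrightarrow> \<exists>B>0. \<forall>\<^sub>F r in at_right 0. ennreal (r powr \<kappa>) * f r \<le> ennreal B * g r"
  shows "liminf_index f = liminf_index g" "lim_index f = lim_index g"
proof -
  have le': "\<forall>\<^sub>F r in at_right 0. ennreal (r powr \<eta>) * g r \<le> ennreal (r powr \<eta>) * f r" for \<eta>
    using le by (rule eventually_mono) (rule mult_left_mono, auto)
  have ge': "\<exists>B>0. \<forall>\<^sub>F r in at_right 0. ennreal (r powr (\<eta> + \<kappa>)) * f r \<le> ennreal B * (ennreal (r powr \<eta>) * g r)"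
    if "\<kappa> > 0" for \<eta> \<kappa>
  proof -
    from ge[OF that] obtain B where B: "B > 0" "\<forall>\<^sub>F r in at_right 0. ennreal (r powr \<kappa>) * f r \<le> ennreal B * g r" by blast
    from B(2) have "\<forall>\<^sub>F r in at_right 0. ennreal (r powr (\<eta> + \<kappa>)) * f r \<le> ennreal B * (ennreal (r powr \<eta>) * g r)"
    proof (rule eventually_mono)
      fix r assume "ennreal (r powr \<kappa>) * f r \<le> ennreal B * g r"
      then have "ennreal (r powr \<eta>) * (ennreal (r powr \<kappa>) * f r) \<le> ennreal (r powr \<eta>) * (ennreal B * g r)"
        by (rule mult_left_mono) simp
      then show "ennreal (r powr (\<eta> + \<kappa>)) * f r \<le> ennreal B * (ennreal (r powr \<eta>) * g r)"
        by (simp add: powr_add ennreal_mult mult_ac)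
    qed
    with B show ?thesis by blast
  qed
  have squeeze: "x \<le> ereal \<eta>" if "\<And>\<kappa>. \<kappa> > 0 \<Longrightarrow> x \<le> ereal (\<eta> + \<kappa>)" for x \<eta>
  proof (rule ccontr)
    assume "\<not> x \<le> ereal \<eta>"
    then obtain z where z: "ereal \<eta> < ereal z" "ereal z < x" using ereal_dense2[of "ereal \<eta>" x] by (auto simp: not_le)
    with that[of "z - \<eta>"] show False by simp
  qed
  show "liminf_index f = liminf_index g"
  proof (rule antisym)
    show "liminf_index f \<le> liminf_index g"
      unfolding liminf_index_def[of g]
    proof (rule INF_greatest, rule squeeze)
      fix \<eta> \<kappa> :: real
      assume \<eta>: "\<eta> \<in> {\<eta>. 0 \<le> \<eta> \<and> Liminf (at_right 0) (\<lambda>r. ennreal (r powr \<eta>) * g r) = 0}" and "\<kappa> > 0"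
      from ge'[OF \<open>\<kappa> > 0\<close>] obtain B where B: "B > 0"
        "\<forall>\<^sub>F r in at_right 0. ennreal (r powr (\<eta> + \<kappa>)) * f r \<le> ennreal B * (ennreal (r powr \<eta>) * g r)" by blast
      have "Liminf (at_right 0) (\<lambda>r. ennreal (r powr (\<eta> + \<kappa>)) * f r) = 0"
        unfolding ennreal_Liminf_eq_0_iff
      proof (intro allI impI)
        fix \<epsilon> :: ennreal assume "\<epsilon> > 0"
        then have "\<epsilon> / ennreal B > 0" using B(1) by (simp add: ennreal_zero_less_divide)
        with \<eta> have "\<exists>\<^sub>F r in at_right 0. ennreal (r powr \<eta>) * g r < \<epsilon> / ennreal B"
          by (simp add: ennreal_Liminf_eq_0_iff)
        from frequently_eventually_frequently[OF this B(2)]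
        show "\<exists>\<^sub>F r in at_right 0. ennreal (r powr (\<eta> + \<kappa>)) * f r < \<epsilon>"
        proof (rule frequently_elim1, elim conjE)
          fix r assume "ennreal (r powr \<eta>) * g r < \<epsilon> / ennreal B"
            and *: "ennreal (r powr (\<eta> + \<kappa>)) * f r \<le> ennreal B * (ennreal (r powr \<eta>) * g r)"
          then have "ennreal B * (ennreal (r powr \<eta>) * g r) < ennreal B * (\<epsilon> / ennreal B)"
            using B(1) by (intro ennreal_mult_strict_left_mono) auto
          also have "\<dots> = \<epsilon>" using B(1) by (simp add: ennreal_times_divide mult.commute[of "ennreal B"] ennreal_mult_divide_eq)
          finally show "ennreal (r powr (\<eta> + \<kappa>)) * f r < \<epsilon>" using * by (rule order_le_less_trans[rotated])
        qed
      qed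
      with \<eta> \<open>\<kappa> > 0\<close> show "liminf_index f \<le> ereal (\<eta> + \<kappa>)"
        unfolding liminf_index_def by (intro INF_lower) auto
    qed
    show "liminf_index g \<le> liminf_index f"
      unfolding liminf_index_def
    proof (rule INF_superset_mono)
      show "{\<eta>. 0 \<le> \<eta> \<and> Liminf (at_right 0) (\<lambda>r. ennreal (r powr \<eta>) * f r) = 0}
        \<subseteq> {\<eta>. 0 \<le> \<eta> \<and> Liminf (at_right 0) (\<lambda>r. ennreal (r powr \<eta>) * g r) = 0}"
        using order_trans[OF Liminf_mono[OF le']] by (auto simp flip: le_zero_eq)
    qed simp
  qed
  show "lim_index f = lim_index g"
  proof (rule antisym)
    show "lim_index f \<le> lim_index g"
      unfolding lim_index_def[of g]
    proof (rule INF_greatest, rule squeeze)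
      fix \<eta> \<kappa> :: real
      assume \<eta>: "\<eta> \<in> {\<eta>. 0 \<le> \<eta> \<and> ((\<lambda>r. ennreal (r powr \<eta>) * g r) \<longlongrightarrow> 0) (at_right 0)}" and "\<kappa> > 0"
      from ge'[OF \<open>\<kappa> > 0\<close>] obtain B where B: "B > 0"
        "\<forall>\<^sub>F r in at_right 0. ennreal (r powr (\<eta> + \<kappa>)) * f r \<le> ennreal B * (ennreal (r powr \<eta>) * g r)" by blast
      have "((\<lambda>r. ennreal B * (ennreal (r powr \<eta>) * g r)) \<longlongrightarrow> ennreal B * 0) (at_right 0)"
        using \<eta> by (intro ennreal_tendsto_cmult) auto
      then have "((\<lambda>r. ennreal (r powr (\<eta> + \<kappa>)) * f r) \<longlongrightarrow> 0) (at_right 0)"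
        by (intro tendsto_sandwich[OF _ B(2) tendsto_const]) auto
      with \<eta> \<open>\<kappa> > 0\<close> show "lim_index f \<le> ereal (\<eta> + \<kappa>)"
        unfolding lim_index_def by (intro INF_lower) auto
    qed
    show "lim_index g \<le> lim_index f"
      unfolding lim_index_def
    proof (rule INF_superset_mono)
      show "{\<eta>. 0 \<le> \<eta> \<and> ((\<lambda>r. ennreal (r powr \<eta>) * f r) \<longlongrightarrow> 0) (at_right 0)}
        \<subseteq> {\<eta>. 0 \<le> \<eta> \<and> ((\<lambda>r. ennreal (r powr \<eta>) * g r) \<longlongrightarrow> 0) (at_right 0)}"
        using tendsto_sandwich[OF _ le' tendsto_const] by auto
    qed simp
  qed
qed

lemma slow_eventually_ge:
  assumes "slow c" "\<kappa> > 0"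
  obtains \<epsilon> where "\<epsilon> > 0" "\<forall>\<^sub>F r in at_right 0. \<epsilon> * r powr \<kappa> \<le> c r"
proof -
  have "0 < Liminf (at_right 0) (\<lambda>r. ereal (c r * r powr (- \<kappa>)))" using assms by (simp add: slow_def)
  then obtain \<epsilon> where \<epsilon>: "0 < ereal \<epsilon>" "ereal \<epsilon> < Liminf (at_right 0) (\<lambda>r. ereal (c r * r powr (- \<kappa>)))"
    using ereal_dense2 by blast
  then have "\<forall>\<^sub>F r in at_right 0. ereal \<epsilon> < ereal (c r * r powr (- \<kappa>))" by (intro less_LiminfD)
  moreover have "\<forall>\<^sub>F r in at_right (0::real). 0 < r" by (rule eventually_at_right_less)
  ultimately have "\<forall>\<^sub>F r in at_right 0. \<epsilon> * r powr \<kappa> \<le> c r"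
    by eventually_elim (simp add: powr_minus field_simps)
  with \<epsilon> that show thesis by auto
qed

lemma slow_divide:
  assumes "slow c" "K \<ge> 1" shows "slow (\<lambda>r. c r / K)"
  unfolding slow_def
proof (intro conjI ballI allI impI)
  fix r :: real assume "r \<in> {0<..1}"
  then have "0 < c r" "c r < 1" using assms by (auto simp: slow_def)
  then show "0 < c r / K" "c r / K < 1" using assms by (auto simp: divide_less_eq)
next
  fix \<eta> :: real assume \<eta>: "\<eta> > 0"
  obtain \<epsilon> where \<epsilon>: "\<epsilon> > 0" "\<forall>\<^sub>F r in at_right 0. \<epsilon> * r powr \<eta> \<le> c r"
    using slow_eventually_ge[OF assms(1) \<eta>] by blast
  have "\<forall>\<^sub>F r in at_right (0::real). 0 < r" by (rule eventually_at_right_less)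
  with \<epsilon>(2) have "\<forall>\<^sub>F r in at_right 0. ereal (\<epsilon> / K) \<le> ereal (c r / K * r powr (- \<eta>))"
    by eventually_elim (use assms in \<open>simp add: powr_minus field_simps\<close>)
  then have "ereal (\<epsilon> / K) \<le> Liminf (at_right 0) (\<lambda>r. ereal (c r / K * r powr (- \<eta>)))" by (rule Liminf_bounded)
  moreover have "0 < ereal (\<epsilon> / K)" using \<epsilon> assms by simp
  ultimately show "0 < Liminf (at_right 0) (\<lambda>r. ereal (c r / K * r powr (- \<eta>)))" by (rule less_le_trans[rotated])
qed

lemma ennreal_inverse_antimono: "a \<le> b \<Longrightarrow> inverse b \<le> inverse (a :: ennreal)"
  including ennreal.lifting
  by transfer (auto intro: ereal_inverse_antimono)

text \<open>The inequality h <= H is immediate. Conversely, since c < 1, the bound gives h >= (c/2)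
  H, and a slow c dominates every positive power of r up to a constant, which is a loss that the
  indices tolerate.\<close>

lemma indices_eq_of_slow_bound:
  assumes "slow c" and pos: "\<And>r. r > 0 \<Longrightarrow> e r > 0"
    and bound: "\<forall>r\<in>{0<..<1}. EG_int M X e r \<le> ennreal (inverse (c r) * e r)"
  shows "\<delta>\<^sub>1 e = \<delta>\<^sub>2 M X e" "\<beta>\<^sub>1 M X e = \<beta>\<^sub>2 e"
proof -
  have small: "\<forall>\<^sub>F r in at_right (0::real). 0 < r \<and> r < 1"
    unfolding eventually_at_right_field by (intro exI[of _ 1]) auto
  have le: "\<forall>\<^sub>F r in at_right 0. h_fun M X e r \<le> H_fun e r"
    unfolding h_fun_def H_fun_def by (intro always_eventually allI ennreal_inverse_antimono) simp
  have ge: "\<exists>B>0. \<forall>\<^sub>F r in at_right 0. ennreal (r powr \<kappa>) * H_fun e r \<le> ennreal B * h_fun M X e r" if "\<kappa> > 0" for \<kappa>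
  proof -
    obtain \<epsilon> where \<epsilon>: "\<epsilon> > 0" "\<forall>\<^sub>F r in at_right 0. \<epsilon> * r powr \<kappa> \<le> c r"
      using slow_eventually_ge[OF assms(1) \<open>\<kappa> > 0\<close>] by blast
    have "\<forall>\<^sub>F r in at_right 0. ennreal (r powr \<kappa>) * H_fun e r \<le> ennreal (2 / \<epsilon>) * h_fun M X e r"
      using \<epsilon>(2) small
    proof eventually_elim
      case (elim r)
      have c: "0 < c r" "c r < 1" and e: "e r > 0" using elim assms(1) pos by (auto simp: slow_def)
      have "ennreal (e r) + EG_int M X e r \<le> ennreal (e r) + ennreal (inverse (c r) * e r)"
        using bound elim by (intro add_left_mono) auto
      also have "\<dots> \<le> ennreal (2 / c r * e r)"
      proof -
        have "e r \<le> inverse (c r) * e r" using c e by (simp add: field_simps)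
        then have "e r + inverse (c r) * e r \<le> 2 / c r * e r" by (simp add: divide_inverse mult.commute)
        then show ?thesis using c e by (subst ennreal_plus[symmetric]) (auto intro!: ennreal_leI simp del: ennreal_plus)
      qed
      finally have "inverse (ennreal (2 / c r * e r)) \<le> h_fun M X e r"
        unfolding h_fun_def by (rule ennreal_inverse_antimono)
      then have h: "ennreal (c r / (2 * e r)) \<le> h_fun M X e r"
        using c e by (subst (asm) inverse_ennreal) (auto simp: field_simps)
      have "ennreal (r powr \<kappa>) * H_fun e r = ennreal (r powr \<kappa> / e r)"
        unfolding H_fun_def using e by (simp add: inverse_ennreal ennreal_mult[symmetric] divide_inverse)
      also have "\<dots> \<le> ennreal (2 / \<epsilon> * (c r / (2 * e r)))"
        using elim \<epsilon>(1) e by (intro ennreal_leI) (simp add: field_simps)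
      also have "\<dots> = ennreal (2 / \<epsilon>) * ennreal (c r / (2 * e r))"
        using \<epsilon>(1) c e by (intro ennreal_mult) auto
      also have "\<dots> \<le> ennreal (2 / \<epsilon>) * h_fun M X e r" by (rule mult_left_mono[OF h]) simp
      finally show ?case .
    qed
    moreover have "2 / \<epsilon> > 0" using \<epsilon>(1) by simp
    ultimately show ?thesis by blast
  qed
  show "\<delta>\<^sub>1 e = \<delta>\<^sub>2 M X e" "\<beta>\<^sub>1 M X e = \<beta>\<^sub>2 e"
    unfolding \<delta>\<^sub>1_def \<delta>\<^sub>2_def \<beta>\<^sub>1_def \<beta>\<^sub>2_def using index_eqI[OF le ge] by auto
qed

lemma (in normalized) mono_continuous_powr:
  assumes "p > 0" shows "mono_continuous (\<lambda>x. e x powr p)"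
proof
  show "mono_on {0..} (\<lambda>x. e x powr p)"
    using assms nonneg monoD by (auto simp: mono_on_def intro!: powr_mono2)
  show "continuous_on {0..} (\<lambda>x. e x powr p)"
    using assms nonneg by (intro continuous_on_powr' continuous continuous_on_const) auto
  show "e 0 powr p = 0" by (simp add: zero)
qed

text \<open>In terms of e, with A = e^q, the hypothesis bounds \<open>EG\<close> by e(r)^q e(l)^(-q)
  / c(r). Under the substitution y = e(l) the integral of y^(-q) from e(r) on is of order
  e(r)^(1-q), so the powers combine to e(r), and dividing c by the constant K gives the new slow
  function.\<close>

lemma EG_int_root_bound:
  assumes "slow c" "normalized A" "q > 1"
    and EG: "\<And>r l. 0 < r \<Longrightarrow> r \<le> l \<Longrightarrow> l \<le> 1 \<Longrightarrow> EG M X r l \<le> ennreal (inverse (c r) * (A r / A l))"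
  shows "\<exists>c\<^sub>1. slow c\<^sub>1 \<and> (\<forall>r\<in>{0<..<1}. EG_int M X (\<lambda>x. A x powr (1 / q)) r \<le> ennreal (inverse (c\<^sub>1 r) * A r powr (1 / q)))"
proof -
  interpret A: normalized A by fact
  define e where "e = (\<lambda>x. A x powr (1 / q))"
  interpret e: mono_continuous e
    unfolding e_def using assms(3) by (intro A.mono_continuous_powr) simp
  have e_pos: "e x > 0" if "x > 0" for x using A.pos[OF that] by (simp add: e_def)
  have A_eq: "A x = e x powr q" if "x > 0" for x
    using A.pos[OF that] assms(3) by (simp add: e_def powr_powr)
  obtain K :: real where K: "K \<ge> 1"
    "\<And>r. 0 < e r \<Longrightarrow> 0 < r \<Longrightarrow> (\<integral>\<^sup>+l\<in>{r<..1}. ennreal (e l powr (- q)) \<partial>e.stieltjes) \<le> ennreal (K * e r powr (1 - q))"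
    by (rule e.nn_integral_powr_stieltjes[OF assms(3)]) blast
  have "EG_int M X e r \<le> ennreal (inverse (c r / K) * e r)" if r: "r \<in> {0<..<1}" for r
  proof -
    have c: "c r > 0" and er: "e r > 0" using assms(1) r e_pos by (auto simp: slow_def)
    \<comment> \<open>The majorant is written with \<open>max 0 l\<close> because this extension of
      e is Borel on the whole line, which pulling out the constant factor requires.\<close>
    have "EG_int M X e r \<le> (\<integral>\<^sup>+l. ennreal (inverse (c r) * A r) * (ennreal (e (max 0 l) powr (- q)) * indicator {r<..1} l) \<partial>e.stieltjes)"
      unfolding EG_int_def
    proof (rule nn_integral_mono)
      fix l
      show "EG M X r l * indicator {r<..1} l \<le> ennreal (inverse (c r) * A r) * (ennreal (e (max 0 l) powr (- q)) * indicator {r<..1} l)"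
      proof (cases "l \<in> {r<..1}")
        case True
        then have l: "l > 0" using r by simp
        have "EG M X r l \<le> ennreal (inverse (c r) * (A r / A l))" using True r by (intro EG) auto
        also have "inverse (c r) * (A r / A l) = inverse (c r) * A r * e l powr (- q)"
          by (simp add: A_eq[OF l] powr_minus divide_inverse)
        also have "ennreal \<dots> = ennreal (inverse (c r) * A r) * ennreal (e l powr (- q))"
          using c A.pos[of r] r by (intro ennreal_mult) auto
        finally show ?thesis using True l by (simp add: max_absorb2)
      qed simp
    qed
    also have "\<dots> = ennreal (inverse (c r) * A r) * (\<integral>\<^sup>+l\<in>{r<..1}. ennreal (e (max 0 l) powr (- q)) \<partial>e.stieltjes)"
      by (rule nn_integral_cmult) measurable
    also have "(\<integral>\<^sup>+l\<in>{r<..1}. ennreal (e (max 0 l) powr (- q)) \<partial>e.stieltjes) = (\<integral>\<^sup>+l\<in>{r<..1}. ennreal (e l powr (- q)) \<partial>e.stieltjes)"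
      using r by (intro nn_integral_cong) (auto split: split_indicator simp: max_def)
    also have "ennreal (inverse (c r) * A r) * \<dots> \<le> ennreal (inverse (c r) * A r) * ennreal (K * e r powr (1 - q))"
      using K(2)[OF er] r by (intro mult_left_mono) auto
    also have "\<dots> = ennreal (inverse (c r) * A r * (K * e r powr (1 - q)))"
      using c K(1) A.pos[of r] r by (intro ennreal_mult[symmetric]) auto
    also have "inverse (c r) * A r * (K * e r powr (1 - q)) = inverse (c r / K) * (e r powr q * e r powr (1 - q))"
      using r by (simp add: A_eq field_simps)
    also have "e r powr q * e r powr (1 - q) = e r" using er by (simp add: powr_add[symmetric])
    finally show ?thesis .
  qed
  with slow_divide[OF assms(1) K(1)] show ?thesis unfolding e_def by blast
qed

theorem theorem5p5:
  fixes M :: "'w measure" and X :: "real \<Rightarrow> 'w \<Rightarrow> real ^ 'd"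
  assumes "additive_process M X"
  shows
    "(\<forall>e. normalized_moderate e \<longrightarrow> (\<forall>t>0. a_fun M X e t > 0) \<longrightarrow>
       (AE \<omega> in M. \<forall>\<eta>>0.
          let Y = (\<lambda>t. ereal (a_fun M X e t powr (- 1 / \<eta>) * run_max X t \<omega>)) in
          (ereal \<eta> > \<delta>\<^sub>1 e \<longrightarrow> Liminf (at_right 0) Y = 0) \<and>
          (ereal \<eta> < \<delta>\<^sub>2 M X e \<longrightarrow> Liminf (at_right 0) Y = \<infinity>) \<and>
          (ereal \<eta> > \<beta>\<^sub>2 e \<longrightarrow> Limsup (at_right 0) Y = 0) \<and>
          (ereal \<eta> < \<beta>\<^sub>1 M X e \<longrightarrow> Limsup (at_right 0) Y = \<infinity>)))
     \<and>
     (\<forall>c A q. slow c \<longrightarrow> normalized_moderate A \<longrightarrow> q > 1 \<longrightarrow>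
       (\<forall>r l. 0 < r \<and> r \<le> l \<and> l \<le> 1 \<longrightarrow> EG M X r l \<le> ennreal (inverse (c r) * (A r / A l))) \<longrightarrow>
       (let e = (\<lambda>x. A x powr (1 / q)) in
          (\<exists>c\<^sub>1. slow c\<^sub>1 \<and> (\<forall>r\<in>{0<..<1}. EG_int M X e r \<le> ennreal (inverse (c\<^sub>1 r) * e r))) \<and>
          \<delta>\<^sub>1 e = \<delta>\<^sub>2 M X e \<and> \<beta>\<^sub>1 M X e = \<beta>\<^sub>2 e))"
proof (intro conjI allI impI)
  fix e assume e: "normalized_moderate e" "\<forall>t>0. a_fun M X e t > 0"
  interpret additive_process_moderate M X e
    using assms normalized_moderate_imp_normalized[OF e(1)] e(2)
    by (simp add: additive_process_moderate_def additive_process_moderate_axioms_def)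
  show "AE \<omega> in M. \<forall>\<eta>>0.
          let Y = (\<lambda>t. ereal (a_fun M X e t powr (- 1 / \<eta>) * run_max X t \<omega>)) in
          (ereal \<eta> > \<delta>\<^sub>1 e \<longrightarrow> Liminf (at_right 0) Y = 0) \<and>
          (ereal \<eta> < \<delta>\<^sub>2 M X e \<longrightarrow> Liminf (at_right 0) Y = \<infinity>) \<and>
          (ereal \<eta> > \<beta>\<^sub>2 e \<longrightarrow> Limsup (at_right 0) Y = 0) \<and>
          (ereal \<eta> < \<beta>\<^sub>1 M X e \<longrightarrow> Limsup (at_right 0) Y = \<infinity>)"
    unfolding Let_def by (rule limits_at_zero)
next
  fix c A and q :: real
  assume c: "slow c" and A: "normalized_moderate A" and q: "q > 1"
    and EG: "\<forall>r l. 0 < r \<and> r \<le> l \<and> l \<le> 1 \<longrightarrow> EG M X r l \<le> ennreal (inverse (c r) * (A r / A l))"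
  have nA: "normalized A" by (rule normalized_moderate_imp_normalized[OF A])
  obtain c\<^sub>1 where c1: "slow c\<^sub>1" "\<forall>r\<in>{0<..<1}. EG_int M X (\<lambda>x. A x powr (1 / q)) r \<le> ennreal (inverse (c\<^sub>1 r) * A r powr (1 / q))"
    using EG_int_root_bound[OF c nA q] EG by blast
  have "A r powr (1 / q) > 0" if "r > 0" for r using normalized.pos[OF nA that] by simp
  from c1 indices_eq_of_slow_bound[OF c1(1) this c1(2)]
  show "let e = (\<lambda>x. A x powr (1 / q)) in
          (\<exists>c\<^sub>1. slow c\<^sub>1 \<and> (\<forall>r\<in>{0<..<1}. EG_int M X e r \<le> ennreal (inverse (c\<^sub>1 r) * e r))) \<and>
          \<delta>\<^sub>1 e = \<delta>\<^sub>2 M X e \<and> \<beta>\<^sub>1 M X e = \<beta>\<^sub>2 e"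
    unfolding Let_def by blast
qed

end
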